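(* Let $(\mathscr{G},a_0)$ be a pointed topological groupoid with classifying space $B\mathscr{G}$. Then for every $n\geq 1$ the homotopy group $\pi_n(\mathscr{G},a_0)$ of the pointed topological groupoid (defined below by means of principal bundles) is isomorphic to the $n$-th homotopy group of the space $B\mathscr{G}$ (based at the class of $(1\cdot 1_{a_0},0,0,\ldots)$).
   Context: A topological groupoid $\mathscr{G}$ has spaces $\mathscr{G}_0$ of objects and $\mathscr{G}_1$ of arrows, with all structure maps (source $s$, target $t$, multiplication, inverse, unit $x\mapsto 1_x$) continuous; $gg'$ is defined when $s(g)=t(g')$. A right $\mathscr{G}$-action on a space $X$ along $\epsilon:X\to\mathscr{G}_0$ is a continuous map $\{(x,g)\in X\times\mathscr{G}_1:\epsilon(x)=t(g)\}\to X$, $(x,g)\mapsto xg$, with $\epsilon(xg)=s(g)$, $x1_{\epsilon(x)}=x$, $(xg)g'=x(gg')$. A principal $\mathscr{G}$-bundle over a space $B$ is a space $P$ with a continuous map $\pi:P\to B$ which has local sections (every point of $B$ has an open neighbourhood with a continuous section) and a right $\mathscr{G}$-action along a map $\epsilon:P\to\mathscr{G}_0$, such that $\pi(pg)=\pi(p)$ and $(p,g)\mapsto(p,pg)$ is a homeomorphism $P\times_{\mathscr{G}_0}\mathscr{G}_1\to P\times_B P$. An isomorphism of such bundles is a $\mathscr{G}$-equivariant homeomorphism commuting with $\pi$ and $\epsilon$. For $a_0\in\mathscr{G}_0$ and a pair of spaces $(B,A)$, a principal $(\mathscr{G},a_0)$-bundle over $(B,A)$ is a pair $(P,\sigma)$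 where $P$ is a principal $\mathscr{G}$-bundle over $B$ and $\sigma:A\to P$ is a continuous section of $\pi$ over $A$ with $\epsilon\circ\sigma\equiv a_0$, such that every $b\in B$ has an open neighbourhood $V$ and a continuous section $V\to P$ of $\pi$ agreeing with $\sigma$ on $V\cap A$. Isomorphisms are required to preserve the sections. Two such bundles over $(B,A)$ are homotopic if there is a principal $(\mathscr{G},a_0)$-bundle over $(B\times I,A\times I)$, $I=[0,1]$, whose restrictions to $(B\times\{0\},A\times\{0\})$ and $(B\times\{1\},A\times\{1\})$ are isomorphic to the two given ones. $\pi_n(\mathscr{G},a_0)$ is the set of homotopy classes of principal $(\mathscr{G},a_0)$-bundles over $(I^n,\partial I^n)$. For $n\ge1$ it is a group under concatenation: $(P,\sigma)$ and $(P',\sigma')$ are glued along the unique isomorphism between $P|_{\{1\}\times I^{n-1}}$ and $P'|_{\{0\}\times I^{n-1}}$ respecting the sections, followed by reparametrization of the base. Classifying space (Milnor infinite join): $E\mathscr{G}$ is the set of sequences $(t_1g_1,t_2g_2,\ldots)$ with $t_i\in[0,1]$, only finitely many non-zero, $\sum t_i=1$, $g_i\in\mathscr{G}_1$, $s(g_1)=s(g_2)=\cdots$, where $0g$ is identified with $0g'$ for all $g,g'$; it has the coarsest topology for which the coordinate functions $t_i:E\mathscr{G}\to[0,1]$ and $g_i:t_i^{-1}((0,1])\to\mathscr{G}_1$ are continuous. $\mathscr{G}$ acts on the right by $(t_1g_1,t_2g_2,\ldots)g=(t_1(g_1g),t_2(g_2g),\ldots)$, along the map $(t_1g_1,t_2g_2,\ldots)\mapsto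 s(g_i)$ (for any $i$ with $t_i\neq0$), and $B\mathscr{G}=E\mathscr{G}/\mathscr{G}$ is the orbit space with the quotient topology. *)

theory Defs
  imports "HOL-Analysis.Analysis" "HOL-Algebra.Group"
begin

section \<open>Quotient topologies\<close>

definition quotient_topology :: "'x topology \<Rightarrow> ('x \<Rightarrow> 'y) \<Rightarrow> 'y topology" where
  "quotient_topology X q =
     topology (\<lambda>U. U \<subseteq> q ` topspace X \<and> openin X {x \<in> topspace X. q x \<in> U})"

lemma openin_quotient_topology:
  "openin (quotient_topology X q) U \<longleftrightarrow>
     U \<subseteq> q ` topspace X \<and> openin X {x \<in> topspace X. q x \<in> U}"
proof -
  let ?L = "\<lambda>U. U \<subseteq> q ` topspace X \<and> openin X {x \<in> topspace X. q x \<in> U}"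
  have "istopology ?L"
    unfolding istopology_def
  proof (intro conjI allI impI)
    fix S T
    assume S: "?L S" and T: "?L T"
    show "S \<inter> T \<subseteq> q ` topspace X"
      using S by blast
    have "{x \<in> topspace X. q x \<in> S \<inter> T} =
        {x \<in> topspace X. q x \<in> S} \<inter> {x \<in> topspace X. q x \<in> T}"
      by blast
    with S T show "openin X {x \<in> topspace X. q x \<in> S \<inter> T}"
      by auto
  next
    fix \<K>
    assume K: "Ball \<K> ?L"
    show "\<Union>\<K> \<subseteq> q ` topspace X"
      using K by blast
    have "{x \<in> topspace X. q x \<in> \<Union>\<K>} = (\<Union>U\<in>\<K>. {x \<in> topspace X. q x \<in> U})"
      by blast
    with K show "openin X {x \<in> topspace X. q x \<in> \<Union>\<K>}"
      by auto
  qed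
  then show ?thesis
    by (simp add: quotient_topology_def topology_inverse')
qed

lemma topspace_quotient_topology [simp]:
  "topspace (quotient_topology X q) = q ` topspace X"
proof -
  have "{x \<in> topspace X. q x \<in> q ` topspace X} = topspace X"
    by blast
  then have "openin (quotient_topology X q) (q ` topspace X)"
    by (simp add: openin_quotient_topology)
  then show ?thesis
    by (meson openin_quotient_topology openin_subset openin_topspace subset_antisym)
qed

lemma quotient_map_quotient_topology: "quotient_map X (quotient_topology X q) q"
  by (simp add: quotient_map_def openin_quotient_topology)

section \<open>Topological groupoids and actions\<close>

record ('o, 'a) groupoid_data =
  Obj :: "'o topology"
  Arr :: "'a topology"
  src :: "'a \<Rightarrow> 'o"
  tgt :: "'a \<Rightarrow> 'o"
  gmul :: "'a \<Rightarrow> 'a \<Rightarrow> 'a"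
  ginv :: "'a \<Rightarrow> 'a"
  gid :: "'o \<Rightarrow> 'a"

locale topological_groupoid =
  fixes G :: "('o, 'a) groupoid_data"
  assumes src_cont: "continuous_map (Arr G) (Obj G) (src G)"
    and tgt_cont: "continuous_map (Arr G) (Obj G) (tgt G)"
    and gmul_cont:
      "continuous_map
         (subtopology (prod_topology (Arr G) (Arr G)) {(g, h). src G g = tgt G h})
         (Arr G) (\<lambda>(g, h). gmul G g h)"
    and ginv_cont: "continuous_map (Arr G) (Arr G) (ginv G)"
    and gid_cont: "continuous_map (Obj G) (Arr G) (gid G)"
    and src_gid: "x \<in> topspace (Obj G) \<Longrightarrow> src G (gid G x) = x"
    and tgt_gid: "x \<in> topspace (Obj G) \<Longrightarrow> tgt G (gid G x) = x"
    and src_gmul: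
      "\<lbrakk>g \<in> topspace (Arr G); h \<in> topspace (Arr G); src G g = tgt G h\<rbrakk>
        \<Longrightarrow> src G (gmul G g h) = src G h"
    and tgt_gmul:
      "\<lbrakk>g \<in> topspace (Arr G); h \<in> topspace (Arr G); src G g = tgt G h\<rbrakk>
        \<Longrightarrow> tgt G (gmul G g h) = tgt G g"
    and gmul_assoc:
      "\<lbrakk>g \<in> topspace (Arr G); h \<in> topspace (Arr G); k \<in> topspace (Arr G);
        src G g = tgt G h; src G h = tgt G k\<rbrakk>
        \<Longrightarrow> gmul G (gmul G g h) k = gmul G g (gmul G h k)"
    and gmul_gid_left: "g \<in> topspace (Arr G) \<Longrightarrow> gmul G (gid G (tgt G g)) g = g"
    and gmul_gid_right: "g \<in> topspace (Arr G) \<Longrightarrow> gmul G g (gid G (src G g)) = g"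
    and src_ginv: "g \<in> topspace (Arr G) \<Longrightarrow> src G (ginv G g) = tgt G g"
    and tgt_ginv: "g \<in> topspace (Arr G) \<Longrightarrow> tgt G (ginv G g) = src G g"
    and gmul_ginv_left: "g \<in> topspace (Arr G) \<Longrightarrow> gmul G (ginv G g) g = gid G (src G g)"
    and gmul_ginv_right: "g \<in> topspace (Arr G) \<Longrightarrow> gmul G g (ginv G g) = gid G (tgt G g)"

definition right_action ::
  "('o, 'a) groupoid_data \<Rightarrow> 'p topology \<Rightarrow> ('p \<Rightarrow> 'o) \<Rightarrow> ('p \<Rightarrow> 'a \<Rightarrow> 'p) \<Rightarrow> bool" where
  "right_action G X \<epsilon> \<alpha> \<longleftrightarrow>
     continuous_map X (Obj G) \<epsilon> \<and>
     continuous_map (subtopology (prod_topology X (Arr G)) {(x, g). \<epsilon> x = tgt G g}) X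
       (\<lambda>(x, g). \<alpha> x g) \<and>
     (\<forall>x\<in>topspace X. \<forall>g\<in>topspace (Arr G). \<epsilon> x = tgt G g \<longrightarrow> \<epsilon> (\<alpha> x g) = src G g) \<and>
     (\<forall>x\<in>topspace X. \<alpha> x (gid G (\<epsilon> x)) = x) \<and>
     (\<forall>x\<in>topspace X. \<forall>g\<in>topspace (Arr G). \<forall>h\<in>topspace (Arr G).
        \<epsilon> x = tgt G g \<longrightarrow> src G g = tgt G h \<longrightarrow> \<alpha> (\<alpha> x g) h = \<alpha> x (gmul G g h))"

section \<open>Principal bundles\<close>

record ('p, 'o, 'a, 'b) gbundle =
  tot :: "'p topology"
  proj :: "'p \<Rightarrow> 'b"
  anchor :: "'p \<Rightarrow> 'o"
  act :: "'p \<Rightarrow> 'a \<Rightarrow> 'p"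
  sect :: "'b \<Rightarrow> 'p"

definition local_section ::
  "'b topology \<Rightarrow> ('p, 'o, 'a, 'b) gbundle \<Rightarrow> 'b set \<Rightarrow> ('b \<Rightarrow> 'p) \<Rightarrow> bool" where
  "local_section B P V s \<longleftrightarrow>
     continuous_map (subtopology B V) (tot P) s \<and> (\<forall>x\<in>V. proj P (s x) = x)"

text \<open>The component \<^term>\<open>sect\<close> plays no role here.\<close>

definition principal_bundle ::
  "('o, 'a) groupoid_data \<Rightarrow> 'b topology \<Rightarrow> ('p, 'o, 'a, 'b) gbundle \<Rightarrow> bool" where
  "principal_bundle G B P \<longleftrightarrow>
     continuous_map (tot P) B (proj P) \<and>
     (\<forall>b\<in>topspace B. \<exists>V s. openin B V \<and> b \<in> V \<and> local_section B P V s) \<and>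
     right_action G (tot P) (anchor P) (act P) \<and>
     (\<forall>p\<in>topspace (tot P). \<forall>g\<in>topspace (Arr G).
        anchor P p = tgt G g \<longrightarrow> proj P (act P p g) = proj P p) \<and>
     homeomorphic_map
       (subtopology (prod_topology (tot P) (Arr G)) {(p, g). anchor P p = tgt G g})
       (subtopology (prod_topology (tot P) (tot P)) {(p, p'). proj P p = proj P p'})
       (\<lambda>(p, g). (p, act P p g))"

definition pointed_bundle ::
  "('o, 'a) groupoid_data \<Rightarrow> 'o \<Rightarrow> 'b topology \<Rightarrow> 'b set \<Rightarrow> ('p, 'o, 'a, 'b) gbundle \<Rightarrow> bool" where
  "pointed_bundle G a0 B A P \<longleftrightarrow>
     A \<subseteq> topspace B \<and>
     principal_bundle G B P \<and>
     local_section B P A (sect P) \<and>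
     (\<forall>a\<in>A. anchor P (sect P a) = a0) \<and>
     (\<forall>b\<in>topspace B. \<exists>V s. openin B V \<and> b \<in> V \<and> local_section B P V s \<and>
        (\<forall>a\<in>V \<inter> A. s a = sect P a))"

definition bundle_iso ::
  "('o, 'a) groupoid_data \<Rightarrow> 'b set \<Rightarrow> ('p, 'o, 'a, 'b) gbundle \<Rightarrow> ('q, 'o, 'a, 'b) gbundle
    \<Rightarrow> ('p \<Rightarrow> 'q) \<Rightarrow> bool" where
  "bundle_iso G A P Q \<phi> \<longleftrightarrow>
     homeomorphic_map (tot P) (tot Q) \<phi> \<and>
     (\<forall>p\<in>topspace (tot P). proj Q (\<phi> p) = proj P p) \<and>
     (\<forall>p\<in>topspace (tot P). anchor Q (\<phi> p) = anchor P p) \<and>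
     (\<forall>p\<in>topspace (tot P). \<forall>g\<in>topspace (Arr G).
        anchor P p = tgt G g \<longrightarrow> \<phi> (act P p g) = act Q (\<phi> p) g) \<and>
     (\<forall>a\<in>A. \<phi> (sect P a) = sect Q a)"

text \<open>Restriction of a bundle to the subspace \<open>j ` C\<close> of its base, regarded as a bundle over \<open>C\<close>;
  \<open>j\<close> will be a topological embedding of \<open>C\<close>.\<close>

definition restrict_bundle ::
  "'c set \<Rightarrow> ('c \<Rightarrow> 'b) \<Rightarrow> ('p, 'o, 'a, 'b) gbundle \<Rightarrow> ('p, 'o, 'a, 'c) gbundle" where
  "restrict_bundle C j P =
     \<lparr>tot = subtopology (tot P) {p. proj P p \<in> j ` C},
      proj = inv_into C j \<circ> proj P,
      anchor = anchor P,
      act = act P,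
      sect = sect P \<circ> j\<rparr>"

text \<open>The total space of a homotopy may be any space; it is taken on a set of
  pairs \<open>(b, g)\<close> of a base point and an arrow because every principal bundle over \<open>B\<close> is
  isomorphic to one of this kind: choose a point \<open>p\<^sub>b\<close> in each fibre and
  send \<open>p\<close> to \<open>(\<pi> p, g)\<close>, where \<open>p = p\<^sub>b g\<close> with \<open>b = \<pi> p\<close>.\<close>

definition bundle_homotopic ::
  "('o, 'a) groupoid_data \<Rightarrow> 'o \<Rightarrow> 'b topology \<Rightarrow> 'b set
    \<Rightarrow> ('p, 'o, 'a, 'b) gbundle \<Rightarrow> ('q, 'o, 'a, 'b) gbundle \<Rightarrow> bool" where
  "bundle_homotopic G a0 B A P Q \<longleftrightarrow>
     (\<exists>(H :: (('b \<times> real) \<times> 'a, 'o, 'a, 'b \<times> real) gbundle) \<phi> \<psi>.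
        pointed_bundle G a0 (prod_topology B (top_of_set {0..1})) (A \<times> {0..1}) H \<and>
        bundle_iso G A (restrict_bundle (topspace B) (\<lambda>b. (b, 0)) H) P \<phi> \<and>
        bundle_iso G A (restrict_bundle (topspace B) (\<lambda>b. (b, 1)) H) Q \<psi>)"

definition trivial_bundle ::
  "('o, 'a) groupoid_data \<Rightarrow> 'o \<Rightarrow> 'b topology \<Rightarrow> ('b \<times> 'a, 'o, 'a, 'b) gbundle" where
  "trivial_bundle G a0 B =
     \<lparr>tot = prod_topology B (subtopology (Arr G) {g. tgt G g = a0}),
      proj = fst,
      anchor = (\<lambda>(b, g). src G g),
      act = (\<lambda>(b, g) h. (b, gmul G g h)),
      sect = (\<lambda>b. (b, gid G a0))\<rparr>"

section \<open>Cubes\<close>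

definition cube :: "nat \<Rightarrow> (nat \<Rightarrow> real) topology" where
  "cube n = product_topology (\<lambda>_. top_of_set {0..1}) {..<n}"

definition cube_boundary :: "nat \<Rightarrow> (nat \<Rightarrow> real) set" where
  "cube_boundary n = {x \<in> topspace (cube n). \<exists>i<n. x i = 0 \<or> x i = 1}"

text \<open>For \<open>n \<ge> 1\<close> the first coordinate, numbered \<open>0\<close>, is the direction of concatenation, and
  \<^term>\<open>case_nat u\<close> identifies \<^term>\<open>cube (n - 1)\<close> with the slice \<open>x 0 = u\<close> of \<^term>\<open>cube n\<close>.\<close>

definition to_half :: "bool \<Rightarrow> (nat \<Rightarrow> real) \<Rightarrow> nat \<Rightarrow> real" where
  "to_half k x = x(0 := (x 0 + of_bool k) / 2)"

definition from_half :: "bool \<Rightarrow> (nat \<Rightarrow> real) \<Rightarrow> nat \<Rightarrow> real" where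
  "from_half k x = x(0 := 2 * x 0 - of_bool k)"

section \<open>Homotopy groups of a pointed topological groupoid\<close>

text \<open>The isomorphism between the restrictions of \<open>P\<close> to \<open>x 0 = 1\<close> and of \<open>Q\<close> to \<open>x 0 = 0\<close>;
  it is unique on the total space because it preserves sections defined on the whole base.\<close>

definition face_iso ::
  "('o, 'a) groupoid_data \<Rightarrow> nat \<Rightarrow> ('p, 'o, 'a, nat \<Rightarrow> real) gbundle
    \<Rightarrow> ('q, 'o, 'a, nat \<Rightarrow> real) gbundle \<Rightarrow> 'p \<Rightarrow> 'q" where
  "face_iso G n P Q =
     (SOME \<phi>. bundle_iso G (topspace (cube (n - 1)))
        (restrict_bundle (topspace (cube (n - 1))) (case_nat 1) P)
        (restrict_bundle (topspace (cube (n - 1))) (case_nat 0) Q) \<phi>)"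

text \<open>The disjoint union of \<open>P\<close> (tag \<^term>\<open>False\<close>) and \<open>Q\<close> (tag \<^term>\<open>True\<close>), divided by
  the equivalence relation generated by \<open>(False, p) \<sim> (True, \<phi> p)\<close>. Projection, anchor and
  action do not depend on the chosen representative of a class.\<close>

definition concat_bundle ::
  "('o, 'a) groupoid_data \<Rightarrow> nat \<Rightarrow> ('p, 'o, 'a, nat \<Rightarrow> real) gbundle
    \<Rightarrow> ('p, 'o, 'a, nat \<Rightarrow> real) gbundle \<Rightarrow> ((bool \<times> 'p) set, 'o, 'a, nat \<Rightarrow> real) gbundle" where
  "concat_bundle G n P Q =
     (let \<phi> = face_iso G n P Q;
          piece = (\<lambda>k. if k then Q else P);
          E = {((False, p), (True, \<phi> p)) | p. p \<in> topspace (tot P) \<and> proj P p 0 = 1};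
          q = (\<lambda>z. (E \<union> E\<inverse>)\<^sup>* `` {z});
          rep = (\<lambda>c. SOME z. z \<in> c)
      in \<lparr>tot = quotient_topology (sum_topology (\<lambda>k. tot (piece k)) UNIV) q,
          proj = (\<lambda>c. let (k, p) = rep c in to_half k (proj (piece k) p)),
          anchor = (\<lambda>c. let (k, p) = rep c in anchor (piece k) p),
          act = (\<lambda>c g. let (k, p) = rep c in q (k, act (piece k) p g)),
          sect = (\<lambda>x. let k = (x 0 > 1 / 2) in q (k, sect (piece k) (from_half k x)))\<rparr>)"

text \<open>As above, total spaces on sets of pairs of a base point and an arrow represent all
  isomorphism classes. The glued bundle has a different type, so the product of two classes
  consists of the bundles of the chosen kind that are homotopic to it.\<close>

type_synonym ('o, 'a) cube_bundle = "((nat \<Rightarrow> real) \<times> 'a, 'o, 'a, nat \<Rightarrow> real) gbundle"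

definition cube_bundles ::
  "('o, 'a) groupoid_data \<Rightarrow> 'o \<Rightarrow> nat \<Rightarrow> ('o, 'a) cube_bundle set" where
  "cube_bundles G a0 n = {P. pointed_bundle G a0 (cube n) (cube_boundary n) P}"

definition groupoid_homotopy_group ::
  "('o, 'a) groupoid_data \<Rightarrow> 'o \<Rightarrow> nat \<Rightarrow> ('o, 'a) cube_bundle set monoid" where
  "groupoid_homotopy_group G a0 n =
     \<lparr>carrier = cube_bundles G a0 n //
        {(P, Q). P \<in> cube_bundles G a0 n \<and> Q \<in> cube_bundles G a0 n \<and>
           bundle_homotopic G a0 (cube n) (cube_boundary n) P Q},
      mult = (\<lambda>c d. {R \<in> cube_bundles G a0 n. \<exists>P\<in>c. \<exists>Q\<in>d.
           bundle_homotopic G a0 (cube n) (cube_boundary n) (concat_bundle G n P Q) R}),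
      one = {R \<in> cube_bundles G a0 n.
           bundle_homotopic G a0 (cube n) (cube_boundary n) (trivial_bundle G a0 (cube n)) R}\<rparr>"

section \<open>Homotopy groups of a pointed space\<close>

definition cube_maps :: "nat \<Rightarrow> 'x topology \<Rightarrow> 'x \<Rightarrow> ((nat \<Rightarrow> real) \<Rightarrow> 'x) set" where
  "cube_maps n X x0 = {f. continuous_map (cube n) X f \<and> (\<forall>a\<in>cube_boundary n. f a = x0)}"

definition cube_homotopic ::
  "nat \<Rightarrow> 'x topology \<Rightarrow> 'x \<Rightarrow> ((nat \<Rightarrow> real) \<Rightarrow> 'x) \<Rightarrow> ((nat \<Rightarrow> real) \<Rightarrow> 'x) \<Rightarrow> bool" where
  "cube_homotopic n X x0 = homotopic_with (\<lambda>f. \<forall>a\<in>cube_boundary n. f a = x0) (cube n) X"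

definition concat_map ::
  "((nat \<Rightarrow> real) \<Rightarrow> 'x) \<Rightarrow> ((nat \<Rightarrow> real) \<Rightarrow> 'x) \<Rightarrow> (nat \<Rightarrow> real) \<Rightarrow> 'x" where
  "concat_map f g x = (if x 0 \<le> 1 / 2 then f (from_half False x) else g (from_half True x))"

definition homotopy_group ::
  "nat \<Rightarrow> 'x topology \<Rightarrow> 'x \<Rightarrow> ((nat \<Rightarrow> real) \<Rightarrow> 'x) set monoid" where
  "homotopy_group n X x0 =
     \<lparr>carrier = cube_maps n X x0 //
        {(f, g). f \<in> cube_maps n X x0 \<and> g \<in> cube_maps n X x0 \<and> cube_homotopic n X x0 f g},
      mult = (\<lambda>c d. {h \<in> cube_maps n X x0. \<exists>f\<in>c. \<exists>g\<in>d.
           cube_homotopic n X x0 (concat_map f g) h}),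
      one = {h \<in> cube_maps n X x0. cube_homotopic n X x0 (\<lambda>_. x0) h}\<rparr>"

section \<open>The classifying space\<close>

text \<open>The symbol \<open>t g\<close> of the infinite join: all \<open>0 g\<close> are represented by
  \<^term>\<open>(0, undefined)\<close>.\<close>

definition join_point :: "real \<Rightarrow> 'a \<Rightarrow> real \<times> 'a" where
  "join_point t g = (t, if t = 0 then undefined else g)"

text \<open>The arrows at entries with \<open>t\<^sub>i = 0\<close> are forgotten, so the condition on
  sources only involves the other entries.\<close>

definition milnor_set :: "('o, 'a) groupoid_data \<Rightarrow> (nat \<Rightarrow> real \<times> 'a) set" where
  "milnor_set G =
     {e. (\<forall>i. fst (e i) \<in> {0..1}) \<and>
         finite {i. fst (e i) \<noteq> 0} \<and>
         (\<Sum>i | fst (e i) \<noteq> 0. fst (e i)) = 1 \<and>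
         (\<forall>i. fst (e i) = 0 \<longrightarrow> snd (e i) = undefined) \<and>
         (\<forall>i. fst (e i) \<noteq> 0 \<longrightarrow> snd (e i) \<in> topspace (Arr G)) \<and>
         (\<forall>i j. fst (e i) \<noteq> 0 \<longrightarrow> fst (e j) \<noteq> 0 \<longrightarrow> src G (snd (e i)) = src G (snd (e j)))}"

definition milnor_total :: "('o, 'a) groupoid_data \<Rightarrow> (nat \<Rightarrow> real \<times> 'a) topology" where
  "milnor_total G = topology_generated_by
     ({{e \<in> milnor_set G. fst (e i) \<in> U} | i U. openin (top_of_set {0..1}) U} \<union>
      {{e \<in> milnor_set G. fst (e i) \<in> {0<..1} \<and> snd (e i) \<in> W} | i W. openin (Arr G) W})"

definition milnor_anchor :: "('o, 'a) groupoid_data \<Rightarrow> (nat \<Rightarrow> real \<times> 'a) \<Rightarrow> 'o" where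
  "milnor_anchor G e = src G (snd (e (SOME i. fst (e i) \<noteq> 0)))"

definition milnor_act ::
  "('o, 'a) groupoid_data \<Rightarrow> (nat \<Rightarrow> real \<times> 'a) \<Rightarrow> 'a \<Rightarrow> nat \<Rightarrow> real \<times> 'a" where
  "milnor_act G e g = (\<lambda>i. join_point (fst (e i)) (gmul G (snd (e i)) g))"

definition milnor_orbit ::
  "('o, 'a) groupoid_data \<Rightarrow> (nat \<Rightarrow> real \<times> 'a) \<Rightarrow> (nat \<Rightarrow> real \<times> 'a) set" where
  "milnor_orbit G e = {milnor_act G e g | g. g \<in> topspace (Arr G) \<and> milnor_anchor G e = tgt G g}"

definition classifying_space ::
  "('o, 'a) groupoid_data \<Rightarrow> (nat \<Rightarrow> real \<times> 'a) set topology" where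
  "classifying_space G = quotient_topology (milnor_total G) (milnor_orbit G)"

definition classifying_basepoint ::
  "('o, 'a) groupoid_data \<Rightarrow> 'o \<Rightarrow> (nat \<Rightarrow> real \<times> 'a) set" where
  "classifying_basepoint G a0 =
     milnor_orbit G (\<lambda>i. join_point (if i = 0 then 1 else 0) (gid G a0))"

end

theory Submission
  imports Defs
begin

text \<open>
  The theorem is a classification theorem for principal bundles, made relative to the boundary of
  the cube.

  The orbit map from \<open>E\<G>\<close> to \<open>B\<G>\<close> is a principal bundle (\<open>principal_milnor_bundle\<close>), but the
  base point of \<open>B\<G>\<close> is too small to serve as the place where sections are prescribed. A bundle \<open>P\<close>
  over \<open>(B, A)\<close> with local sections \<open>s\<^sub>i\<close> that extend \<open>\<sigma>\<close> maps to \<open>E\<G>\<close> by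
  \<open>p \<mapsto> (t\<^sub>i g\<^sub>i)\<close>, where \<open>p = s\<^sub>i g\<^sub>i\<close> and the \<open>t\<^sub>i\<close> form a partition of unity; this map sends
  \<open>\<sigma>\<close> into the infinite simplex of all points \<open>(t\<^sub>i 1)\<close>, with \<open>1\<close> the unit of \<open>a\<^sub>0\<close>, and
  rarely to its first vertex. The simplex embeds into \<open>B\<G>\<close>. Let \<open>\<Delta>\<close> be its image. Lifting \<open>\<Delta>\<close> back to
  the simplex makes \<open>E\<G>\<close> a pointed bundle over the pair \<open>(B\<G>, \<Delta>)\<close> (\<open>pointed_milnor_bundle\<close>), and
  for compact completely regular \<open>B\<close> the formula above is a bundle map into it
  (\<open>classifying_map_exists\<close>). Two bundle maps into \<open>E\<G>\<close> are joined by straight lines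
  once their coordinates have been moved to disjoint places (\<open>classifying_map_unique\<close>); on sections
  these lines stay inside the simplex. Hence bundles over \<open>(B, A)\<close> are homotopic exactly when
  their classifying maps are homotopic as maps of pairs \<open>(B, A) \<rightarrow> (B\<G>, \<Delta>)\<close>
  (\<open>bundle_homotopic_of_homotopy\<close>, \<open>homotopy_of_bundle_homotopic\<close>). In particular bundle homotopy is
  transitive, although no homotopies of bundles are glued.

  The simplex contracts to its first vertex. Performing this contraction in a collar of the boundary
  of the cube turns maps into \<open>(B\<G>, \<Delta>)\<close> into maps that are constant on the boundary, so both kinds
  of maps have the same homotopy classes (\<open>collar_1\<close>, \<open>cube_homotopic_phom\<close>).

  For the product, the glued bundle is a pointed bundle even when its section is prescribed on the seam
  as well as on the boundary (\<open>pointed_concat\<close>). A classifying map of it relative to this larger set restricts to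
  classifying maps of both halves, and is therefore their concatenation
  (\<open>concat_classifying\<close>). The group laws are proved for maps of cubes and transported.
\<close>

section \<open>Continuity of maps\<close>

lemma continuous_map_locally:
  assumes "\<And>x. x \<in> topspace X \<Longrightarrow> \<exists>W. openin X W \<and> x \<in> W \<and> continuous_map (subtopology X W) Y f"
  shows "continuous_map X Y f"
proof -
  obtain W where W: "\<And>x. x \<in> topspace X \<Longrightarrow> openin X (W x) \<and> x \<in> W x \<and> continuous_map (subtopology X (W x)) Y f"
    using assms by metis
  show ?thesis
    by (rule pasting_lemma[where I = "topspace X" and T = W and f = "\<lambda>_. f"]) (use W in auto)
qed

lemma continuous_map_compose2:
  assumes "continuous_map X Y f" "continuous_map Z X g"
  shows "continuous_map Z Y (\<lambda>z. f (g z))"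
  using continuous_map_compose[OF assms(2,1)] by (simp add: o_def)

lemma continuous_map_pair_subtopology:
  assumes "continuous_map Z X u" "continuous_map Z Y v" "\<And>z. z \<in> topspace Z \<Longrightarrow> (u z, v z) \<in> S"
  shows "continuous_map Z (subtopology (prod_topology X Y) S) (\<lambda>z. (u z, v z))"
  using assms by (simp add: continuous_map_into_subtopology continuous_map_pairedI image_subset_iff)

lemma continuous_map_subtopology_compose:
  assumes "continuous_map (subtopology X W) Y f" "continuous_map Z X g"
    "\<And>z. z \<in> topspace Z \<Longrightarrow> g z \<in> W"
  shows "continuous_map Z Y (\<lambda>z. f (g z))"
  by (rule continuous_map_compose2[OF assms(1)])
     (use assms in \<open>simp add: continuous_map_into_subtopology image_subset_iff\<close>)

lemma continuous_map_in: "continuous_map X Y f \<Longrightarrow> x \<in> topspace X \<Longrightarrow> f x \<in> topspace Y"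
  using continuous_map_image_subset_topspace by fastforce

section \<open>Arrows and actions\<close>

context topological_groupoid
begin

lemma arr_closed [simp]:
  "g \<in> topspace (Arr G) \<Longrightarrow> src G g \<in> topspace (Obj G)"
  "g \<in> topspace (Arr G) \<Longrightarrow> tgt G g \<in> topspace (Obj G)"
  "g \<in> topspace (Arr G) \<Longrightarrow> ginv G g \<in> topspace (Arr G)"
  "x \<in> topspace (Obj G) \<Longrightarrow> gid G x \<in> topspace (Arr G)"
  using continuous_map_in[OF src_cont] continuous_map_in[OF tgt_cont]
    continuous_map_in[OF ginv_cont] continuous_map_in[OF gid_cont] by auto

lemma gmul_closed [simp]:
  assumes "g \<in> topspace (Arr G)" "h \<in> topspace (Arr G)" "src G g = tgt G h"
  shows "gmul G g h \<in> topspace (Arr G)"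
  using continuous_map_in[OF gmul_cont, of "(g, h)"] assms by simp

lemmas groupoid_simps [simp] = src_gid tgt_gid src_gmul tgt_gmul src_ginv tgt_ginv
  gmul_gid_left gmul_gid_right gmul_ginv_left gmul_ginv_right

lemma ginv_gmul_cancel [simp]:
  assumes "g \<in> topspace (Arr G)" "h \<in> topspace (Arr G)" "src G g = tgt G h"
  shows "gmul G (ginv G g) (gmul G g h) = h"
  using gmul_assoc[of "ginv G g" g h] assms by simp

lemma gmul_ginv_cancel [simp]:
  assumes "g \<in> topspace (Arr G)" "h \<in> topspace (Arr G)" "tgt G g = tgt G h"
  shows "gmul G g (gmul G (ginv G g) h) = h"
  using gmul_assoc[of g "ginv G g" h] assms by simp

lemma ginv_gid: "x \<in> topspace (Obj G) \<Longrightarrow> ginv G (gid G x) = gid G x"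
  by (metis arr_closed(3,4) gmul_gid_right gmul_ginv_left src_gid src_ginv tgt_gid gmul_gid_left tgt_ginv)

lemma continuous_map_gmul:
  assumes "continuous_map Z (Arr G) u" "continuous_map Z (Arr G) v"
    "\<And>z. z \<in> topspace Z \<Longrightarrow> src G (u z) = tgt G (v z)"
  shows "continuous_map Z (Arr G) (\<lambda>z. gmul G (u z) (v z))"
  using continuous_map_compose2[OF gmul_cont continuous_map_pair_subtopology[OF assms(1,2)]] assms(3)
  by simp

lemma continuous_map_act:
  assumes "right_action G X \<epsilon> \<alpha>" "continuous_map Z X u" "continuous_map Z (Arr G) v"
    "\<And>z. z \<in> topspace Z \<Longrightarrow> \<epsilon> (u z) = tgt G (v z)"
  shows "continuous_map Z X (\<lambda>z. \<alpha> (u z) (v z))"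
proof -
  have "continuous_map (subtopology (prod_topology X (Arr G)) {(x, g). \<epsilon> x = tgt G g}) X (\<lambda>(x, g). \<alpha> x g)"
    using assms(1) by (simp add: right_action_def)
  from continuous_map_compose2[OF this continuous_map_pair_subtopology[OF assms(2,3)]] assms(4)
  show ?thesis by simp
qed

lemma act_closed:
  assumes "right_action G X \<epsilon> \<alpha>" "x \<in> topspace X" "g \<in> topspace (Arr G)" "\<epsilon> x = tgt G g"
  shows "\<alpha> x g \<in> topspace X"
proof -
  have "continuous_map (subtopology (prod_topology X (Arr G)) {(x, g). \<epsilon> x = tgt G g}) X (\<lambda>(x, g). \<alpha> x g)"
    using assms(1) by (simp add: right_action_def)
  from continuous_map_in[OF this, of "(x, g)"] assms show ?thesis by simp
qed

end

section \<open>Principal bundles and difference arrows\<close>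

text \<open>The translation function of the bundle: the second component of the inverse of the shear map.\<close>
definition diff_arrow ::
  "('o, 'a) groupoid_data \<Rightarrow> ('p, 'o, 'a, 'b) gbundle \<Rightarrow> 'p \<Rightarrow> 'p \<Rightarrow> 'a" where
  "diff_arrow G P p p' = (THE g. g \<in> topspace (Arr G) \<and> tgt G g = anchor P p \<and> act P p g = p')"

context topological_groupoid
begin

text \<open>The inverse of the shear map \<open>(p, g) \<mapsto> (p, p g)\<close> has the form \<open>(p, p') \<mapsto> (p, d p p')\<close>, so the
  homeomorphism condition amounts to a continuous \<open>d\<close>. The bundles constructed below are verified in this form.\<close>
lemma principal_bundleI:
  assumes proj: "continuous_map (tot P) B (proj P)"
    and loc: "\<And>b. b \<in> topspace B \<Longrightarrow> \<exists>V s. openin B V \<and> b \<in> V \<and> local_section B P V s"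
    and act: "right_action G (tot P) (anchor P) (act P)"
    and inv: "\<And>p g. \<lbrakk>p \<in> topspace (tot P); g \<in> topspace (Arr G); anchor P p = tgt G g\<rbrakk>
          \<Longrightarrow> proj P (act P p g) = proj P p"
    and d: "continuous_map (subtopology (prod_topology (tot P) (tot P)) {(p, p'). proj P p = proj P p'})
          (Arr G) (\<lambda>(p, p'). d p p')"
    and d_tgt: "\<And>p p'. \<lbrakk>p \<in> topspace (tot P); p' \<in> topspace (tot P); proj P p = proj P p'\<rbrakk>
          \<Longrightarrow> tgt G (d p p') = anchor P p"
    and d_act: "\<And>p p'. \<lbrakk>p \<in> topspace (tot P); p' \<in> topspace (tot P); proj P p = proj P p'\<rbrakk>
          \<Longrightarrow> act P p (d p p') = p'"
    and act_d: "\<And>p g. \<lbrakk>p \<in> topspace (tot P); g \<in> topspace (Arr G); anchor P p = tgt G g\<rbrakk>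
          \<Longrightarrow> d p (act P p g) = g"
  shows "principal_bundle G B P"
proof -
  let ?X = "subtopology (prod_topology (tot P) (Arr G)) {(p, g). anchor P p = tgt G g}"
  let ?Y = "subtopology (prod_topology (tot P) (tot P)) {(p, p'). proj P p = proj P p'}"
  have d_cl: "d p p' \<in> topspace (Arr G)" if "p \<in> topspace (tot P)" "p' \<in> topspace (tot P)" "proj P p = proj P p'" for p p'
    using continuous_map_in[OF d, of "(p, p')"] that by simp
  have f: "continuous_map ?X (tot P) fst" and s: "continuous_map ?X (Arr G) snd"
    by (auto intro: continuous_map_from_subtopology continuous_map_fst continuous_map_snd)
  have 1: "continuous_map ?X ?Y (\<lambda>z. (fst z, act P (fst z) (snd z)))"
    by (intro continuous_map_pair_subtopology f continuous_map_act[OF act f s])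
       (use inv in auto)
  have "continuous_map ?Y (tot P) fst"
    by (auto intro: continuous_map_from_subtopology continuous_map_fst)
  then have 2: "continuous_map ?Y ?X (\<lambda>z. (fst z, (\<lambda>(p, p'). d p p') z))"
    by (intro continuous_map_pair_subtopology d) (use d_tgt in auto)
  have "homeomorphic_maps ?X ?Y (\<lambda>z. (fst z, act P (fst z) (snd z))) (\<lambda>z. (fst z, (\<lambda>(p, p'). d p p') z))"
    unfolding homeomorphic_maps_def using 1 2 d_act act_d by auto
  then have "homeomorphic_map ?X ?Y (\<lambda>(p, g). (p, act P p g))"
    using homeomorphic_maps_map by (auto simp: case_prod_unfold)
  then show ?thesis
    unfolding principal_bundle_def using assms by auto
qed

lemma principal_bundleD:
  assumes "principal_bundle G B P"
  shows "continuous_map (tot P) B (proj P)"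
    and "b \<in> topspace B \<Longrightarrow> \<exists>V s. openin B V \<and> b \<in> V \<and> local_section B P V s"
    and "right_action G (tot P) (anchor P) (act P)"
    and "p \<in> topspace (tot P) \<Longrightarrow> proj P p \<in> topspace B"
    and "p \<in> topspace (tot P) \<Longrightarrow> anchor P p \<in> topspace (Obj G)"
    and "continuous_map (tot P) (Obj G) (anchor P)"
    and "p \<in> topspace (tot P) \<Longrightarrow> g \<in> topspace (Arr G) \<Longrightarrow> anchor P p = tgt G g \<Longrightarrow> act P p g \<in> topspace (tot P)"
    and "p \<in> topspace (tot P) \<Longrightarrow> g \<in> topspace (Arr G) \<Longrightarrow> anchor P p = tgt G g \<Longrightarrow> proj P (act P p g) = proj P p"
    and "p \<in> topspace (tot P) \<Longrightarrow> g \<in> topspace (Arr G) \<Longrightarrow> anchor P p = tgt G g \<Longrightarrow> anchor P (act P p g) = src G g"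
    and "p \<in> topspace (tot P) \<Longrightarrow> act P p (gid G (anchor P p)) = p"
    and "\<lbrakk>p \<in> topspace (tot P); g \<in> topspace (Arr G); h \<in> topspace (Arr G); anchor P p = tgt G g; src G g = tgt G h\<rbrakk>
        \<Longrightarrow> act P (act P p g) h = act P p (gmul G g h)"
proof -
  show c: "continuous_map (tot P) B (proj P)" and r: "right_action G (tot P) (anchor P) (act P)"
    using assms by (auto simp: principal_bundle_def)
  show "b \<in> topspace B \<Longrightarrow> \<exists>V s. openin B V \<and> b \<in> V \<and> local_section B P V s"
    using assms by (auto simp: principal_bundle_def)
  show "p \<in> topspace (tot P) \<Longrightarrow> proj P p \<in> topspace B"
    using continuous_map_in[OF c] by simp
  show c2: "continuous_map (tot P) (Obj G) (anchor P)"
    using r by (auto simp: right_action_def)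
  show "p \<in> topspace (tot P) \<Longrightarrow> anchor P p \<in> topspace (Obj G)"
    using continuous_map_in[OF c2] by simp
  show "p \<in> topspace (tot P) \<Longrightarrow> g \<in> topspace (Arr G) \<Longrightarrow> anchor P p = tgt G g \<Longrightarrow> act P p g \<in> topspace (tot P)"
    by (rule act_closed[OF r])
qed (use assms in \<open>auto simp: principal_bundle_def right_action_def\<close>)

lemma diff_arrow:
  assumes P: "principal_bundle G B P" and p: "p \<in> topspace (tot P)" "p' \<in> topspace (tot P)" "proj P p = proj P p'"
  shows "diff_arrow G P p p' \<in> topspace (Arr G)" "tgt G (diff_arrow G P p p') = anchor P p"
    "act P p (diff_arrow G P p p') = p'" "src G (diff_arrow G P p p') = anchor P p'"
proof -
  let ?X = "subtopology (prod_topology (tot P) (Arr G)) {(p, g). anchor P p = tgt G g}"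
  let ?Y = "subtopology (prod_topology (tot P) (tot P)) {(p, p'). proj P p = proj P p'}"
  have h: "homeomorphic_map ?X ?Y (\<lambda>(p, g). (p, act P p g))"
    using P by (simp add: principal_bundle_def)
  have "(p, p') \<in> (\<lambda>(p, g). (p, act P p g)) ` topspace ?X"
    using homeomorphic_imp_surjective_map[OF h] p by auto
  then obtain g where g: "g \<in> topspace (Arr G)" "tgt G g = anchor P p" "act P p g = p'"
    by auto
  have "h = g" if "h \<in> topspace (Arr G)" "tgt G h = anchor P p" "act P p h = p'" for h
    using inj_onD[OF homeomorphic_imp_injective_map[OF h], of "(p, h)" "(p, g)"] that g p by simp
  then have *: "diff_arrow G P p p' = g"
    unfolding diff_arrow_def using g by blast
  show "diff_arrow G P p p' \<in> topspace (Arr G)" "tgt G (diff_arrow G P p p') = anchor P p"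
    "act P p (diff_arrow G P p p') = p'" "src G (diff_arrow G P p p') = anchor P p'"
    using * g principal_bundleD(9)[OF P p(1), of g] by auto
qed

lemma diff_arrow_act:
  assumes P: "principal_bundle G B P" and p: "p \<in> topspace (tot P)" "g \<in> topspace (Arr G)" "anchor P p = tgt G g"
  shows "diff_arrow G P p (act P p g) = g"
proof -
  let ?X = "subtopology (prod_topology (tot P) (Arr G)) {(p, g). anchor P p = tgt G g}"
  let ?Y = "subtopology (prod_topology (tot P) (tot P)) {(p, p'). proj P p = proj P p'}"
  have h: "homeomorphic_map ?X ?Y (\<lambda>(p, g). (p, act P p g))"
    using P by (simp add: principal_bundle_def)
  have "h = g" if "h \<in> topspace (Arr G)" "tgt G h = anchor P p" "act P p h = act P p g" for h
    using inj_onD[OF homeomorphic_imp_injective_map[OF h], of "(p, h)" "(p, g)"] that p by simp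
  then show ?thesis
    unfolding diff_arrow_def using p by (intro the_equality) auto
qed

lemma diff_arrow_eqI:
  assumes "principal_bundle G B P" "p \<in> topspace (tot P)" "g \<in> topspace (Arr G)" "anchor P p = tgt G g"
   "act P p g = p'"
  shows "diff_arrow G P p p' = g"
  using diff_arrow_act assms by metis

lemma continuous_map_diff_arrow:
  assumes P: "principal_bundle G B P"
    and uv: "continuous_map Z (tot P) u" "continuous_map Z (tot P) v"
      "\<And>z. z \<in> topspace Z \<Longrightarrow> proj P (u z) = proj P (v z)"
  shows "continuous_map Z (Arr G) (\<lambda>z. diff_arrow G P (u z) (v z))"
proof -
  let ?X = "subtopology (prod_topology (tot P) (Arr G)) {(p, g). anchor P p = tgt G g}"
  let ?Y = "subtopology (prod_topology (tot P) (tot P)) {(p, p'). proj P p = proj P p'}"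
  have h: "homeomorphic_map ?X ?Y (\<lambda>(p, g). (p, act P p g))"
    using P by (simp add: principal_bundle_def)
  then obtain k where k: "homeomorphic_maps ?X ?Y (\<lambda>(p, g). (p, act P p g)) k"
    by (meson homeomorphic_map_maps)
  have kc: "continuous_map ?Y ?X k"
    using k by (simp add: homeomorphic_maps_def)
  have "snd (k (p, p')) = diff_arrow G P p p'" if "(p, p') \<in> topspace ?Y" for p p'
  proof -
    have "k (p, p') \<in> topspace ?X" "(\<lambda>(p, g). (p, act P p g)) (k (p, p')) = (p, p')"
      using continuous_map_in[OF kc that] k that by (auto simp: homeomorphic_maps_def)
    then show ?thesis
      using diff_arrow_eqI[OF P, of p "snd (k (p, p'))" p'] by (auto simp: case_prod_unfold)
  qed
  moreover have "continuous_map ?Y (Arr G) (\<lambda>z. snd (k z))"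
    by (intro continuous_map_compose2[OF _ kc] continuous_map_from_subtopology continuous_map_snd)
  ultimately have *: "continuous_map ?Y (Arr G) (\<lambda>z. diff_arrow G P (fst z) (snd z))"
    by (rule_tac continuous_map_eq[where f = "\<lambda>z. snd (k z)"]) auto
  show ?thesis
    using continuous_map_compose2[OF * continuous_map_pair_subtopology[OF uv(1,2)]] uv(3) by auto
qed

end

section \<open>Bundle maps\<close>

definition bundle_map ::
  "('o, 'a) groupoid_data \<Rightarrow> 'b set \<Rightarrow> ('p, 'o, 'a, 'b) gbundle \<Rightarrow> ('q, 'o, 'a, 'c) gbundle
    \<Rightarrow> ('p \<Rightarrow> 'q) \<Rightarrow> ('b \<Rightarrow> 'c) \<Rightarrow> bool" where
  "bundle_map G A P Q F f \<longleftrightarrow>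
     continuous_map (tot P) (tot Q) F \<and>
     (\<forall>p\<in>topspace (tot P). proj Q (F p) = f (proj P p)) \<and>
     (\<forall>p\<in>topspace (tot P). anchor Q (F p) = anchor P p) \<and>
     (\<forall>p\<in>topspace (tot P). \<forall>g\<in>topspace (Arr G).
        anchor P p = tgt G g \<longrightarrow> F (act P p g) = act Q (F p) g) \<and>
     (\<forall>a\<in>A. F (sect P a) = sect Q (f a))"

lemma bundle_mapD:
  assumes "bundle_map G A P Q F f"
  shows "continuous_map (tot P) (tot Q) F"
    "p \<in> topspace (tot P) \<Longrightarrow> F p \<in> topspace (tot Q)"
    "p \<in> topspace (tot P) \<Longrightarrow> proj Q (F p) = f (proj P p)"
    "p \<in> topspace (tot P) \<Longrightarrow> anchor Q (F p) = anchor P p"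
    "p \<in> topspace (tot P) \<Longrightarrow> g \<in> topspace (Arr G) \<Longrightarrow> anchor P p = tgt G g \<Longrightarrow> F (act P p g) = act Q (F p) g"
    "a \<in> A \<Longrightarrow> F (sect P a) = sect Q (f a)"
  using assms by (auto simp: bundle_map_def dest: continuous_map_in)

lemma bundle_map_compose:
  assumes "bundle_map G A P Q F f" "bundle_map G A' Q R F' f'" "f ` A \<subseteq> A'"
  shows "bundle_map G A P R (\<lambda>x. F' (F x)) (\<lambda>x. f' (f x))"
  unfolding bundle_map_def
  using bundle_mapD[OF assms(1)] bundle_mapD[OF assms(2)] assms(3)
  by (auto intro: continuous_map_compose2)

lemma bundle_iso_imp_bundle_map: "bundle_iso G A P Q \<phi> \<Longrightarrow> bundle_map G A P Q \<phi> id"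
  unfolding bundle_iso_def bundle_map_def by (simp add: homeomorphic_imp_continuous_map)

lemma local_section_in:
  assumes "local_section B P V s" "V \<subseteq> topspace B" "x \<in> V"
  shows "s x \<in> topspace (tot P)" "proj P (s x) = x"
  using assms continuous_map_in[of "subtopology B V" "tot P" s x]
  by (auto simp: local_section_def)

text \<open>Continuity of the prescribed section is automatic, since it agrees with continuous local sections.\<close>
lemma pointed_bundleI:
  assumes A: "A \<subseteq> topspace B" and P: "principal_bundle G B P"
    and a0: "\<And>a. a \<in> A \<Longrightarrow> anchor P (sect P a) = a0"
    and loc: "\<And>b. b \<in> topspace B \<Longrightarrow> \<exists>V s. openin B V \<and> b \<in> V \<and> local_section B P V s \<and>
        (\<forall>a\<in>V \<inter> A. s a = sect P a)"
  shows "pointed_bundle G a0 B A P"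
proof -
  have "continuous_map (subtopology B A) (tot P) (sect P)"
  proof (rule continuous_map_locally)
    fix c assume "c \<in> topspace (subtopology B A)"
    then have c: "c \<in> topspace B" "c \<in> A" by auto
    obtain V s where V: "openin B V" "c \<in> V" "local_section B P V s" "\<forall>a\<in>V \<inter> A. s a = sect P a"
      using loc[OF c(1)] by blast
    have "continuous_map (subtopology (subtopology B A) (V \<inter> A)) (tot P) s"
      using V(3) unfolding local_section_def subtopology_subtopology
      by (auto intro: continuous_map_from_subtopology_mono)
    then have "continuous_map (subtopology (subtopology B A) (V \<inter> A)) (tot P) (sect P)"
      by (rule continuous_map_eq) (use V(4) in auto)
    moreover have "openin (subtopology B A) (V \<inter> A)"
      using V(1) by (simp add: openin_subtopology_Int)
    ultimately show "\<exists>W. openin (subtopology B A) W \<and> c \<in> W \<and> continuous_map (subtopology (subtopology B A) W) (tot P) (sect P)"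
      using V(2) c by blast
  qed
  moreover have "proj P (sect P a) = a" if a: "a \<in> A" for a
  proof -
    obtain V s where V: "a \<in> V" "local_section B P V s" "\<forall>a\<in>V \<inter> A. s a = sect P a"
      using loc[of a] a A by blast
    then show ?thesis using a by (auto simp: local_section_def)
  qed
  ultimately have "local_section B P A (sect P)" by (simp add: local_section_def)
  then show ?thesis unfolding pointed_bundle_def using assms by blast
qed

context topological_groupoid
begin

text \<open>Two points of a fibre differ by an arrow \<open>g\<close>; if their images coincide then \<open>g\<close> fixes a point of
  \<open>Q\<close>, and the action on \<open>Q\<close> is free.\<close>
lemma bundle_map_inj:
  assumes P: "principal_bundle G B P" and Q: "principal_bundle G C Q" and F: "bundle_map G A P Q F f"
    and p: "p \<in> topspace (tot P)" "p' \<in> topspace (tot P)" "proj P p = proj P p'" "F p = F p'"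
  shows "p = p'"
proof -
  let ?g = "diff_arrow G P p p'"
  note g = diff_arrow[OF P p(1-3)]
  have "act Q (F p) ?g = F p"
    using bundle_mapD(5)[OF F p(1) g(1)] g p by simp
  moreover have "act Q (F p) (gid G (anchor Q (F p))) = F p"
    using bundle_mapD(2)[OF F p(1)] principal_bundleD(10)[OF Q] by simp
  ultimately have "?g = gid G (anchor Q (F p))"
    using bundle_mapD(2,4)[OF F p(1)] g principal_bundleD(5)[OF P p(1)]
    by (metis Q arr_closed(4) diff_arrow_eqI tgt_gid)
  then show ?thesis
    using g(3) principal_bundleD(10)[OF P p(1)] bundle_mapD(4)[OF F p(1)] by metis
qed

text \<open>Near a point \<open>f\<close> equals \<open>proj Q \<circ> F \<circ> s\<close> for a local section \<open>s\<close>.\<close>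
lemma bundle_map_base_continuous:
  assumes P: "principal_bundle G B P" and Q: "principal_bundle G C Q" and F: "bundle_map G A P Q F f"
  shows "continuous_map B C f"
proof (rule continuous_map_locally)
  fix b assume "b \<in> topspace B"
  then obtain V s where V: "openin B V" "b \<in> V" "local_section B P V s"
    using principal_bundleD(2)[OF P] by blast
  have VB: "V \<subseteq> topspace B" using V openin_subset by auto
  have "continuous_map (subtopology B V) C (\<lambda>x. proj Q (F (s x)))"
    using continuous_map_compose2[OF principal_bundleD(1)[OF Q] continuous_map_compose2[OF bundle_mapD(1)[OF F]]] V(3)
    by (auto simp: local_section_def)
  moreover have "proj Q (F (s x)) = f x" if "x \<in> topspace (subtopology B V)" for x
    using local_section_in[OF V(3) VB] bundle_mapD(3)[OF F] that by auto
  ultimately have "continuous_map (subtopology B V) C f"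
    by (rule continuous_map_eq)
  then show "\<exists>W. openin B W \<and> b \<in> W \<and> continuous_map (subtopology B W) C f"
    using V by blast
qed

lemma fibre_nonempty:
  assumes P: "principal_bundle G B P" and b: "b \<in> topspace B"
  obtains p where "p \<in> topspace (tot P)" "proj P p = b"
proof -
  obtain V s where V: "openin B V" "b \<in> V" "local_section B P V s"
    using principal_bundleD(2)[OF P] b by blast
  then show thesis
    using local_section_in[OF V(3) _ V(2)] that openin_subset by blast
qed

text \<open>Both \<open>P\<close> and \<open>P'\<close> have the fibre of \<open>U\<close> over \<open>f b\<close> as their fibre over \<open>b\<close>. The lift is
  continuous because, for a local section \<open>s\<close> of \<open>P'\<close>, it is \<open>p \<mapsto> s (\<pi> p) \<cdot> d\<close> with \<open>d\<close> the arrow from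
  \<open>F' (s (\<pi> p))\<close> to \<open>F p\<close>.\<close>
lemma bundle_map_lift:
  assumes P: "principal_bundle G B P" and P': "principal_bundle G B P'" and U: "principal_bundle G C U"
    and F: "bundle_map G A P U F f" and F': "bundle_map G A P' U F' f'"
    and ff: "\<And>b. b \<in> topspace B \<Longrightarrow> f b = f' b"
    and sA: "\<And>a. a \<in> A \<Longrightarrow> sect P a \<in> topspace (tot P) \<and> proj P (sect P a) = a"
      "\<And>a. a \<in> A \<Longrightarrow> sect P' a \<in> topspace (tot P') \<and> proj P' (sect P' a) = a"
  shows "\<exists>\<phi>. bundle_map G A P P' \<phi> id \<and> (\<forall>p\<in>topspace (tot P). F' (\<phi> p) = F p)"
proof -
  have ex: "\<exists>p'. p' \<in> topspace (tot P') \<and> proj P' p' = proj P p \<and> F' p' = F p" if p: "p \<in> topspace (tot P)" for p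
  proof -
    obtain q where q: "q \<in> topspace (tot P')" "proj P' q = proj P p"
      using fibre_nonempty[OF P' principal_bundleD(4)[OF P p]] by blast
    have e: "proj U (F' q) = proj U (F p)"
      using bundle_mapD(3)[OF F p] bundle_mapD(3)[OF F' q(1)] q ff principal_bundleD(4)[OF P p] by simp
    note d = diff_arrow[OF U bundle_mapD(2)[OF F' q(1)] bundle_mapD(2)[OF F p] e]
    have a: "anchor P' q = tgt G (diff_arrow G U (F' q) (F p))"
      using d bundle_mapD(4)[OF F' q(1)] by simp
    show ?thesis
      using principal_bundleD(7,8)[OF P' q(1) d(1) a] bundle_mapD(5)[OF F' q(1) d(1) a] d q by auto
  qed
  then obtain \<phi> where \<phi>: "\<And>p. p \<in> topspace (tot P) \<Longrightarrow> \<phi> p \<in> topspace (tot P') \<and> proj P' (\<phi> p) = proj P p \<and> F' (\<phi> p) = F p"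
    by metis
  have uniq: "\<phi> p = q" if "p \<in> topspace (tot P)" "q \<in> topspace (tot P')" "proj P' q = proj P p" "F' q = F p" for p q
    using bundle_map_inj[OF P' U F', of "\<phi> p" q] \<phi>[of p] that by simp
  have cont: "continuous_map (tot P) (tot P') \<phi>"
  proof (rule continuous_map_locally)
    fix p assume p: "p \<in> topspace (tot P)"
    obtain V s where V: "openin B V" "proj P p \<in> V" "local_section B P' V s"
      using principal_bundleD(2)[OF P' principal_bundleD(4)[OF P p]] by blast
    have VB: "V \<subseteq> topspace B" using V openin_subset by auto
    define W where "W = {x \<in> topspace (tot P). proj P x \<in> V}"
    have W: "openin (tot P) W"
      unfolding W_def using principal_bundleD(1)[OF P] V(1) openin_continuous_map_preimage by blast
    let ?Z = "subtopology (tot P) W"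
    have WZ: "topspace ?Z = W" using W openin_subset by fastforce
    have pc: "continuous_map ?Z B (proj P)"
      using principal_bundleD(1)[OF P] continuous_map_from_subtopology by blast
    have sc: "continuous_map ?Z (tot P') (\<lambda>x. s (proj P x))"
      by (rule continuous_map_subtopology_compose[OF _ pc]) (use V(3) W_def in \<open>auto simp: local_section_def\<close>)
    have s: "s (proj P x) \<in> topspace (tot P')" "proj P' (s (proj P x)) = proj P x" if "x \<in> W" for x
      using local_section_in[OF V(3) VB] that by (auto simp: W_def)
    have e: "proj U (F' (s (proj P x))) = proj U (F x)" if "x \<in> W" for x
      using s[OF that] that bundle_mapD(3)[OF F] bundle_mapD(3)[OF F'] ff principal_bundleD(4)[OF P]
      by (simp add: W_def)
    have dc: "continuous_map ?Z (Arr G) (\<lambda>x. diff_arrow G U (F' (s (proj P x))) (F x))"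
      by (rule continuous_map_diff_arrow[OF U continuous_map_compose2[OF bundle_mapD(1)[OF F'] sc] continuous_map_from_subtopology[OF bundle_mapD(1)[OF F]]])
         (use e WZ in auto)
    have d: "diff_arrow G U (F' (s (proj P x))) (F x) \<in> topspace (Arr G)"
       "anchor P' (s (proj P x)) = tgt G (diff_arrow G U (F' (s (proj P x))) (F x))"
       "act U (F' (s (proj P x))) (diff_arrow G U (F' (s (proj P x))) (F x)) = F x" if "x \<in> W" for x
      using diff_arrow[OF U _ _ e[OF that]] bundle_mapD(2,4)[OF F' s(1)[OF that]] bundle_mapD(2)[OF F, of x] that
      by (auto simp: W_def)
    have "continuous_map ?Z (tot P') (\<lambda>x. act P' (s (proj P x)) (diff_arrow G U (F' (s (proj P x))) (F x)))"
      by (rule continuous_map_act[OF principal_bundleD(3)[OF P'] sc dc]) (use d WZ in auto)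
    moreover have "act P' (s (proj P x)) (diff_arrow G U (F' (s (proj P x))) (F x)) = \<phi> x" if "x \<in> topspace ?Z" for x
    proof (rule uniq[symmetric])
      have x: "x \<in> W" using that WZ by simp
      show "x \<in> topspace (tot P)" using x W_def by simp
      show "act P' (s (proj P x)) (diff_arrow G U (F' (s (proj P x))) (F x)) \<in> topspace (tot P')"
        using principal_bundleD(7)[OF P' s(1)[OF x] d(1,2)[OF x]] .
      show "proj P' (act P' (s (proj P x)) (diff_arrow G U (F' (s (proj P x))) (F x))) = proj P x"
        using principal_bundleD(8)[OF P' s(1)[OF x] d(1,2)[OF x]] s[OF x] by simp
      show "F' (act P' (s (proj P x)) (diff_arrow G U (F' (s (proj P x))) (F x))) = F x"
        using bundle_mapD(5)[OF F' s(1)[OF x] d(1,2)[OF x]] d(3)[OF x] by simp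
    qed
    ultimately have "continuous_map ?Z (tot P') \<phi>" by (rule continuous_map_eq)
    then show "\<exists>W. openin (tot P) W \<and> p \<in> W \<and> continuous_map (subtopology (tot P) W) (tot P') \<phi>"
      using W p V(2) W_def by blast
  qed
  have "bundle_map G A P P' \<phi> id"
    unfolding bundle_map_def
  proof (intro conjI ballI impI cont)
    fix p assume p: "p \<in> topspace (tot P)"
    show "proj P' (\<phi> p) = id (proj P p)" using \<phi>[OF p] by simp
    show an: "anchor P' (\<phi> p) = anchor P p" 
      using \<phi>[OF p] bundle_mapD(4)[OF F p] bundle_mapD(4)[OF F', of "\<phi> p"] by simp
    fix g assume g: "g \<in> topspace (Arr G)" "anchor P p = tgt G g"
    show "\<phi> (act P p g) = act P' (\<phi> p) g"
      by (rule uniq) (use g an \<phi>[OF p] principal_bundleD(7,8)[OF P p g] principal_bundleD(7,8)[OF P' _ g(1), of "\<phi> p"]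
         bundle_mapD(5)[OF F p g] bundle_mapD(5)[OF F' _ g(1), of "\<phi> p"] in auto)
  next
    fix a assume a: "a \<in> A"
    have "a \<in> topspace B" using sA(1)[OF a] principal_bundleD(4)[OF P] by metis
    then show "\<phi> (sect P a) = sect P' (id a)"
      using uniq[of "sect P a" "sect P' a"] sA(1)[OF a] sA(2)[OF a] bundle_mapD(6)[OF F a] bundle_mapD(6)[OF F' a] ff by simp
  qed
  then show ?thesis using \<phi> by blast
qed

text \<open>A bundle is determined up to isomorphism by a bundle map into \<open>U\<close> and the map of base spaces under it.
  Isomorphisms of bundles will mostly be obtained from this fact.\<close>
lemma bundle_iso_of_bundle_maps:
  assumes P: "principal_bundle G B P" and P': "principal_bundle G B P'" and U: "principal_bundle G C U"
    and F: "bundle_map G A P U F f" and F': "bundle_map G A P' U F' f'"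
    and ff: "\<And>b. b \<in> topspace B \<Longrightarrow> f b = f' b"
    and sA: "\<And>a. a \<in> A \<Longrightarrow> sect P a \<in> topspace (tot P) \<and> proj P (sect P a) = a"
      "\<And>a. a \<in> A \<Longrightarrow> sect P' a \<in> topspace (tot P') \<and> proj P' (sect P' a) = a"
  shows "\<exists>\<phi>. bundle_iso G A P P' \<phi>"
proof -
  obtain \<phi> where \<phi>: "bundle_map G A P P' \<phi> id" "\<forall>p\<in>topspace (tot P). F' (\<phi> p) = F p"
    using bundle_map_lift[OF P P' U F F' ff sA] by blast
  obtain \<psi> where \<psi>: "bundle_map G A P' P \<psi> id" "\<forall>p\<in>topspace (tot P'). F (\<psi> p) = F' p"
    using bundle_map_lift[OF P' P U F' F _ sA(2,1)] ff by metis
  have "\<psi> (\<phi> p) = p" if "p \<in> topspace (tot P)" for p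
    using bundle_map_inj[OF P U F, of "\<psi> (\<phi> p)" p] that \<phi>(2) \<psi>(2) bundle_mapD(2,3)[OF \<phi>(1)] bundle_mapD(2,3)[OF \<psi>(1)]
    by simp
  moreover have "\<phi> (\<psi> p) = p" if "p \<in> topspace (tot P')" for p
    using bundle_map_inj[OF P' U F', of "\<phi> (\<psi> p)" p] that \<phi>(2) \<psi>(2) bundle_mapD(2,3)[OF \<phi>(1)] bundle_mapD(2,3)[OF \<psi>(1)]
    by simp
  ultimately have "homeomorphic_maps (tot P) (tot P') \<phi> \<psi>"
    using bundle_mapD(1)[OF \<phi>(1)] bundle_mapD(1)[OF \<psi>(1)] by (simp add: homeomorphic_maps_def)
  then have "homeomorphic_map (tot P) (tot P') \<phi>" using homeomorphic_maps_map by blast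
  then have "bundle_iso G A P P' \<phi>"
    using bundle_mapD[OF \<phi>(1)] by (auto simp: bundle_iso_def)
  then show ?thesis by blast
qed

end

section \<open>The infinite join\<close>

lemma continuous_map_self [simp]: "continuous_map X X (\<lambda>x. x)"
  by (simp add: continuous_map_def)

lemma subtopology_Collect: "subtopology X {x. P x} = subtopology X {x \<in> topspace X. P x}"
proof -
  have "{x \<in> topspace X. P x} = topspace X \<inter> {x. P x}" by auto
  then show ?thesis by (simp add: subtopology_restrict)
qed

lemma topspace_milnor_total [simp]: "topspace (milnor_total G) = milnor_set G"
proof -
  let ?S = "{{e \<in> milnor_set G. fst (e i) \<in> U} | i U. openin (top_of_set {0..1}) U} \<union>
      {{e \<in> milnor_set G. fst (e i) \<in> {0<..1} \<and> snd (e i) \<in> W} | i W. openin (Arr G) W}"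
  have "openin (top_of_set {0..1::real}) {0..1}"
    by simp
  then have "{e \<in> milnor_set G. fst (e 0) \<in> {0..1}} \<in> ?S"
    by blast
  moreover have "milnor_set G = {e \<in> milnor_set G. fst (e 0) \<in> {0..1}}"
    by (auto simp: milnor_set_def)
  ultimately have "milnor_set G \<in> ?S" by simp
  moreover have "\<Union>?S \<subseteq> milnor_set G" by auto
  ultimately show ?thesis
    unfolding milnor_total_def topology_generated_by_topspace by blast
qed

lemma milnor_setD:
  assumes "e \<in> milnor_set G"
  shows "0 \<le> fst (e i)" "fst (e i) \<le> 1" "finite {i. fst (e i) \<noteq> 0}"
    "fst (e i) = 0 \<Longrightarrow> e i = (0, undefined)"
    "fst (e i) \<noteq> 0 \<Longrightarrow> snd (e i) \<in> topspace (Arr G)"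
    "\<exists>i. fst (e i) \<noteq> 0"
    "(\<Sum>i | fst (e i) \<noteq> 0. fst (e i)) = 1"
proof -
  show "\<exists>i. fst (e i) \<noteq> 0"
  proof (rule ccontr)
    assume "\<not> ?thesis"
    then have "{i. fst (e i) \<noteq> 0} = {}" by simp
    then show False using assms unfolding milnor_set_def by (metis (mono_tags, lifting) mem_Collect_eq sum.empty zero_neq_one)
  qed
qed (use assms in \<open>auto simp: milnor_set_def prod_eq_iff\<close>)

lemma milnor_anchor_eq:
  assumes "e \<in> milnor_set G" "fst (e i) \<noteq> 0"
  shows "milnor_anchor G e = src G (snd (e i))"
proof -
  have "fst (e (SOME i. fst (e i) \<noteq> 0)) \<noteq> 0"
    using assms(2) by (rule someI)
  then show ?thesis
    using assms unfolding milnor_anchor_def milnor_set_def by blast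
qed

lemma milnor_setI:
  assumes "finite K" "\<And>i. i \<notin> K \<Longrightarrow> fst (e i) = 0" "\<And>i. 0 \<le> fst (e i)" "(\<Sum>i\<in>K. fst (e i)) = 1"
    "\<And>i. fst (e i) = 0 \<Longrightarrow> snd (e i) = undefined"
    "\<And>i. fst (e i) \<noteq> 0 \<Longrightarrow> snd (e i) \<in> topspace (Arr G) \<and> src G (snd (e i)) = x"
  shows "e \<in> milnor_set G" "milnor_anchor G e = x"
proof -
  have sub: "{i. fst (e i) \<noteq> 0} \<subseteq> K" using assms(2) by auto
  have "(\<Sum>i | fst (e i) \<noteq> 0. fst (e i)) = (\<Sum>i\<in>K. fst (e i))"
    by (rule sum.mono_neutral_left) (use assms(1) sub in auto)
  moreover have "fst (e i) \<le> 1" for i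
  proof (cases "i \<in> K")
    case True
    then have "fst (e i) \<le> (\<Sum>i\<in>K. fst (e i))"
      by (rule member_le_sum) (use assms in auto)
    then show ?thesis using assms(4) by simp
  qed (use assms(2) in simp)
  ultimately show *: "e \<in> milnor_set G"
    unfolding milnor_set_def using assms finite_subset[OF sub] by auto
  obtain i where "fst (e i) \<noteq> 0" using milnor_setD(6)[OF *] by blast
  then show "milnor_anchor G e = x"
    using milnor_anchor_eq[OF *] assms(6) by metis
qed

lemma milnor_eqI:
  assumes "e \<in> milnor_set G" "e' \<in> milnor_set G" "\<And>i. fst (e i) = fst (e' i)"
    "\<And>i. fst (e i) \<noteq> 0 \<Longrightarrow> snd (e i) = snd (e' i)"
  shows "e = e'"
proof
  fix i show "e i = e' i"
    using milnor_setD(4)[OF assms(1), of i] milnor_setD(4)[OF assms(2), of i] assms(3)[of i] assms(4)[of i]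
    by (cases "fst (e i) = 0") (simp, simp add: prod_eq_iff)
qed

lemma continuous_map_milnor_weight:
  assumes "continuous_map X (milnor_total G) \<phi>"
  shows "continuous_map X euclideanreal (\<lambda>x. fst (\<phi> x i))"
proof -
  have "continuous_map (milnor_total G) (top_of_set {0..1}) (\<lambda>e. fst (e i))"
    unfolding continuous_map_def
  proof (intro conjI allI impI)
    show "(\<lambda>e. fst (e i)) \<in> topspace (milnor_total G) \<rightarrow> topspace (top_of_set {0..1})"
      using milnor_setD(1,2)[of _ G i] by auto
    fix U :: "real set" assume "openin (top_of_set {0..1}) U"
    then have "openin (milnor_total G) {e \<in> milnor_set G. fst (e i) \<in> U}"
      unfolding milnor_total_def by (intro topology_generated_by_Basis) blast
    then show "openin (milnor_total G) {x \<in> topspace (milnor_total G). fst (x i) \<in> U}" by simp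
  qed
  then have "continuous_map (milnor_total G) euclideanreal (\<lambda>e. fst (e i))"
    using continuous_map_into_fulltopology by blast
  from continuous_map_compose2[OF this assms] show ?thesis .
qed

lemma openin_milnor_weight:
  assumes "continuous_map X (milnor_total G) \<phi>"
  shows "openin X {x \<in> topspace X. fst (\<phi> x i) \<noteq> 0}"
  using openin_continuous_map_preimage[OF continuous_map_milnor_weight[OF assms, of i], of "- {0}"] by auto

lemma continuous_map_milnor_arrow:
  assumes "continuous_map X (milnor_total G) \<phi>"
  shows "continuous_map (subtopology X {x. fst (\<phi> x i) \<noteq> 0}) (Arr G) (\<lambda>x. snd (\<phi> x i))"
proof -
  let ?E = "subtopology (milnor_total G) {e. fst (e i) \<noteq> 0}"
  have "continuous_map ?E (Arr G) (\<lambda>e. snd (e i))"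
    unfolding continuous_map_def
  proof (intro conjI allI impI)
    show "(\<lambda>e. snd (e i)) \<in> topspace ?E \<rightarrow> topspace (Arr G)"
      using milnor_setD(5)[of _ G i] by auto
    fix W assume W: "openin (Arr G) W"
    then have "openin (milnor_total G) {e \<in> milnor_set G. fst (e i) \<in> {0<..1} \<and> snd (e i) \<in> W}"
      unfolding milnor_total_def by (intro topology_generated_by_Basis) blast
    moreover have "{e \<in> topspace ?E. snd (e i) \<in> W} = {e \<in> milnor_set G. fst (e i) \<in> {0<..1} \<and> snd (e i) \<in> W} \<inter> {e. fst (e i) \<noteq> 0}"
      using milnor_setD(1,2)[of _ G i] by (auto simp: less_le)
    ultimately show "openin ?E {e \<in> topspace ?E. snd (e i) \<in> W}"
      by (simp add: openin_subtopology_Int)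
  qed
  moreover have "continuous_map (subtopology X {x. fst (\<phi> x i) \<noteq> 0}) ?E \<phi>"
    using assms by (simp add: continuous_map_into_subtopology continuous_map_from_subtopology image_subset_iff)
  ultimately show ?thesis by (rule continuous_map_compose2)
qed

text \<open>The topology of the join is the coarsest one that makes weights and arrows continuous.\<close>
lemma continuous_map_into_milnor:
  assumes "\<And>x. x \<in> topspace X \<Longrightarrow> \<phi> x \<in> milnor_set G"
    "\<And>i. continuous_map X euclideanreal (\<lambda>x. fst (\<phi> x i))"
    "\<And>i. continuous_map (subtopology X {x. fst (\<phi> x i) \<noteq> 0}) (Arr G) (\<lambda>x. snd (\<phi> x i))"
  shows "continuous_map X (milnor_total G) \<phi>"
  unfolding milnor_total_def
proof (rule continuous_on_generated_topo, goal_cases)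
  case (1 U)
  then consider i V where "openin (top_of_set {0..1::real}) V" "U = {e \<in> milnor_set G. fst (e i) \<in> V}"
    | i W where "openin (Arr G) W" "U = {e \<in> milnor_set G. fst (e i) \<in> {0<..1} \<and> snd (e i) \<in> W}"
    by blast
  then show ?case
  proof cases
    case (1 i V)
    then obtain T where T: "open T" "V = T \<inter> {0..1}" by (metis openin_open inf_commute)
    have "\<phi> -` U \<inter> topspace X = {x \<in> topspace X. fst (\<phi> x i) \<in> T}"
      using assms(1) milnor_setD(1,2)[of _ G i] unfolding 1 T by auto
    then show ?thesis
      using openin_continuous_map_preimage[OF assms(2)[of i]] T by simp
  next
    case (2 i W)
    let ?S = "{x \<in> topspace X. fst (\<phi> x i) \<noteq> 0}"
    have S: "openin X ?S"
      using openin_continuous_map_preimage[OF assms(2)[of i], of "- {0}"] by auto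
    have eq: "subtopology X {x. fst (\<phi> x i) \<noteq> 0} = subtopology X ?S"
      by (rule subtopology_Collect)
    have "openin (subtopology X ?S) {x \<in> topspace (subtopology X ?S). snd (\<phi> x i) \<in> W}"
      using openin_continuous_map_preimage[OF assms(3)[of i, unfolded eq]] 2 by simp
    then have "openin X {x \<in> topspace (subtopology X ?S). snd (\<phi> x i) \<in> W}"
      using S openin_trans_full by blast
    moreover have "{x \<in> topspace (subtopology X ?S). snd (\<phi> x i) \<in> W} = \<phi> -` U \<inter> topspace X"
      using assms(1) milnor_setD(1,2)[of _ G i] 2 by (fastforce simp: less_le)
    ultimately show ?thesis by simp
  qed
next
  case 2
  show ?case
    using assms(1) topspace_milnor_total[of G] unfolding milnor_total_def topology_generated_by_topspace by blast
qed

section \<open>Join constructions\<close>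

text \<open>Points of the join are built from finitely many weights with positive sum; dividing by the
  sum replaces partitions of unity.\<close>
definition normal_join :: "nat \<Rightarrow> (nat \<Rightarrow> real) \<Rightarrow> (nat \<Rightarrow> 'a) \<Rightarrow> nat \<Rightarrow> real \<times> 'a" where
  "normal_join N w g = (\<lambda>i. if i < N then join_point (w i / (\<Sum>j<N. w j)) (g i) else (0, undefined))"

lemma normal_join:
  assumes "\<And>i. i < N \<Longrightarrow> 0 \<le> w i" "0 < (\<Sum>i<N. w i)"
    "\<And>i. i < N \<Longrightarrow> w i \<noteq> 0 \<Longrightarrow> g i \<in> topspace (Arr G) \<and> src G (g i) = x"
  shows "normal_join N w g \<in> milnor_set G" "milnor_anchor G (normal_join N w g) = x"
proof -
  let ?e = "normal_join N w g"
  have "(\<Sum>i<N. fst (?e i)) = (\<Sum>i<N. w i) / (\<Sum>i<N. w i)"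
    unfolding sum_divide_distrib by (rule sum.cong) (auto simp: normal_join_def join_point_def)
  then have 1: "(\<Sum>i<N. fst (?e i)) = 1" using assms(2) by simp
  have 2: "0 \<le> fst (?e i)" "fst (?e i) = 0 \<Longrightarrow> snd (?e i) = undefined" "i \<notin> {..<N} \<Longrightarrow> fst (?e i) = 0"
    "fst (?e i) \<noteq> 0 \<Longrightarrow> snd (?e i) \<in> topspace (Arr G) \<and> src G (snd (?e i)) = x" for i
    using assms(1,3)[of i] assms(2) by (auto simp: normal_join_def join_point_def split: if_splits)
  show "?e \<in> milnor_set G" "milnor_anchor G ?e = x"
    using milnor_setI[OF finite_lessThan 2(3,1) 1 2(2,4)] by auto
qed

lemma continuous_map_normal_join:
  assumes "\<And>x i. x \<in> topspace X \<Longrightarrow> i < N \<Longrightarrow> 0 \<le> w x i" "\<And>x. x \<in> topspace X \<Longrightarrow> 0 < (\<Sum>i<N. w x i)"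
    "\<And>x i. x \<in> topspace X \<Longrightarrow> i < N \<Longrightarrow> w x i \<noteq> 0 \<Longrightarrow> g x i \<in> topspace (Arr G) \<and> src G (g x i) = a x"
    and w: "\<And>i. i < N \<Longrightarrow> continuous_map X euclideanreal (\<lambda>x. w x i)"
    and g: "\<And>i. i < N \<Longrightarrow> continuous_map (subtopology X {x. w x i \<noteq> 0}) (Arr G) (\<lambda>x. g x i)"
  shows "continuous_map X (milnor_total G) (\<lambda>x. normal_join N (w x) (g x))"
proof (rule continuous_map_into_milnor)
  show "normal_join N (w x) (g x) \<in> milnor_set G" if "x \<in> topspace X" for x
    by (rule normal_join(1)[of N "w x" "g x" G "a x"]) (use assms that in blast)+
  fix i
  have "continuous_map X euclideanreal (\<lambda>x. w x i / (\<Sum>j<N. w x j))" if "i < N"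
    by (intro continuous_map_real_divide continuous_map_sum w that) (use assms(2) in force)+
  then show "continuous_map X euclideanreal (\<lambda>x. fst (normal_join N (w x) (g x) i))"
    by (cases "i < N") (auto simp: normal_join_def join_point_def)
  have "continuous_map (subtopology X {x. fst (normal_join N (w x) (g x) i) \<noteq> 0}) (Arr G) (\<lambda>x. g x i)" if "i < N"
    by (rule continuous_map_from_subtopology_mono[OF g[OF that]])
       (use that in \<open>auto simp: normal_join_def join_point_def\<close>)
  moreover have "g x i = snd (normal_join N (w x) (g x) i)"
    if "x \<in> topspace (subtopology X {x. fst (normal_join N (w x) (g x) i) \<noteq> 0})" "i < N" for x
    using that by (auto simp: normal_join_def join_point_def)
  moreover have "fst (normal_join N (w x) (g x) i) = 0" if "\<not> i < N" for x
    using that by (simp add: normal_join_def)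
  ultimately show "continuous_map (subtopology X {x. fst (normal_join N (w x) (g x) i) \<noteq> 0}) (Arr G)
      (\<lambda>x. snd (normal_join N (w x) (g x) i))"
    by (cases "i < N") (auto elim: continuous_map_eq)
qed

text \<open>Points of the join for which every point \<open>((1 - u) t\<^sub>i + u t'\<^sub>i)\<close> of the segment between the weights
  has an obvious choice of arrows.\<close>
definition compatible :: "('o, 'a) groupoid_data \<Rightarrow> (nat \<Rightarrow> real \<times> 'a) \<Rightarrow> (nat \<Rightarrow> real \<times> 'a) \<Rightarrow> bool" where
  "compatible G e e' \<longleftrightarrow> milnor_anchor G e = milnor_anchor G e' \<and>
     (\<forall>i. fst (e i) \<noteq> 0 \<longrightarrow> fst (e' i) \<noteq> 0 \<longrightarrow> snd (e i) = snd (e' i))"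

definition blend :: "real \<Rightarrow> (nat \<Rightarrow> real \<times> 'a) \<Rightarrow> (nat \<Rightarrow> real \<times> 'a) \<Rightarrow> nat \<Rightarrow> real \<times> 'a" where
  "blend u e e' = (\<lambda>i. join_point ((1 - u) * fst (e i) + u * fst (e' i))
     (if fst (e i) \<noteq> 0 then snd (e i) else snd (e' i)))"

lemma blend:
  assumes e: "e \<in> milnor_set G" "e' \<in> milnor_set G" "compatible G e e'" and u: "0 \<le> u" "u \<le> 1"
  shows "blend u e e' \<in> milnor_set G" "milnor_anchor G (blend u e e') = milnor_anchor G e"
proof -
  let ?K = "{i. fst (e i) \<noteq> 0} \<union> {i. fst (e' i) \<noteq> 0}" and ?b = "blend u e e'"
  have K: "finite ?K" using e milnor_setD(3) by blast
  have "(\<Sum>i\<in>?K. fst (?b i)) = (1 - u) * (\<Sum>i\<in>?K. fst (e i)) + u * (\<Sum>i\<in>?K. fst (e' i))"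
    by (simp add: blend_def join_point_def sum.distrib sum_distrib_left)
  moreover have "(\<Sum>i\<in>?K. fst (e i)) = (\<Sum>i | fst (e i) \<noteq> 0. fst (e i))"
    by (rule sum.mono_neutral_right) (use K in auto)
  moreover have "(\<Sum>i\<in>?K. fst (e' i)) = (\<Sum>i | fst (e' i) \<noteq> 0. fst (e' i))"
    by (rule sum.mono_neutral_right) (use K in auto)
  ultimately have 1: "(\<Sum>i\<in>?K. fst (?b i)) = 1"
    using milnor_setD(7)[OF e(1)] milnor_setD(7)[OF e(2)] by simp
  have 2: "0 \<le> fst (?b i)" "fst (?b i) = 0 \<Longrightarrow> snd (?b i) = undefined" for i
    using milnor_setD(1)[OF e(1), of i] milnor_setD(1)[OF e(2), of i] u by (auto simp: blend_def join_point_def)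
  have 3: "snd (?b i) \<in> topspace (Arr G) \<and> src G (snd (?b i)) = milnor_anchor G e" if "fst (?b i) \<noteq> 0" for i
    using that milnor_setD(5)[OF e(1), of i] milnor_setD(5)[OF e(2), of i] e(3)
      milnor_anchor_eq[OF e(1), of i] milnor_anchor_eq[OF e(2), of i]
    by (auto simp: blend_def join_point_def compatible_def)
  show "?b \<in> milnor_set G" "milnor_anchor G ?b = milnor_anchor G e"
    using milnor_setI[OF K _ 2(1) 1 2(2) 3] by (auto simp: blend_def join_point_def)
qed

lemma blend_end:
  assumes "e \<in> milnor_set G" "e' \<in> milnor_set G" "compatible G e e'"
  shows "blend 0 e e' = e" "blend 1 e e' = e'"
proof -
  show "blend 0 e e' = e"
    by (rule milnor_eqI[OF blend(1)[OF assms] assms(1)]) (auto simp: blend_def join_point_def)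
  show "blend 1 e e' = e'"
    by (rule milnor_eqI[OF blend(1)[OF assms] assms(2)])
       (use assms(3) in \<open>auto simp: blend_def join_point_def compatible_def\<close>)
qed

text \<open>Where the weight of the blend is positive, so is one of the two given weights. The open sets on which the one or
  the other is positive cover, and on their intersection compatibility makes the arrows agree.\<close>
lemma continuous_map_blend:
  assumes \<phi>: "continuous_map X (milnor_total G) \<phi>" and \<phi>': "continuous_map X (milnor_total G) \<phi>'"
    and u: "continuous_map X (top_of_set {0..1}) u"
    and c: "\<And>x. x \<in> topspace X \<Longrightarrow> compatible G (\<phi> x) (\<phi>' x)"
  shows "continuous_map X (milnor_total G) (\<lambda>x. blend (u x) (\<phi> x) (\<phi>' x))"
proof (rule continuous_map_into_milnor)
  have u': "continuous_map X euclideanreal u" "\<And>x. x \<in> topspace X \<Longrightarrow> 0 \<le> u x \<and> u x \<le> 1"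
    using u by (auto simp: continuous_map_in_subtopology)
  have in': "\<phi> x \<in> milnor_set G" "\<phi>' x \<in> milnor_set G" if "x \<in> topspace X" for x
    using continuous_map_in[OF \<phi> that] continuous_map_in[OF \<phi>' that] by auto
  show "blend (u x) (\<phi> x) (\<phi>' x) \<in> milnor_set G" if "x \<in> topspace X" for x
    using blend(1)[OF in'[OF that] c[OF that]] u'(2)[OF that] by simp
  fix i
  show "continuous_map X euclideanreal (\<lambda>x. fst (blend (u x) (\<phi> x) (\<phi>' x) i))"
    unfolding blend_def join_point_def fst_conv
    by (intro continuous_map_add continuous_map_real_mult continuous_map_diff u'
        continuous_map_milnor_weight[OF \<phi>] continuous_map_milnor_weight[OF \<phi>']) simp
  let ?Z = "subtopology X {x. fst (blend (u x) (\<phi> x) (\<phi>' x) i) \<noteq> 0}"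
  have sub: "continuous_map ?Z (milnor_total G) \<phi>" "continuous_map ?Z (milnor_total G) \<phi>'"
    using \<phi> \<phi>' continuous_map_from_subtopology by blast+
  let ?T = "\<lambda>b. {x \<in> topspace ?Z. fst ((if b then \<phi> else \<phi>') x i) \<noteq> 0}"
  have eq: "subtopology ?Z (?T b) = subtopology ?Z {x. fst ((if b then \<phi> else \<phi>') x i) \<noteq> 0}" for b
    by (rule subtopology_Collect[symmetric])
  show "continuous_map ?Z (Arr G) (\<lambda>x. snd (blend (u x) (\<phi> x) (\<phi>' x) i))"
  proof (rule pasting_lemma[where I = UNIV and T = ?T and f = "\<lambda>b x. snd ((if b then \<phi> else \<phi>') x i)"])
    fix b :: bool
    show "openin ?Z (?T b)"
      using openin_milnor_weight[OF sub(1)] openin_milnor_weight[OF sub(2)] by (cases b) auto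
    show "continuous_map (subtopology ?Z (?T b)) (Arr G) (\<lambda>x. snd ((if b then \<phi> else \<phi>') x i))"
      unfolding eq using continuous_map_milnor_arrow[OF sub(1)] continuous_map_milnor_arrow[OF sub(2)] by (cases b) auto
  next
    fix b b' :: bool and x
    assume "x \<in> topspace ?Z \<inter> ?T b \<inter> ?T b'"
    then show "snd ((if b then \<phi> else \<phi>') x i) = snd ((if b' then \<phi> else \<phi>') x i)"
      using c[of x] by (cases b; cases b') (auto simp: compatible_def)
  next
    fix x assume x: "x \<in> topspace ?Z"
    show "\<exists>j. j \<in> UNIV \<and> x \<in> ?T j \<and> snd (blend (u x) (\<phi> x) (\<phi>' x) i) = snd ((if j then \<phi> else \<phi>') x i)"
    proof (cases "fst (\<phi> x i) \<noteq> 0")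
      case True
      then show ?thesis using x by (intro exI[of _ True]) (auto simp: blend_def join_point_def)
    next
      case False
      then show ?thesis using x by (intro exI[of _ False]) (auto simp: blend_def join_point_def)
    qed
  qed
qed

section \<open>The universal bundle\<close>

context topological_groupoid
begin

lemma ginv_gmul:
  assumes "g \<in> topspace (Arr G)" "h \<in> topspace (Arr G)" "src G g = tgt G h"
  shows "ginv G (gmul G g h) = gmul G (ginv G h) (ginv G g)"
proof -
  let ?k = "gmul G (ginv G h) (ginv G g)"
  have "gmul G (gmul G g h) ?k = gid G (tgt G g)"
    using gmul_assoc[of g h ?k] assms by simp
  then have "gmul G (ginv G (gmul G g h)) (gid G (tgt G g)) = ?k"
    using ginv_gmul_cancel[of "gmul G g h" ?k] assms by simp
  then show ?thesis
    using gmul_gid_right[of "ginv G (gmul G g h)"] assms by simp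
qed

lemma milnor_act:
  assumes "e \<in> milnor_set G" "g \<in> topspace (Arr G)" "milnor_anchor G e = tgt G g"
  shows "milnor_act G e g \<in> milnor_set G" "milnor_anchor G (milnor_act G e g) = src G g"
proof -
  let ?e = "milnor_act G e g"
  have f: "fst (?e i) = fst (e i)" for i by (simp add: milnor_act_def join_point_def)
  have *: "snd (?e i) \<in> topspace (Arr G) \<and> src G (snd (?e i)) = src G g" if "fst (?e i) \<noteq> 0" for i
    using that milnor_setD(5)[OF assms(1), of i] milnor_anchor_eq[OF assms(1), of i] assms
    by (auto simp: milnor_act_def join_point_def)
  show "?e \<in> milnor_set G" "milnor_anchor G ?e = src G g"
    using milnor_setI[of "{i. fst (e i) \<noteq> 0}" ?e G "src G g", OF milnor_setD(3)[OF assms(1)] _ _ _ _ *]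
      milnor_setD(1,7)[OF assms(1)] by (auto simp: f) (auto simp: milnor_act_def join_point_def)
qed

lemma milnor_act_fst [simp]: "fst (milnor_act G e g i) = fst (e i)"
  by (simp add: milnor_act_def join_point_def)

lemma milnor_act_snd: "fst (e i) \<noteq> 0 \<Longrightarrow> snd (milnor_act G e g i) = gmul G (snd (e i)) g"
  by (simp add: milnor_act_def join_point_def)

lemma milnor_act_id:
  assumes "e \<in> milnor_set G" shows "milnor_act G e (gid G (milnor_anchor G e)) = e"
proof (rule milnor_eqI[of _ G])
  obtain i where i: "fst (e i) \<noteq> 0" using milnor_setD(6)[OF assms] by blast
  then have o: "milnor_anchor G e \<in> topspace (Obj G)"
    using milnor_anchor_eq[OF assms i] milnor_setD(5)[OF assms i] by simp
  then show "milnor_act G e (gid G (milnor_anchor G e)) \<in> milnor_set G"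
    by (intro milnor_act assms) auto
  fix i assume "fst (milnor_act G e (gid G (milnor_anchor G e)) i) \<noteq> 0"
  then show "snd (milnor_act G e (gid G (milnor_anchor G e)) i) = snd (e i)"
    using milnor_setD(5)[OF assms, of i] milnor_anchor_eq[OF assms, of i] by (simp add: milnor_act_snd)
qed (use assms in auto)

lemma milnor_act_act:
  assumes "e \<in> milnor_set G" "g \<in> topspace (Arr G)" "h \<in> topspace (Arr G)" "milnor_anchor G e = tgt G g"
    "src G g = tgt G h"
  shows "milnor_act G (milnor_act G e g) h = milnor_act G e (gmul G g h)"
proof (rule milnor_eqI[of _ G])
  show "milnor_act G (milnor_act G e g) h \<in> milnor_set G" "milnor_act G e (gmul G g h) \<in> milnor_set G"
    using assms by (auto simp: milnor_act)
  fix i assume "fst (milnor_act G (milnor_act G e g) h i) \<noteq> 0"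
  then show "snd (milnor_act G (milnor_act G e g) h i) = snd (milnor_act G e (gmul G g h) i)"
    using milnor_setD(5)[OF assms(1), of i] milnor_anchor_eq[OF assms(1), of i] assms
    by (simp add: milnor_act_snd gmul_assoc)
qed auto

lemma continuous_map_milnor_anchor:
  "continuous_map (milnor_total G) (Obj G) (milnor_anchor G)"
proof (rule continuous_map_locally)
  fix e assume "e \<in> topspace (milnor_total G)"
  then have e: "e \<in> milnor_set G" by simp
  obtain i where i: "fst (e i) \<noteq> 0" using milnor_setD(6)[OF e] by blast
  let ?W = "{x \<in> topspace (milnor_total G). fst (x i) \<noteq> 0}"
  have "openin (milnor_total G) ?W"
    using openin_milnor_weight[OF continuous_map_self[of "milnor_total G"]] by simp
  moreover have "continuous_map (subtopology (milnor_total G) ?W) (Obj G) (\<lambda>x. src G (snd (x i)))"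
    by (intro continuous_map_compose2[OF src_cont]
       continuous_map_from_subtopology_mono[OF continuous_map_milnor_arrow[OF continuous_map_self[of "milnor_total G"], of i]]) auto
  then have "continuous_map (subtopology (milnor_total G) ?W) (Obj G) (milnor_anchor G)"
    by (rule continuous_map_eq) (auto simp: milnor_anchor_eq)
  ultimately show "\<exists>W. openin (milnor_total G) W \<and> e \<in> W \<and> continuous_map (subtopology (milnor_total G) W) (Obj G) (milnor_anchor G)"
    using e i by (intro exI[of _ ?W]) simp
qed

lemma continuous_map_milnor_act:
  assumes \<phi>: "continuous_map X (milnor_total G) \<phi>" and g: "continuous_map X (Arr G) g"
    and a: "\<And>x. x \<in> topspace X \<Longrightarrow> milnor_anchor G (\<phi> x) = tgt G (g x)"
  shows "continuous_map X (milnor_total G) (\<lambda>x. milnor_act G (\<phi> x) (g x))"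
proof (rule continuous_map_into_milnor)
  have in': "\<phi> x \<in> milnor_set G" "g x \<in> topspace (Arr G)" if "x \<in> topspace X" for x
    using continuous_map_in[OF \<phi> that] continuous_map_in[OF g that] by auto
  show "milnor_act G (\<phi> x) (g x) \<in> milnor_set G" if "x \<in> topspace X" for x
    using milnor_act in' a that by blast
  fix i
  show "continuous_map X euclideanreal (\<lambda>x. fst (milnor_act G (\<phi> x) (g x) i))"
    using continuous_map_milnor_weight[OF \<phi>] by simp
  have "continuous_map (subtopology X {x. fst (milnor_act G (\<phi> x) (g x) i) \<noteq> 0}) (Arr G) (\<lambda>x. gmul G (snd (\<phi> x i)) (g x))"
  proof (rule continuous_map_gmul)
    show "src G (snd (\<phi> x i)) = tgt G (g x)" if "x \<in> topspace (subtopology X {x. fst (milnor_act G (\<phi> x) (g x) i) \<noteq> 0})" for x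
      using that a in' milnor_anchor_eq[of "\<phi> x" G i] by auto
  qed (use continuous_map_milnor_arrow[OF \<phi>, of i] continuous_map_from_subtopology[OF g] in simp_all)
  then show "continuous_map (subtopology X {x. fst (milnor_act G (\<phi> x) (g x) i) \<noteq> 0}) (Arr G) (\<lambda>x. snd (milnor_act G (\<phi> x) (g x) i))"
    by (rule continuous_map_eq) (auto simp: milnor_act_snd)
qed

lemma right_action_milnor: "right_action G (milnor_total G) (milnor_anchor G) (milnor_act G)"
proof -
  let ?X = "subtopology (prod_topology (milnor_total G) (Arr G)) {(x, g). milnor_anchor G x = tgt G g}"
  have "continuous_map ?X (milnor_total G) (\<lambda>z. milnor_act G (fst z) (snd z))"
    by (intro continuous_map_milnor_act continuous_map_from_subtopology continuous_map_fst continuous_map_snd) auto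
  then show ?thesis
    unfolding right_action_def
    by (auto simp: case_prod_unfold continuous_map_milnor_anchor milnor_act milnor_act_id milnor_act_act)
qed

lemma milnor_anchor_in: "e \<in> milnor_set G \<Longrightarrow> milnor_anchor G e \<in> topspace (Obj G)"
  using continuous_map_in[OF continuous_map_milnor_anchor] by simp

lemma milnor_orbit_self: "e \<in> milnor_set G \<Longrightarrow> e \<in> milnor_orbit G e"
  unfolding milnor_orbit_def using milnor_act_id[of e] milnor_anchor_in[of e]
  by (auto intro!: exI[of _ "gid G (milnor_anchor G e)"])

lemma milnor_orbit_act:
  assumes e: "e \<in> milnor_set G" and g: "g \<in> topspace (Arr G)" "milnor_anchor G e = tgt G g"
  shows "milnor_orbit G (milnor_act G e g) = milnor_orbit G e"
proof (rule subset_antisym; rule subsetI)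
  fix x assume "x \<in> milnor_orbit G (milnor_act G e g)"
  then obtain h where "h \<in> topspace (Arr G)" "src G g = tgt G h" "x = milnor_act G (milnor_act G e g) h"
    using milnor_act[OF e g] by (auto simp: milnor_orbit_def)
  then show "x \<in> milnor_orbit G e"
    using e g milnor_act_act by (auto simp: milnor_orbit_def intro!: exI[of _ "gmul G g h"])
next
  fix x assume "x \<in> milnor_orbit G e"
  then obtain h where "h \<in> topspace (Arr G)" "tgt G g = tgt G h" "x = milnor_act G e h"
    using g by (auto simp: milnor_orbit_def)
  then show "x \<in> milnor_orbit G (milnor_act G e g)"
    using e g milnor_act_act[of e g "gmul G (ginv G g) h"] milnor_act[OF e g]
    by (auto simp: milnor_orbit_def intro!: exI[of _ "gmul G (ginv G g) h"])
qed

lemma milnor_orbit_eqE: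
  assumes "milnor_orbit G e = milnor_orbit G e'" "e' \<in> milnor_set G"
  obtains g where "g \<in> topspace (Arr G)" "milnor_anchor G e = tgt G g" "e' = milnor_act G e g"
  using milnor_orbit_self[OF assms(2)] assms(1) by (auto simp: milnor_orbit_def)

lemma topspace_classifying_space: "topspace (classifying_space G) = milnor_orbit G ` milnor_set G"
  by (simp add: classifying_space_def)

lemma quotient_map_milnor_orbit: "quotient_map (milnor_total G) (classifying_space G) (milnor_orbit G)"
  by (simp add: classifying_space_def quotient_map_quotient_topology)

text \<open>The weights are constant on orbits and hence functions on the classifying space.\<close>
lemma milnor_orbit_weight:
  assumes "e \<in> milnor_set G"
  shows "milnor_orbit G e \<in> milnor_orbit G ` {x \<in> milnor_set G. fst (x i) \<noteq> 0} \<longleftrightarrow> fst (e i) \<noteq> 0"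
proof
  assume "milnor_orbit G e \<in> milnor_orbit G ` {x \<in> milnor_set G. fst (x i) \<noteq> 0}"
  then obtain y where y: "fst (y i) \<noteq> 0" "milnor_orbit G y = milnor_orbit G e" by auto
  show "fst (e i) \<noteq> 0" by (rule milnor_orbit_eqE[OF y(2) assms]) (use y(1) in simp)
qed (use assms in blast)

lemma openin_orbit_weight:
  "openin (classifying_space G) (milnor_orbit G ` {x \<in> milnor_set G. fst (x i) \<noteq> 0})"
proof -
  have "{x \<in> milnor_set G. milnor_orbit G x \<in> milnor_orbit G ` {x \<in> milnor_set G. fst (x i) \<noteq> 0}} =
      {x \<in> milnor_set G. fst (x i) \<noteq> 0}"
    using milnor_orbit_weight by blast
  then show ?thesis
    using openin_milnor_weight[OF continuous_map_self[of "milnor_total G"], of i]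
    unfolding classifying_space_def openin_quotient_topology by auto
qed

end

definition milnor_simplex :: "('o, 'a) groupoid_data \<Rightarrow> 'o \<Rightarrow> (nat \<Rightarrow> real \<times> 'a) set" where
  "milnor_simplex G a0 = {e \<in> milnor_set G. \<forall>i. fst (e i) \<noteq> 0 \<longrightarrow> snd (e i) = gid G a0}"

text \<open>The set \<open>\<Delta>\<close> that replaces the base point.\<close>
definition orbit_simplex :: "('o, 'a) groupoid_data \<Rightarrow> 'o \<Rightarrow> (nat \<Rightarrow> real \<times> 'a) set set" where
  "orbit_simplex G a0 = milnor_orbit G ` milnor_simplex G a0"

text \<open>The section inverts the orbit map on the simplex, on which the latter is injective.\<close>
definition milnor_bundle ::
  "('o, 'a) groupoid_data \<Rightarrow> 'o \<Rightarrow> (nat \<Rightarrow> real \<times> 'a, 'o, 'a, (nat \<Rightarrow> real \<times> 'a) set) gbundle" where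
  "milnor_bundle G a0 =
     \<lparr>tot = milnor_total G, proj = milnor_orbit G, anchor = milnor_anchor G, act = milnor_act G,
      sect = inv_into (milnor_simplex G a0) (milnor_orbit G)\<rparr>"

lemma milnor_bundle_simps [simp]:
  "tot (milnor_bundle G a0) = milnor_total G"
  "proj (milnor_bundle G a0) = milnor_orbit G"
  "anchor (milnor_bundle G a0) = milnor_anchor G"
  "act (milnor_bundle G a0) = milnor_act G"
  by (simp_all add: milnor_bundle_def)

context topological_groupoid
begin

lemma milnor_simplex_anchor:
  assumes "a0 \<in> topspace (Obj G)" "e \<in> milnor_simplex G a0"
  shows "milnor_anchor G e = a0"
proof -
  have e: "e \<in> milnor_set G" using assms(2) by (simp add: milnor_simplex_def)
  obtain i where "fst (e i) \<noteq> 0" using milnor_setD(6)[OF e] by blast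
  then show ?thesis using milnor_anchor_eq[OF e] assms by (simp add: milnor_simplex_def)
qed

text \<open>An arrow that takes one point of the simplex to another satisfies \<open>1 g = 1\<close> in some
  coordinate of positive weight, so it is a unit.\<close>
lemma inj_on_milnor_simplex:
  assumes "a0 \<in> topspace (Obj G)"
  shows "inj_on (milnor_orbit G) (milnor_simplex G a0)"
proof (rule inj_onI)
  fix e e' assume e: "e \<in> milnor_simplex G a0" "e' \<in> milnor_simplex G a0" and eq: "milnor_orbit G e = milnor_orbit G e'"
  have m: "e \<in> milnor_set G" "e' \<in> milnor_set G" using e by (auto simp: milnor_simplex_def)
  obtain g where g: "g \<in> topspace (Arr G)" "milnor_anchor G e = tgt G g" "e' = milnor_act G e g"
    using milnor_orbit_eqE[OF eq m(2)] .
  obtain i where i: "fst (e i) \<noteq> 0" using milnor_setD(6)[OF m(1)] by blast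
  then have "gmul G (gid G a0) g = gid G a0"
    using e g by (auto simp: milnor_simplex_def milnor_act_snd)
  then have "g = gid G a0"
    using g milnor_simplex_anchor[OF assms e(1)] gmul_gid_left[of g] by simp
  then show "e = e'"
    using g milnor_act_id[OF m(1)] milnor_simplex_anchor[OF assms e(1)] by simp
qed

lemma milnor_sect:
  assumes "a0 \<in> topspace (Obj G)" "e \<in> milnor_simplex G a0"
  shows "sect (milnor_bundle G a0) (milnor_orbit G e) = e"
  using inv_into_f_f[OF inj_on_milnor_simplex[OF assms(1)] assms(2)] by (simp add: milnor_bundle_def)

lemma milnor_sect_in:
  assumes "c \<in> orbit_simplex G a0"
  shows "sect (milnor_bundle G a0) c \<in> milnor_simplex G a0" "milnor_orbit G (sect (milnor_bundle G a0) c) = c"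
  using assms unfolding orbit_simplex_def milnor_bundle_def
  by (auto simp: inv_into_into f_inv_into_f)

text \<open>On the set where the weight \<open>t\<^sub>i\<close> is positive every orbit has exactly one point whose
  arrow at \<open>i\<close> is a unit. For an orbit that meets the simplex this is the point of the simplex.\<close>
lemma milnor_local_section:
  assumes a0: "a0 \<in> topspace (Obj G)" and c: "c \<in> topspace (classifying_space G)"
  shows "\<exists>V s. openin (classifying_space G) V \<and> c \<in> V \<and> local_section (classifying_space G) (milnor_bundle G a0) V s \<and>
    (\<forall>a\<in>V \<inter> orbit_simplex G a0. s a = sect (milnor_bundle G a0) a)"
proof -
  obtain e where e: "e \<in> milnor_set G" "c = milnor_orbit G e"
    using c by (auto simp: topspace_classifying_space)
  obtain i where i: "fst (e i) \<noteq> 0" using milnor_setD(6)[OF e(1)] by blast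
  let ?W = "{x \<in> milnor_set G. fst (x i) \<noteq> 0}"
  define \<sigma> where "\<sigma> x = milnor_act G x (ginv G (snd (x i)))" for x
  define V where "V = milnor_orbit G ` ?W"
  define s where "s c = \<sigma> (SOME x. x \<in> ?W \<and> milnor_orbit G x = c)" for c
  have sat: "{x \<in> milnor_set G. milnor_orbit G x \<in> V} = ?W"
    unfolding V_def using milnor_orbit_weight by auto
  have V: "openin (classifying_space G) V"
    unfolding V_def by (rule openin_orbit_weight)
  have inv: "\<sigma> y = \<sigma> x" if "x \<in> ?W" "y \<in> ?W" "milnor_orbit G x = milnor_orbit G y" for x y
  proof -
    have *: "milnor_orbit G x = milnor_orbit G y" "y \<in> milnor_set G" using that by auto
    obtain g where g: "g \<in> topspace (Arr G)" "milnor_anchor G x = tgt G g" "y = milnor_act G x g"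
      using milnor_orbit_eqE[OF *] .
    have x: "x \<in> milnor_set G" "snd (x i) \<in> topspace (Arr G)" "src G (snd (x i)) = tgt G g"
      using that(1) milnor_setD(5)[of x G i] milnor_anchor_eq[of x G i] g by auto
    have "\<sigma> y = milnor_act G (milnor_act G x g) (gmul G (ginv G g) (ginv G (snd (x i))))"
      using g that x by (simp add: \<sigma>_def milnor_act_snd ginv_gmul)
    also have "\<dots> = \<sigma> x"
      using milnor_act_act[OF x(1) g(1), of "gmul G (ginv G g) (ginv G (snd (x i)))"] g x
      by (simp add: \<sigma>_def)
    finally show ?thesis .
  qed
  have s: "s (milnor_orbit G x) = \<sigma> x" if "x \<in> ?W" for x
  proof -
    have "(SOME y. y \<in> ?W \<and> milnor_orbit G y = milnor_orbit G x) \<in> ?W \<and>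
        milnor_orbit G (SOME y. y \<in> ?W \<and> milnor_orbit G y = milnor_orbit G x) = milnor_orbit G x"
      by (rule someI[of _ x]) (use that in simp)
    then have "\<sigma> (SOME y. y \<in> ?W \<and> milnor_orbit G y = milnor_orbit G x) = \<sigma> x"
      by (intro inv that) simp_all
    then show ?thesis unfolding s_def .
  qed
  have \<sigma>W: "ginv G (snd (x i)) \<in> topspace (Arr G)" "milnor_anchor G x = tgt G (ginv G (snd (x i)))" if "x \<in> ?W" for x
    using that milnor_setD(5)[of x G i] milnor_anchor_eq[of x G i] by auto
  have \<sigma>: "continuous_map (subtopology (milnor_total G) ?W) (milnor_total G) \<sigma>"
    unfolding \<sigma>_def
  proof (rule continuous_map_milnor_act)
    show "continuous_map (subtopology (milnor_total G) ?W) (milnor_total G) (\<lambda>x. x)"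
      by (rule continuous_map_from_subtopology) simp
    show "continuous_map (subtopology (milnor_total G) ?W) (Arr G) (\<lambda>x. ginv G (snd (x i)))"
      by (intro continuous_map_compose2[OF ginv_cont] continuous_map_from_subtopology_mono[OF continuous_map_milnor_arrow[OF continuous_map_self[of "milnor_total G"], of i]]) auto
  qed (use \<sigma>W in auto)
  have q: "quotient_map (subtopology (milnor_total G) ?W) (subtopology (classifying_space G) V) (milnor_orbit G)"
    by (rule quotient_map_restriction[OF quotient_map_milnor_orbit]) (use sat V in auto)
  have sc: "continuous_map (subtopology (classifying_space G) V) (milnor_total G) s"
    by (rule continuous_compose_quotient_map[OF q], rule continuous_map_eq[OF \<sigma>]) (auto simp: s)
  have "local_section (classifying_space G) (milnor_bundle G a0) V s"
    unfolding local_section_def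
  proof (intro conjI ballI)
    fix x assume "x \<in> V"
    then obtain y where y: "y \<in> ?W" "x = milnor_orbit G y" by (auto simp: V_def)
    then show "proj (milnor_bundle G a0) (s x) = x"
      using s[OF y(1)] milnor_orbit_act \<sigma>W[OF y(1)] by (simp add: \<sigma>_def)
  qed (use sc in simp)
  moreover have "s a = sect (milnor_bundle G a0) a" if "a \<in> V \<inter> orbit_simplex G a0" for a
  proof -
    have "a \<in> orbit_simplex G a0" using that by simp
    then obtain x where x: "x \<in> milnor_simplex G a0" "a = milnor_orbit G x"
      by (auto simp: orbit_simplex_def)
    then have m: "x \<in> milnor_set G" by (simp add: milnor_simplex_def)
    then have xW: "x \<in> ?W" using sat that x by blast
    have "snd (x i) = gid G a0" using x xW by (simp add: milnor_simplex_def)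
    then have "\<sigma> x = x"
      using ginv_gid[OF a0] milnor_simplex_anchor[OF a0 x(1)] milnor_act_id[OF m] by (simp add: \<sigma>_def)
    then show ?thesis using s[OF xW] x milnor_sect[OF a0 x(1)] by simp
  qed
  moreover have "c \<in> V" using e i by (auto simp: V_def)
  ultimately show ?thesis using V by blast
qed

text \<open>If \<open>e' = e g\<close> then \<open>g = g\<^sub>i\<inverse> g'\<^sub>i\<close> for every \<open>i\<close> of positive weight, which is continuous
  where \<open>t\<^sub>i > 0\<close>.\<close>
lemma principal_milnor_bundle:
  assumes a0: "a0 \<in> topspace (Obj G)"
  shows "principal_bundle G (classifying_space G) (milnor_bundle G a0)"
proof -
  define d where "d e e' = (let i = (SOME i. fst (e i) \<noteq> 0) in gmul G (ginv G (snd (e i))) (snd (e' i)))"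
    for e e' :: "nat \<Rightarrow> real \<times> 'a"
  have d: "d e (milnor_act G e g) = g" "fst (e i) \<noteq> 0 \<Longrightarrow> gmul G (ginv G (snd (e i))) (snd (milnor_act G e g i)) = g"
    if "e \<in> milnor_set G" "g \<in> topspace (Arr G)" "milnor_anchor G e = tgt G g" for e g i
  proof -
    have *: "gmul G (ginv G (snd (e i))) (snd (milnor_act G e g i)) = g" if "fst (e i) \<noteq> 0" for i
      using milnor_setD(5)[OF \<open>e \<in> milnor_set G\<close> that] milnor_anchor_eq[OF \<open>e \<in> milnor_set G\<close> that]
       \<open>g \<in> topspace (Arr G)\<close> \<open>milnor_anchor G e = tgt G g\<close> that by (simp add: milnor_act_snd)
    show "fst (e i) \<noteq> 0 \<Longrightarrow> gmul G (ginv G (snd (e i))) (snd (milnor_act G e g i)) = g" by (rule *)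
    have "fst (e (SOME i. fst (e i) \<noteq> 0)) \<noteq> 0"
      using milnor_setD(6)[OF that(1)] by (rule someI_ex)
    then show "d e (milnor_act G e g) = g" unfolding d_def Let_def by (rule *)
  qed
  let ?Y = "subtopology (prod_topology (milnor_total G) (milnor_total G)) {(p, p'). milnor_orbit G p = milnor_orbit G p'}"
  have dc: "continuous_map ?Y (Arr G) (\<lambda>z. d (fst z) (snd z))"
  proof (rule continuous_map_locally)
    fix z assume "z \<in> topspace ?Y"
    then have z: "fst z \<in> milnor_set G" by auto
    obtain i where i: "fst (fst z i) \<noteq> 0" using milnor_setD(6)[OF z] by blast
    let ?W = "{x \<in> topspace ?Y. fst (fst x i) \<noteq> 0}"
    have f: "continuous_map ?Y (milnor_total G) fst" and s: "continuous_map ?Y (milnor_total G) snd"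
      by (auto intro: continuous_map_from_subtopology continuous_map_fst continuous_map_snd)
    have E: "\<exists>g. g \<in> topspace (Arr G) \<and> milnor_anchor G (fst x) = tgt G g \<and> snd x = milnor_act G (fst x) g" if "x \<in> topspace ?Y" for x
    proof -
      have *: "milnor_orbit G (fst x) = milnor_orbit G (snd x)" "snd x \<in> milnor_set G" using that by auto
      show ?thesis by (rule milnor_orbit_eqE[OF *]) blast
    qed
    have fsx: "fst (fst x i) = fst (snd x i)" if "x \<in> topspace ?Y" for x i
      using E[OF that] by auto
    have W: "openin ?Y ?W" by (rule openin_milnor_weight[OF f])
    have f': "continuous_map (subtopology ?Y ?W) (Arr G) (\<lambda>x. snd (fst x i))"
      by (rule continuous_map_from_subtopology_mono[OF continuous_map_milnor_arrow[OF f, of i]]) blast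
    have "continuous_map (subtopology ?Y {x. fst (snd x i) \<noteq> 0}) (Arr G) (\<lambda>x. snd (snd x i))"
      by (rule continuous_map_milnor_arrow[OF s])
    then have "continuous_map (subtopology ?Y ({x. fst (snd x i) \<noteq> 0} \<inter> ?W)) (Arr G) (\<lambda>x. snd (snd x i))"
      by (rule continuous_map_from_subtopology_mono) blast
    moreover have "fst (snd x i) \<noteq> 0" if "x \<in> ?W" for x
      using that fsx[of x i] by force
    then have "{x. fst (snd x i) \<noteq> 0} \<inter> ?W = ?W" by blast
    ultimately have s': "continuous_map (subtopology ?Y ?W) (Arr G) (\<lambda>x. snd (snd x i))" by simp
    have st: "tgt G (snd (snd x i)) = tgt G (snd (fst x i))" "snd (fst x i) \<in> topspace (Arr G)" if "x \<in> ?W" for x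
    proof -
      have x: "fst x \<in> milnor_set G" "x \<in> topspace ?Y" "fst (fst x i) \<noteq> 0" using that by auto
      obtain g where g: "g \<in> topspace (Arr G)" "milnor_anchor G (fst x) = tgt G g" "snd x = milnor_act G (fst x) g"
        using E[OF x(2)] by blast
      then show "tgt G (snd (snd x i)) = tgt G (snd (fst x i))" "snd (fst x i) \<in> topspace (Arr G)"
        using milnor_setD(5)[OF x(1,3)] milnor_anchor_eq[OF x(1,3)] x(3) by (auto simp: milnor_act_snd)
    qed
    have "continuous_map (subtopology ?Y ?W) (Arr G) (\<lambda>x. gmul G (ginv G (snd (fst x i))) (snd (snd x i)))"
      by (intro continuous_map_gmul s' continuous_map_compose2[OF ginv_cont f']) (use st in auto)
    moreover have "gmul G (ginv G (snd (fst x i))) (snd (snd x i)) = d (fst x) (snd x)" if x: "x \<in> topspace (subtopology ?Y ?W)" for x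
    proof -
      have x: "fst x \<in> milnor_set G" "x \<in> topspace ?Y" "fst (fst x i) \<noteq> 0" using that by auto
      obtain g where "g \<in> topspace (Arr G)" "milnor_anchor G (fst x) = tgt G g" "snd x = milnor_act G (fst x) g"
        using E[OF x(2)] by blast
      then show ?thesis using d[OF x(1)] x(3) by simp
    qed
    ultimately have "continuous_map (subtopology ?Y ?W) (Arr G) (\<lambda>z. d (fst z) (snd z))"
      by (rule continuous_map_eq)
    then show "\<exists>W. openin ?Y W \<and> z \<in> W \<and> continuous_map (subtopology ?Y W) (Arr G) (\<lambda>z. d (fst z) (snd z))"
      using W i \<open>z \<in> topspace ?Y\<close> by blast
  qed
  have dd: "tgt G (d e e') = milnor_anchor G e \<and> milnor_act G e (d e e') = e'"
    if e: "e \<in> milnor_set G" "e' \<in> milnor_set G" "milnor_orbit G e = milnor_orbit G e'" for e e'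
    using milnor_orbit_eqE[OF e(3,2)] d[OF e(1)] by metis
  show ?thesis
  proof (rule principal_bundleI[where d = d])
    show "continuous_map (tot (milnor_bundle G a0)) (classifying_space G) (proj (milnor_bundle G a0))"
      using quotient_imp_continuous_map[OF quotient_map_milnor_orbit] by simp
    show "\<exists>V s. openin (classifying_space G) V \<and> b \<in> V \<and> local_section (classifying_space G) (milnor_bundle G a0) V s"
      if "b \<in> topspace (classifying_space G)" for b
      using milnor_local_section[OF a0 that] by blast
    show "continuous_map (subtopology (prod_topology (tot (milnor_bundle G a0)) (tot (milnor_bundle G a0))) {(p, p'). proj (milnor_bundle G a0) p = proj (milnor_bundle G a0) p'}) (Arr G) (\<lambda>(p, p'). d p p')"
      using dc by (simp add: case_prod_unfold)
  qed (use right_action_milnor dd d milnor_orbit_act in auto)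
qed

lemma pointed_milnor_bundle:
  assumes a0: "a0 \<in> topspace (Obj G)"
  shows "pointed_bundle G a0 (classifying_space G) (orbit_simplex G a0) (milnor_bundle G a0)"
proof (rule pointed_bundleI[OF _ principal_milnor_bundle[OF a0] _ milnor_local_section[OF a0]])
  show "orbit_simplex G a0 \<subseteq> topspace (classifying_space G)"
    by (auto simp: orbit_simplex_def topspace_classifying_space milnor_simplex_def)
  show "anchor (milnor_bundle G a0) (sect (milnor_bundle G a0) c) = a0" if "c \<in> orbit_simplex G a0" for c
    using milnor_sect_in[OF that] milnor_simplex_anchor[OF a0] by simp
qed

end

section \<open>Pullback\<close>

lemma continuous_map_subtopology_fst_snd [simp]:
  "continuous_map (subtopology (prod_topology X Y) S) X fst"
  "continuous_map (subtopology (prod_topology X Y) S) Y snd"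
  by (auto intro: continuous_map_from_subtopology continuous_map_fst continuous_map_snd)

lemma right_actionI:
  assumes "continuous_map X (Obj G) \<epsilon>"
    "continuous_map (subtopology (prod_topology X (Arr G)) {z. \<epsilon> (fst z) = tgt G (snd z)}) X
       (\<lambda>z. \<alpha> (fst z) (snd z))"
    "\<And>x g. \<lbrakk>x \<in> topspace X; g \<in> topspace (Arr G); \<epsilon> x = tgt G g\<rbrakk> \<Longrightarrow> \<epsilon> (\<alpha> x g) = src G g"
    "\<And>x. x \<in> topspace X \<Longrightarrow> \<alpha> x (gid G (\<epsilon> x)) = x"
    "\<And>x g h. \<lbrakk>x \<in> topspace X; g \<in> topspace (Arr G); h \<in> topspace (Arr G); \<epsilon> x = tgt G g; src G g = tgt G h\<rbrakk>
       \<Longrightarrow> \<alpha> (\<alpha> x g) h = \<alpha> x (gmul G g h)"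
  shows "right_action G X \<epsilon> \<alpha>"
  using assms unfolding right_action_def by (auto simp: case_prod_unfold)

lemma pointed_bundleD:
  assumes "pointed_bundle G a0 B A P"
  shows "A \<subseteq> topspace B" "principal_bundle G B P" "local_section B P A (sect P)"
    "a \<in> A \<Longrightarrow> anchor P (sect P a) = a0"
    "a \<in> A \<Longrightarrow> sect P a \<in> topspace (tot P)" "a \<in> A \<Longrightarrow> proj P (sect P a) = a"
    "b \<in> topspace B \<Longrightarrow> \<exists>V s. openin B V \<and> b \<in> V \<and> local_section B P V s \<and> (\<forall>a\<in>V \<inter> A. s a = sect P a)"
proof -
  show *: "A \<subseteq> topspace B" "local_section B P A (sect P)"
    using assms by (auto simp: pointed_bundle_def)
  show "a \<in> A \<Longrightarrow> sect P a \<in> topspace (tot P)" "a \<in> A \<Longrightarrow> proj P (sect P a) = a"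
    using local_section_in[OF *(2,1)] by auto
qed (use assms in \<open>auto simp: pointed_bundle_def\<close>)

lemma local_section_pullback:
  assumes "local_section B P V s" "continuous_map C B f" "W \<subseteq> {c \<in> topspace C. f c \<in> V}"
  shows "continuous_map (subtopology C W) (tot P) (\<lambda>c. s (f c))" "c \<in> W \<Longrightarrow> proj P (s (f c)) = f c"
proof -
  show "continuous_map (subtopology C W) (tot P) (\<lambda>c. s (f c))"
    by (rule continuous_map_subtopology_compose[of B V])
       (use assms in \<open>auto simp: local_section_def intro: continuous_map_from_subtopology\<close>)
qed (use assms in \<open>auto simp: local_section_def\<close>)

definition pullback_bundle ::
  "'c topology \<Rightarrow> ('c \<Rightarrow> 'd) \<Rightarrow> ('p, 'o, 'a, 'd) gbundle \<Rightarrow> ('c \<times> 'p, 'o, 'a, 'c) gbundle" where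
  "pullback_bundle C f P =
     \<lparr>tot = subtopology (prod_topology C (tot P)) {z. f (fst z) = proj P (snd z)},
      proj = fst, anchor = (\<lambda>z. anchor P (snd z)), act = (\<lambda>z g. (fst z, act P (snd z) g)),
      sect = (\<lambda>c. (c, sect P (f c)))\<rparr>"

context topological_groupoid
begin

lemma pullback_bundle_simps [simp]:
  "tot (pullback_bundle C f P) = subtopology (prod_topology C (tot P)) {z. f (fst z) = proj P (snd z)}"
  "proj (pullback_bundle C f P) = fst"
  "anchor (pullback_bundle C f P) = (\<lambda>z. anchor P (snd z))"
  "act (pullback_bundle C f P) = (\<lambda>z g. (fst z, act P (snd z) g))"
  "sect (pullback_bundle C f P) = (\<lambda>c. (c, sect P (f c)))"
  by (simp_all add: pullback_bundle_def)

lemma principal_pullback: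
  assumes P: "principal_bundle G B P" and f: "continuous_map C B f"
  shows "principal_bundle G C (pullback_bundle C f P)"
proof (rule principal_bundleI[where d = "\<lambda>z z'. diff_arrow G P (snd z) (snd z')"])
  let ?Q = "pullback_bundle C f P"
  show "continuous_map (tot ?Q) C (proj ?Q)" by simp
  show "\<exists>V s. openin C V \<and> b \<in> V \<and> local_section C ?Q V s" if b: "b \<in> topspace C" for b
  proof -
    have "f b \<in> topspace B" using continuous_map_in[OF f b] .
    then obtain V s where V: "openin B V" "f b \<in> V" "local_section B P V s"
      using principal_bundleD(2)[OF P] by blast
    let ?W = "{c \<in> topspace C. f c \<in> V}"
    have "continuous_map (subtopology C ?W) (tot ?Q) (\<lambda>c. (c, s (f c)))"
      unfolding pullback_bundle_simps
      by (intro continuous_map_pair_subtopology continuous_map_from_subtopology[of C C] local_section_pullback[OF V(3) f])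
         (use V(3) in \<open>auto simp: local_section_def\<close>)
    then have "local_section C ?Q ?W (\<lambda>c. (c, s (f c)))"
      by (simp add: local_section_def)
    moreover have "openin C ?W" using f V(1) openin_continuous_map_preimage by blast
    ultimately show ?thesis using V(2) b by blast
  qed
  show "right_action G (tot ?Q) (anchor ?Q) (act ?Q)"
  proof (rule right_actionI)
    show "continuous_map (tot ?Q) (Obj G) (anchor ?Q)"
      by (simp add: continuous_map_compose2[OF principal_bundleD(6)[OF P]])
    let ?X = "subtopology (prod_topology (tot ?Q) (Arr G)) {z. anchor ?Q (fst z) = tgt G (snd z)}"
    have 1: "continuous_map ?X C (\<lambda>z. fst (fst z))" "continuous_map ?X (tot P) (\<lambda>z. snd (fst z))"
      by (rule continuous_map_compose2[of "tot ?Q"]; simp)+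
    have "continuous_map ?X (tot P) (\<lambda>z. act P (snd (fst z)) (snd z))"
      by (intro continuous_map_act[OF principal_bundleD(3)[OF P] 1(2)]) auto
    then show "continuous_map ?X (tot ?Q) (\<lambda>z. act ?Q (fst z) (snd z))"
      unfolding pullback_bundle_simps using 1(1) principal_bundleD(8)[OF P]
      by (intro continuous_map_pair_subtopology) auto
  qed (use principal_bundleD[OF P] in auto)
  show "continuous_map (subtopology (prod_topology (tot ?Q) (tot ?Q)) {(p, p'). proj ?Q p = proj ?Q p'}) (Arr G)
     (\<lambda>(p, p'). diff_arrow G P (snd p) (snd p'))"
    unfolding case_prod_unfold
  proof (rule continuous_map_diff_arrow[OF P])
    let ?X = "subtopology (prod_topology (tot ?Q) (tot ?Q)) {x. proj ?Q (fst x) = proj ?Q (snd x)}"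
    show "continuous_map ?X (tot P) (\<lambda>x. snd (fst x))" "continuous_map ?X (tot P) (\<lambda>x. snd (snd x))"
      by (rule continuous_map_compose2[of "tot ?Q" _ snd]; simp)+
  qed auto
qed (use diff_arrow[OF P] diff_arrow_act[OF P] principal_bundleD[OF P] in auto)

lemma bundle_map_pullback:
  "bundle_map G A (pullback_bundle C f P) P snd f"
  by (auto simp: bundle_map_def)

lemma pointed_pullback:
  assumes P: "pointed_bundle G a0 B A P" and f: "continuous_map C B f" and A': "A' \<subseteq> topspace C" "f ` A' \<subseteq> A"
  shows "pointed_bundle G a0 C A' (pullback_bundle C f P)"
proof (rule pointed_bundleI[OF A'(1) principal_pullback[OF pointed_bundleD(2)[OF P] f]])
  let ?Q = "pullback_bundle C f P"
  show "anchor ?Q (sect ?Q a) = a0" if "a \<in> A'" for a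
    using pointed_bundleD(4)[OF P] A' that by auto
  show "\<exists>V s. openin C V \<and> b \<in> V \<and> local_section C ?Q V s \<and> (\<forall>a\<in>V \<inter> A'. s a = sect ?Q a)" if b: "b \<in> topspace C" for b
  proof -
    have "f b \<in> topspace B" using continuous_map_in[OF f b] .
    then obtain V s where V: "openin B V" "f b \<in> V" "local_section B P V s" "\<forall>a\<in>V \<inter> A. s a = sect P a"
      using pointed_bundleD(7)[OF P] by blast
    let ?W = "{c \<in> topspace C. f c \<in> V}"
    have "continuous_map (subtopology C ?W) (tot ?Q) (\<lambda>c. (c, s (f c)))"
      unfolding pullback_bundle_simps
      by (intro continuous_map_pair_subtopology continuous_map_from_subtopology[of C C] local_section_pullback[OF V(3) f])
         (use V(3) in \<open>auto simp: local_section_def\<close>)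
    then have "local_section C ?Q ?W (\<lambda>c. (c, s (f c)))"
      by (simp add: local_section_def)
    moreover have "openin C ?W" using f V(1) openin_continuous_map_preimage by blast
    ultimately show ?thesis using V(2,4) b A'(2)
      by (intro exI[of _ ?W] exI[of _ "\<lambda>c. (c, s (f c))"]) auto
  qed
qed

section \<open>Restriction\<close>

lemma restrict_bundle_simps [simp]:
  "tot (restrict_bundle C j P) = subtopology (tot P) {p. proj P p \<in> j ` C}"
  "proj (restrict_bundle C j P) = (\<lambda>p. inv_into C j (proj P p))"
  "anchor (restrict_bundle C j P) = anchor P"
  "act (restrict_bundle C j P) = act P"
  "sect (restrict_bundle C j P) = (\<lambda>c. sect P (j c))"
  by (simp_all add: restrict_bundle_def o_def)

lemma bundle_map_restrict: "bundle_map G A (restrict_bundle C j P) P (\<lambda>p. p) j"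
  unfolding bundle_map_def by (auto simp: f_inv_into_f intro: continuous_map_from_subtopology)

lemma pointed_restrict:
  assumes P: "pointed_bundle G a0 B A P" and j: "continuous_map C B j" "inj_on j (topspace C)"
    and ji: "continuous_map (subtopology B (j ` topspace C)) C (inv_into (topspace C) j)"
    and A': "A' \<subseteq> topspace C" "j ` A' \<subseteq> A"
  shows "pointed_bundle G a0 C A' (restrict_bundle (topspace C) j P)"
proof -
  let ?Q = "restrict_bundle (topspace C) j P"
  let ?i = "inv_into (topspace C) j"
  note PP = pointed_bundleD(2)[OF P]
  have ij [simp]: "?i (j c) = c" if "c \<in> topspace C" for c using j(2) that by simp
  have sec: "local_section C ?Q W (\<lambda>c. s (j c))" if V: "local_section B P V s" "W \<subseteq> {c \<in> topspace C. j c \<in> V}" for V s W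
    unfolding local_section_def
  proof (intro conjI ballI)
    have "s (j c) \<in> {p. proj P p \<in> j ` topspace C}" if "c \<in> W" for c
      using local_section_pullback(2)[OF V(1) j(1) V(2) that] that V(2) by auto
    then show "continuous_map (subtopology C W) (tot ?Q) (\<lambda>c. s (j c))"
      using local_section_pullback(1)[OF V(1) j(1) V(2)] by (auto simp: continuous_map_in_subtopology)
    show "proj ?Q (s (j c)) = c" if "c \<in> W" for c
      using local_section_pullback(2)[OF V(1) j(1) V(2) that] that V(2) by auto
  qed
  have loc: "\<exists>V s. openin C V \<and> b \<in> V \<and> local_section C ?Q V s \<and> (\<forall>a\<in>V \<inter> A'. s a = sect ?Q a)" if b: "b \<in> topspace C" for b
  proof -
    have "j b \<in> topspace B" using continuous_map_in[OF j(1) b] .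
    then obtain V s where V: "openin B V" "j b \<in> V" "local_section B P V s" "\<forall>a\<in>V \<inter> A. s a = sect P a"
      using pointed_bundleD(7)[OF P] by blast
    let ?W = "{c \<in> topspace C. j c \<in> V}"
    have "openin C ?W" using j(1) V(1) openin_continuous_map_preimage by blast
    then show ?thesis using V(2,4) b A'(2) sec[OF V(3), of ?W]
      by (intro exI[of _ ?W] exI[of _ "\<lambda>c. s (j c)"]) auto
  qed
  have eq: "proj P p = proj P p'" if "proj ?Q p = proj ?Q p'" "p \<in> topspace (tot ?Q)" "p' \<in> topspace (tot ?Q)" for p p'
    using that by (auto simp: inv_into_injective)
  have "principal_bundle G C ?Q"
  proof (rule principal_bundleI[where d = "diff_arrow G P"])
    show "continuous_map (tot ?Q) C (proj ?Q)"
      unfolding restrict_bundle_simps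
      by (rule continuous_map_subtopology_compose[OF ji continuous_map_from_subtopology[OF principal_bundleD(1)[OF PP]]]) simp
    show "\<exists>V s. openin C V \<and> b \<in> V \<and> local_section C ?Q V s" if "b \<in> topspace C" for b
      using loc[OF that] by blast
    show "right_action G (tot ?Q) (anchor ?Q) (act ?Q)"
    proof (rule right_actionI)
      show "continuous_map (tot ?Q) (Obj G) (anchor ?Q)"
        using principal_bundleD(6)[OF PP] by (simp add: continuous_map_from_subtopology)
      let ?X = "subtopology (prod_topology (tot ?Q) (Arr G)) {z. anchor ?Q (fst z) = tgt G (snd z)}"
      have 1: "continuous_map ?X (tot P) fst"
        by (rule continuous_map_compose2[of "tot ?Q" _ "\<lambda>x. x"]) (auto intro: continuous_map_from_subtopology)
      have "continuous_map ?X (tot P) (\<lambda>z. act P (fst z) (snd z))"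
        by (intro continuous_map_act[OF principal_bundleD(3)[OF PP] 1]) auto
      then show "continuous_map ?X (tot ?Q) (\<lambda>z. act ?Q (fst z) (snd z))"
        using principal_bundleD(8)[OF PP] by (auto simp: continuous_map_in_subtopology)
    qed (use principal_bundleD[OF PP] in auto)
    let ?X = "subtopology (prod_topology (tot ?Q) (tot ?Q)) {x. proj ?Q (fst x) = proj ?Q (snd x)}"
    have "continuous_map ?X (Arr G) (\<lambda>x. diff_arrow G P (fst x) (snd x))"
    proof (rule continuous_map_diff_arrow[OF PP])
      show "continuous_map ?X (tot P) fst" "continuous_map ?X (tot P) snd"
        by (rule continuous_map_compose2[of "tot ?Q" _ "\<lambda>x. x"]; auto intro: continuous_map_from_subtopology)+
      show "proj P (fst z) = proj P (snd z)" if "z \<in> topspace ?X" for z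
        using that by (intro eq) auto
    qed
    then show "continuous_map (subtopology (prod_topology (tot ?Q) (tot ?Q)) {(p, p'). proj ?Q p = proj ?Q p'}) (Arr G)
       (\<lambda>(p, p'). diff_arrow G P p p')"
      by (simp add: case_prod_unfold)
  next
    fix p p' assume p: "p \<in> topspace (tot ?Q)" "p' \<in> topspace (tot ?Q)" "proj ?Q p = proj ?Q p'"
    have "proj P p = proj P p'" by (rule eq[OF p(3,1,2)])
    then show "tgt G (diff_arrow G P p p') = anchor ?Q p" "act ?Q p (diff_arrow G P p p') = p'"
      using diff_arrow[OF PP, of p p'] p by simp_all
  qed (use diff_arrow_act[OF PP] principal_bundleD(8)[OF PP] in auto)
  moreover have "anchor ?Q (sect ?Q a) = a0" if "a \<in> A'" for a
    using pointed_bundleD(4)[OF P] A' that by auto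
  ultimately show ?thesis
    using pointed_bundleI[OF A'(1) _ _ loc] by blast
qed

section \<open>Recoding the total space\<close>

text \<open>Choosing a point \<open>r b\<close> in each fibre identifies \<open>p\<close> with the pair of \<open>\<pi> p\<close> and the
  arrow from \<open>r (\<pi> p)\<close> to \<open>p\<close>. The choice need not be continuous, since the topology is transported along this injection.\<close>
lemma pointed_recode:
  fixes P :: "('p, 'o, 'a, 'c) gbundle"
  assumes P: "pointed_bundle G a0 B A P"
  shows "\<exists>(Q :: ('c \<times> 'a, 'o, 'a, 'c) gbundle) F. pointed_bundle G a0 B A Q \<and> bundle_map G A Q P F id"
proof -
  note PP = pointed_bundleD(2)[OF P]
  have "\<exists>p. p \<in> topspace (tot P) \<and> proj P p = b" if "b \<in> topspace B" for b
    by (rule fibre_nonempty[OF PP that]) blast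
  then obtain r where r: "\<And>b. b \<in> topspace B \<Longrightarrow> r b \<in> topspace (tot P) \<and> proj P (r b) = b"
    by metis
  define \<psi> where "\<psi> p = (proj P p, diff_arrow G P (r (proj P p)) p)" for p
  have inj: "inj_on \<psi> (topspace (tot P))"
  proof (rule inj_onI)
    fix p p' assume p: "p \<in> topspace (tot P)" "p' \<in> topspace (tot P)" "\<psi> p = \<psi> p'"
    let ?r = "r (proj P p)"
    have e: "proj P p' = proj P p" "diff_arrow G P ?r p = diff_arrow G P ?r p'"
      using p(3) by (auto simp: \<psi>_def)
    have R: "?r \<in> topspace (tot P)" "proj P ?r = proj P p" "proj P ?r = proj P p'"
      using r[OF principal_bundleD(4)[OF PP p(1)]] e by auto
    have "p = act P ?r (diff_arrow G P ?r p)" using diff_arrow(3)[OF PP R(1) p(1) R(2)] by (rule sym)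
    also have "\<dots> = act P ?r (diff_arrow G P ?r p')" by (simp only: e(2))
    also have "\<dots> = p'" by (rule diff_arrow(3)[OF PP R(1) p(2) R(3)])
    finally show "p = p'" .
  qed
  let ?T = "quotient_topology (tot P) \<psi>"
  have "homeomorphic_map (tot P) ?T \<psi>"
    using inj by (simp add: homeomorphic_map_def quotient_map_quotient_topology)
  then obtain \<theta> where \<theta>: "homeomorphic_maps (tot P) ?T \<psi> \<theta>"
    by (auto simp: homeomorphic_map_maps)
  have \<theta>c: "continuous_map ?T (tot P) \<theta>" and \<psi>c: "continuous_map (tot P) ?T \<psi>"
    using \<theta> by (auto simp: homeomorphic_maps_def)
  have \<theta>\<psi> [simp]: "\<theta> (\<psi> p) = p" if "p \<in> topspace (tot P)" for p
    using \<theta> that by (auto simp: homeomorphic_maps_def)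
  have \<psi>\<theta> [simp]: "\<psi> (\<theta> z) = z" "\<theta> z \<in> topspace (tot P)" if "z \<in> topspace ?T" for z
    using \<theta> that continuous_map_in[OF \<theta>c] by (auto simp: homeomorphic_maps_def)
  define Q :: "('c \<times> 'a, 'o, 'a, 'c) gbundle" where "Q =
    \<lparr>tot = ?T, proj = (\<lambda>z. proj P (\<theta> z)), anchor = (\<lambda>z. anchor P (\<theta> z)), act = (\<lambda>z g. \<psi> (act P (\<theta> z) g)),
     sect = (\<lambda>b. \<psi> (sect P b))\<rparr>"
  have [simp]: "tot Q = ?T" "proj Q = (\<lambda>z. proj P (\<theta> z))" "anchor Q = (\<lambda>z. anchor P (\<theta> z))"
     "act Q = (\<lambda>z g. \<psi> (act P (\<theta> z) g))" "sect Q = (\<lambda>b. \<psi> (sect P b))"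
    by (simp_all add: Q_def)
  have sec: "local_section B Q V (\<lambda>b. \<psi> (s b))" if "local_section B P V s" "V \<subseteq> topspace B" for V s
    using that local_section_in[OF that] continuous_map_compose2[OF \<psi>c]
    by (auto simp: local_section_def)
  have loc: "\<exists>V s. openin B V \<and> b \<in> V \<and> local_section B Q V s \<and> (\<forall>a\<in>V \<inter> A. s a = sect Q a)" if b: "b \<in> topspace B" for b
  proof -
    obtain V s where V: "openin B V" "b \<in> V" "local_section B P V s" "\<forall>a\<in>V \<inter> A. s a = sect P a"
      using pointed_bundleD(7)[OF P b] by blast
    then show ?thesis
      using sec[OF V(3) openin_subset[OF V(1)]] by (intro exI[of _ V] exI[of _ "\<lambda>b. \<psi> (s b)"]) auto
  qed
  have "principal_bundle G B Q"
  proof (rule principal_bundleI[where d = "\<lambda>z z'. diff_arrow G P (\<theta> z) (\<theta> z')"])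
    show "continuous_map (tot Q) B (proj Q)"
      using continuous_map_compose2[OF principal_bundleD(1)[OF PP] \<theta>c] by simp
    show "\<exists>V s. openin B V \<and> b \<in> V \<and> local_section B Q V s" if "b \<in> topspace B" for b
      using loc[OF that] by blast
    show "right_action G (tot Q) (anchor Q) (act Q)"
    proof (rule right_actionI)
      show "continuous_map (tot Q) (Obj G) (anchor Q)"
        using continuous_map_compose2[OF principal_bundleD(6)[OF PP] \<theta>c] by simp
      let ?X = "subtopology (prod_topology (tot Q) (Arr G)) {z. anchor Q (fst z) = tgt G (snd z)}"
      have "continuous_map ?X (tot P) (\<lambda>z. \<theta> (fst z))"
        by (rule continuous_map_compose2[OF \<theta>c]) simp
      then have "continuous_map ?X (tot P) (\<lambda>z. act P (\<theta> (fst z)) (snd z))"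
        by (intro continuous_map_act[OF principal_bundleD(3)[OF PP]]) auto
      from continuous_map_compose2[OF \<psi>c this]
      show "continuous_map ?X (tot Q) (\<lambda>z. act Q (fst z) (snd z))" by simp
    qed (use principal_bundleD[OF PP] in auto)
    let ?X = "subtopology (prod_topology (tot Q) (tot Q)) {x. proj Q (fst x) = proj Q (snd x)}"
    have "continuous_map ?X (Arr G) (\<lambda>x. diff_arrow G P (\<theta> (fst x)) (\<theta> (snd x)))"
      by (rule continuous_map_diff_arrow[OF PP]) (auto intro: continuous_map_compose2[OF \<theta>c])
    then show "continuous_map (subtopology (prod_topology (tot Q) (tot Q)) {(p, p'). proj Q p = proj Q p'}) (Arr G)
       (\<lambda>(p, p'). diff_arrow G P (\<theta> p) (\<theta> p'))"
      by (simp add: case_prod_unfold)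
  qed (use diff_arrow[OF PP] diff_arrow_act[OF PP] principal_bundleD[OF PP] in auto)
  then have "pointed_bundle G a0 B A Q"
    unfolding pointed_bundle_def using loc pointed_bundleD(1,3-5)[OF P] sec[OF pointed_bundleD(3)[OF P]] by auto
  moreover have "bundle_map G A Q P \<theta> id"
    unfolding bundle_map_def using \<theta>c pointed_bundleD(5)[OF P] principal_bundleD(7)[OF PP] by auto
  ultimately show ?thesis by blast
qed

lemma pullback_recode:
  fixes P :: "('p, 'o, 'a, 'c) gbundle" and C :: "'d topology"
  assumes P: "pointed_bundle G a0 B A P" and f: "continuous_map C B f" and A': "A' \<subseteq> topspace C" "f ` A' \<subseteq> A"
  obtains Q :: "('d \<times> 'a, 'o, 'a, 'd) gbundle" and F
  where "pointed_bundle G a0 C A' Q" "bundle_map G A' Q P F f"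
proof -
  obtain Q :: "('d \<times> 'a, 'o, 'a, 'd) gbundle" and F where
    Q: "pointed_bundle G a0 C A' Q" "bundle_map G A' Q (pullback_bundle C f P) F id"
    using pointed_recode[OF pointed_pullback[OF assms]] by blast
  have "bundle_map G A' Q P (\<lambda>x. snd (F x)) (\<lambda>x. f (id x))"
    by (rule bundle_map_compose[OF Q(2) bundle_map_pullback[of A']]) simp
  then show thesis using that[OF Q(1)] by simp
qed

section \<open>Homotopies of bundles from homotopies of maps\<close>

lemma slice:
  fixes B :: "'c topology"
  assumes "t \<in> {0..1::real}"
  shows "continuous_map B (prod_topology B (top_of_set {0..1})) (\<lambda>b. (b, t))"
    "continuous_map (subtopology (prod_topology B (top_of_set {0..1})) ((\<lambda>b. (b, t)) ` topspace B)) B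
       (inv_into (topspace B) (\<lambda>b. (b, t)))"
proof -
  show "continuous_map B (prod_topology B (top_of_set {0..1})) (\<lambda>b. (b, t))"
    using assms by (intro continuous_map_pairedI) auto
  have "inv_into (topspace B) (\<lambda>b. (b, t)) z = fst z" if "z \<in> (\<lambda>b. (b, t)) ` topspace B" for z
    using that by (auto intro: inv_into_f_eq inj_onI)
  then show "continuous_map (subtopology (prod_topology B (top_of_set {0..1})) ((\<lambda>b. (b, t)) ` topspace B)) B
       (inv_into (topspace B) (\<lambda>b. (b, t)))"
    by (intro continuous_map_eq[OF continuous_map_subtopology_fst_snd(1)]) auto
qed

lemma pointed_restrict_slice:
  assumes "pointed_bundle G a0 (prod_topology B (top_of_set {0..1})) (A \<times> {0..1}) H" "A \<subseteq> topspace B" "t \<in> {0..1::real}"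
  shows "pointed_bundle G a0 B A (restrict_bundle (topspace B) (\<lambda>b. (b, t)) H)"
  by (rule pointed_restrict[OF assms(1) slice(1)[OF assms(3)] _ slice(2)[OF assms(3)] assms(2)])
     (use assms in \<open>auto intro: inj_onI\<close>)

text \<open>The pullback of \<open>U\<close> along the homotopy of maps restricts at both ends to bundles with
  a bundle map to \<open>U\<close> over \<open>f\<close> and \<open>f'\<close>.\<close>
lemma bundle_homotopic_of_homotopy:
  fixes U :: "('u, 'o, 'a, 'c) gbundle" and B :: "'d topology"
  assumes U: "pointed_bundle G a0 C D U" and P: "pointed_bundle G a0 B A P" and Q: "pointed_bundle G a0 B A Q"
    and F: "bundle_map G A P U F f" and F': "bundle_map G A Q U F' f'"
    and h: "homotopic_with (\<lambda>f. f ` A \<subseteq> D) B C f f'"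
  shows "bundle_homotopic G a0 B A P Q"
proof -
  obtain k :: "real \<times> 'd \<Rightarrow> 'c" where k: "continuous_map (prod_topology (top_of_set {0..1}) B) C k"
    "\<And>b. k (0, b) = f b" "\<And>b. k (1, b) = f' b" "\<And>t. t \<in> {0..1} \<Longrightarrow> (\<lambda>b. k (t, b)) ` A \<subseteq> D"
    using h unfolding homotopic_with_def by blast
  let ?BI = "prod_topology B (top_of_set {0..1::real})"
  have AB: "A \<subseteq> topspace B" using pointed_bundleD(1)[OF P] .
  have "continuous_map ?BI C (\<lambda>z. k (snd z, fst z))"
    by (rule continuous_map_compose2[OF k(1)]) (intro continuous_map_pairedI continuous_map_fst continuous_map_snd)
  then obtain H :: "(('d \<times> real) \<times> 'a, 'o, 'a, 'd \<times> real) gbundle" and K where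
    H: "pointed_bundle G a0 ?BI (A \<times> {0..1}) H" "bundle_map G (A \<times> {0..1}) H U K (\<lambda>z. k (snd z, fst z))"
    by (rule pullback_recode[OF U, of ?BI _ "A \<times> {0..1}"]) (use AB k(4) in force)+
  have *: "\<exists>\<phi>. bundle_iso G A (restrict_bundle (topspace B) (\<lambda>b. (b, t)) H) P \<phi>"
    if t: "t \<in> {0..1}" and P: "pointed_bundle G a0 B A P" and F: "bundle_map G A P U F f" and kf: "\<And>b. k (t, b) = f b"
      for t and P :: "('z, 'o, 'a, 'd) gbundle" and F f
  proof -
    let ?R = "restrict_bundle (topspace B) (\<lambda>b. (b, t)) H"
    have R: "pointed_bundle G a0 B A ?R" by (rule pointed_restrict_slice[OF H(1) AB t])
    have m: "bundle_map G A ?R U (\<lambda>p. K p) (\<lambda>b. k (snd (b, t), fst (b, t)))"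
      by (rule bundle_map_compose[OF bundle_map_restrict H(2)]) (use t in auto)
    show ?thesis
      by (rule bundle_iso_of_bundle_maps[OF pointed_bundleD(2)[OF R] pointed_bundleD(2)[OF P] pointed_bundleD(2)[OF U] m F])
         (use kf pointed_bundleD(5,6)[OF R] pointed_bundleD(5,6)[OF P] in auto)
  qed
  show ?thesis
    unfolding bundle_homotopic_def
    using H(1) *[OF _ P F k(2)] *[OF _ Q F' k(3)] by fastforce
qed

section \<open>The trivial bundle\<close>

lemma trivial_bundle_simps [simp]:
  "tot (trivial_bundle G a0 B) = prod_topology B (subtopology (Arr G) {g. tgt G g = a0})"
  "proj (trivial_bundle G a0 B) = fst"
  "anchor (trivial_bundle G a0 B) = (\<lambda>z. src G (snd z))"
  "act (trivial_bundle G a0 B) = (\<lambda>z h. (fst z, gmul G (snd z) h))"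
  "sect (trivial_bundle G a0 B) = (\<lambda>b. (b, gid G a0))"
  by (simp_all add: trivial_bundle_def case_prod_unfold)

lemma pointed_trivial:
  assumes a0: "a0 \<in> topspace (Obj G)" and A: "A \<subseteq> topspace B"
  shows "pointed_bundle G a0 B A (trivial_bundle G a0 B)"
proof -
  let ?T = "trivial_bundle G a0 B"
  have sec: "local_section B ?T V (\<lambda>b. (b, gid G a0))" for V
    unfolding local_section_def using a0 by (auto intro!: continuous_map_pairedI continuous_map_from_subtopology)
  have snd: "continuous_map (tot ?T) (Arr G) snd"
    using continuous_map_snd[of B "subtopology (Arr G) {g. tgt G g = a0}"] continuous_map_into_fulltopology by auto
  have "principal_bundle G B ?T"
  proof (rule principal_bundleI[where d = "\<lambda>z z'. gmul G (ginv G (snd z)) (snd z')"])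
    show "continuous_map (tot ?T) B (proj ?T)" by (simp add: continuous_map_fst)
    show "\<exists>V s. openin B V \<and> b \<in> V \<and> local_section B ?T V s" if "b \<in> topspace B" for b
      using that sec by blast
    show "right_action G (tot ?T) (anchor ?T) (act ?T)"
    proof (rule right_actionI)
      show "continuous_map (tot ?T) (Obj G) (anchor ?T)"
        using continuous_map_compose2[OF src_cont snd] by simp
      let ?X = "subtopology (prod_topology (tot ?T) (Arr G)) {z. anchor ?T (fst z) = tgt G (snd z)}"
      have 1: "continuous_map ?X B (\<lambda>z. fst (fst z))" "continuous_map ?X (Arr G) (\<lambda>z. snd (fst z))"
        by (rule continuous_map_compose2[of "tot ?T"]; use snd in \<open>simp add: continuous_map_fst\<close>)+
      have "continuous_map ?X (Arr G) (\<lambda>z. gmul G (snd (fst z)) (snd z))"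
        by (intro continuous_map_gmul 1) auto
      then have "continuous_map ?X (subtopology (Arr G) {g. tgt G g = a0}) (\<lambda>z. gmul G (snd (fst z)) (snd z))"
        by (auto simp: continuous_map_in_subtopology)
      then show "continuous_map ?X (tot ?T) (\<lambda>z. act ?T (fst z) (snd z))"
        using 1(1) by (simp add: continuous_map_pairedI)
    qed (auto simp: gmul_assoc)
    let ?X = "subtopology (prod_topology (tot ?T) (tot ?T)) {x. proj ?T (fst x) = proj ?T (snd x)}"
    have 1: "continuous_map ?X (Arr G) (\<lambda>z. snd (fst z))" "continuous_map ?X (Arr G) (\<lambda>z. snd (snd z))"
      by (rule continuous_map_compose2[OF snd]; simp)+
    have "continuous_map ?X (Arr G) (\<lambda>x. gmul G (ginv G (snd (fst x))) (snd (snd x)))"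
      by (intro continuous_map_gmul 1 continuous_map_compose2[OF ginv_cont 1(1)]) auto
    then show "continuous_map (subtopology (prod_topology (tot ?T) (tot ?T)) {(p, p'). proj ?T p = proj ?T p'}) (Arr G)
       (\<lambda>(z, z'). gmul G (ginv G (snd z)) (snd z'))"
      by (simp add: case_prod_unfold)
  qed auto
  then show ?thesis
    unfolding pointed_bundle_def using A sec a0 by auto
qed

end

context topological_groupoid
begin

section \<open>Existence of classifying maps\<close>

lemma diff_arrow_right:
  assumes P: "principal_bundle G B P" and p: "p \<in> topspace (tot P)" "p' \<in> topspace (tot P)" "proj P p = proj P p'"
    and g: "g \<in> topspace (Arr G)" "anchor P p' = tgt G g"
  shows "diff_arrow G P p (act P p' g) = gmul G (diff_arrow G P p p') g"
proof (rule diff_arrow_eqI[OF P p(1)])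
  note d = diff_arrow[OF P p]
  show "gmul G (diff_arrow G P p p') g \<in> topspace (Arr G)" "anchor P p = tgt G (gmul G (diff_arrow G P p p') g)"
    using d g by auto
  show "act P p (gmul G (diff_arrow G P p p') g) = act P p' g"
    using principal_bundleD(11)[OF P p(1) d(1) g(1)] d g by simp
qed

lemma diff_arrow_self:
  assumes P: "principal_bundle G B P" and p: "p \<in> topspace (tot P)"
  shows "diff_arrow G P p p = gid G (anchor P p)"
  using principal_bundleD(5,10)[OF P p] by (intro diff_arrow_eqI[OF P p]) auto

text \<open>An equivariant map induces a map of orbits; it respects sections as soon as it sends them
  into the simplex.\<close>
lemma bundle_map_to_milnor:
  assumes a0: "a0 \<in> topspace (Obj G)" and P: "pointed_bundle G a0 B A P"
    and F: "continuous_map (tot P) (milnor_total G) F"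
      "\<And>p. p \<in> topspace (tot P) \<Longrightarrow> milnor_anchor G (F p) = anchor P p"
      "\<And>p g. \<lbrakk>p \<in> topspace (tot P); g \<in> topspace (Arr G); anchor P p = tgt G g\<rbrakk> \<Longrightarrow> F (act P p g) = milnor_act G (F p) g"
      "\<And>a. a \<in> A \<Longrightarrow> F (sect P a) \<in> milnor_simplex G a0"
  shows "\<exists>f. bundle_map G A P (milnor_bundle G a0) F f \<and> f ` A \<subseteq> orbit_simplex G a0 \<and> continuous_map B (classifying_space G) f"
proof -
  note PP = pointed_bundleD(2)[OF P]
  define f where "f b = milnor_orbit G (F (SOME p. p \<in> topspace (tot P) \<and> proj P p = b))" for b
  have f: "f (proj P p) = milnor_orbit G (F p)" if p: "p \<in> topspace (tot P)" for p
  proof -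
    let ?q = "SOME q. q \<in> topspace (tot P) \<and> proj P q = proj P p"
    have q: "?q \<in> topspace (tot P) \<and> proj P ?q = proj P p"
      by (rule someI[of _ p]) (use p in simp)
    let ?d = "diff_arrow G P p ?q"
    have d: "?d \<in> topspace (Arr G)" "tgt G ?d = anchor P p" "act P p ?d = ?q"
      using diff_arrow[OF PP p, of ?q] q by auto
    then have "F ?q = milnor_act G (F p) ?d" using F(3)[OF p d(1)] by simp
    moreover have "F p \<in> milnor_set G" using continuous_map_in[OF F(1) p] by simp
    ultimately have "milnor_orbit G (F ?q) = milnor_orbit G (F p)"
      using milnor_orbit_act[of "F p" ?d] d F(2)[OF p] by simp
    then show ?thesis by (simp add: f_def)
  qed
  have fA: "f a = milnor_orbit G (F (sect P a))" if "a \<in> A" for a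
    using f[OF pointed_bundleD(5)[OF P that]] pointed_bundleD(6)[OF P that] by simp
  have m: "bundle_map G A P (milnor_bundle G a0) F f"
    unfolding bundle_map_def using F f fA milnor_sect[OF a0] by auto
  then show ?thesis
    using fA F(4) bundle_map_base_continuous[OF PP principal_milnor_bundle[OF a0] m]
    by (auto simp: orbit_simplex_def)
qed

text \<open>With finitely many local sections \<open>s\<^sub>i\<close> and weights \<open>\<mu>\<^sub>i\<close> that vanish outside their domains, the map is
  \<open>p \<mapsto> (\<mu>\<^sub>i g\<^sub>i)\<close>, normalised, where \<open>p = s\<^sub>i g\<^sub>i\<close>. Over \<open>A\<close> the \<open>s\<^sub>i\<close> agree with the prescribed section,
  which is why it goes to points with unit arrows.\<close>
lemma classifying_map_exists:
  fixes P :: "('p, 'o, 'a, 'c) gbundle"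
  assumes a0: "a0 \<in> topspace (Obj G)" and P: "pointed_bundle G a0 B A P"
    and B: "compact_space B" "completely_regular_space B"
  shows "\<exists>F f. bundle_map G A P (milnor_bundle G a0) F f \<and> f ` A \<subseteq> orbit_simplex G a0 \<and> continuous_map B (classifying_space G) f"
proof -
  note PP = pointed_bundleD(2)[OF P]
  \<comment> \<open>A local section that extends the prescribed one, and a bump function supported in its domain.\<close>
  define Q where "Q b V s \<mu> \<longleftrightarrow> openin B V \<and> local_section B P V s \<and> (\<forall>a\<in>V \<inter> A. s a = sect P a) \<and>
     continuous_map B euclideanreal \<mu> \<and> (\<forall>x\<in>topspace B. 0 \<le> \<mu> x \<and> (\<mu> x \<noteq> 0 \<longrightarrow> x \<in> V)) \<and> \<mu> b \<noteq> 0"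
    for b V s and \<mu> :: "'c \<Rightarrow> real"
  have "\<forall>b\<in>topspace B. \<exists>V s \<mu>. Q b V s \<mu>"
  proof
    fix b assume b: "b \<in> topspace B"
    obtain V s where V: "openin B V" "b \<in> V" "local_section B P V s" "\<forall>a\<in>V \<inter> A. s a = sect P a"
      using pointed_bundleD(7)[OF P b] by blast
    have "closedin B (topspace B - V)" "b \<in> topspace B - (topspace B - V)" using V b by auto
    then obtain \<mu> :: "'c \<Rightarrow> real" where \<mu>: "continuous_map B (top_of_set {0..1}) \<mu>" "\<mu> b = 0" "\<mu> ` (topspace B - V) \<subseteq> {1}"
      using B(2) unfolding completely_regular_space_def by meson
    have \<mu>': "continuous_map B euclideanreal \<mu>" "\<And>x. x \<in> topspace B \<Longrightarrow> \<mu> x \<le> 1"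
      using \<mu>(1) by (auto simp: continuous_map_in_subtopology)
    have "continuous_map B euclideanreal (\<lambda>x. 1 - \<mu> x)"
      by (intro continuous_map_diff \<mu>') simp
    then show "\<exists>V s \<mu>. Q b V s \<mu>"
      using V \<mu>(2,3) \<mu>'(2) unfolding Q_def by (intro exI[of _ V] exI[of _ s] exI[of _ "\<lambda>x. 1 - \<mu> x"]) auto
  qed
  from bchoice[OF this] obtain V where "\<forall>b\<in>topspace B. \<exists>s \<mu>. Q b (V b) s \<mu>" by blast
  from bchoice[OF this] obtain s where "\<forall>b\<in>topspace B. \<exists>\<mu>. Q b (V b) (s b) \<mu>" by blast
  from bchoice[OF this] obtain \<mu> where "\<forall>b\<in>topspace B. Q b (V b) (s b) (\<mu> b)" by blast
  then have
    V: "\<And>b. b \<in> topspace B \<Longrightarrow> openin B (V b)" and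
    s: "\<And>b. b \<in> topspace B \<Longrightarrow> local_section B P (V b) (s b)" and
    sA: "\<And>b a. b \<in> topspace B \<Longrightarrow> a \<in> V b \<Longrightarrow> a \<in> A \<Longrightarrow> s b a = sect P a" and
    \<mu>c: "\<And>b. b \<in> topspace B \<Longrightarrow> continuous_map B euclideanreal (\<mu> b)" and
    \<mu>0: "\<And>b x. b \<in> topspace B \<Longrightarrow> x \<in> topspace B \<Longrightarrow> 0 \<le> \<mu> b x" and
    \<mu>V: "\<And>b x. b \<in> topspace B \<Longrightarrow> x \<in> topspace B \<Longrightarrow> \<mu> b x \<noteq> 0 \<Longrightarrow> x \<in> V b" and
    \<mu>b: "\<And>b. b \<in> topspace B \<Longrightarrow> \<mu> b b \<noteq> 0"
    unfolding Q_def by blast+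
  let ?O = "\<lambda>b. {x \<in> topspace B. \<mu> b x \<noteq> 0}"
  have "openin B (?O b)" if "b \<in> topspace B" for b
    using openin_continuous_map_preimage[OF \<mu>c[OF that], of "- {0}"] by auto
  moreover have "topspace B \<subseteq> \<Union> (?O ` topspace B)" using \<mu>b by auto
  ultimately obtain \<F> where \<F>: "finite \<F>" "\<F> \<subseteq> ?O ` topspace B" "topspace B \<subseteq> \<Union>\<F>"
    using B(1) unfolding compact_space_alt by (metis (no_types, lifting) imageE)
  then obtain K where K: "finite K" "K \<subseteq> topspace B" "\<F> = ?O ` K"
    by (meson finite_subset_image)
  obtain c where c: "bij_betw c {0..<card K} K" using ex_bij_betw_nat_finite[OF K(1)] by blast
  define N where "N = card K"
  have cK: "c i \<in> topspace B" if "i < N" for i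
    using c K(2) that by (auto simp: bij_betw_def N_def)
  have cover: "\<exists>i<N. \<mu> (c i) x \<noteq> 0" if "x \<in> topspace B" for x
  proof -
    have "x \<in> \<Union> (?O ` K)" using \<F>(3) K(3) that by blast
    then obtain b where b: "b \<in> K" "\<mu> b x \<noteq> 0" by blast
    then have "b \<in> c ` {0..<card K}" using c by (simp add: bij_betw_def)
    then show ?thesis using b by (auto simp: N_def)
  qed
  let ?w = "\<lambda>p i. \<mu> (c i) (proj P p)" and ?g = "\<lambda>p i. diff_arrow G P (s (c i) (proj P p)) p"
  define F where "F p = normal_join N (?w p) (?g p)" for p
  note pB = principal_bundleD(4)[OF PP]
  have sp: "s (c i) (proj P p) \<in> topspace (tot P)" "proj P (s (c i) (proj P p)) = proj P p" "proj P p \<in> V (c i)"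
    if "p \<in> topspace (tot P)" "i < N" "?w p i \<noteq> 0" for p i
    using local_section_in[OF s[OF cK[OF that(2)]] openin_subset[OF V[OF cK[OF that(2)]]] \<mu>V[OF cK[OF that(2)] pB[OF that(1)] that(3)]]
      \<mu>V[OF cK[OF that(2)] pB[OF that(1)] that(3)] by auto
  have w0: "0 \<le> ?w p i" if "p \<in> topspace (tot P)" "i < N" for p i
    using \<mu>0[OF cK[OF that(2)] pB[OF that(1)]] .
  have wpos: "0 < (\<Sum>i<N. ?w p i)" if p: "p \<in> topspace (tot P)" for p
  proof -
    obtain i where "i < N" "?w p i \<noteq> 0" using cover[OF pB[OF p]] by blast
    then show ?thesis using w0[OF p] by (intro sum_pos2[of _ i]) (auto simp: less_le)
  qed
  have g: "?g p i \<in> topspace (Arr G) \<and> src G (?g p i) = anchor P p" if "p \<in> topspace (tot P)" "i < N" "?w p i \<noteq> 0" for p i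
    using diff_arrow[OF PP sp(1)[OF that] that(1)] sp(2)[OF that] by simp
  have Fin: "F p \<in> milnor_set G" "milnor_anchor G (F p) = anchor P p" if "p \<in> topspace (tot P)" for p
    unfolding F_def by (rule normal_join; use that w0 wpos g in blast)+
  have Fc: "continuous_map (tot P) (milnor_total G) F"
    unfolding F_def
  proof (rule continuous_map_normal_join[where a = "anchor P"])
    fix i assume i: "i < N"
    show "continuous_map (tot P) euclideanreal (\<lambda>p. ?w p i)"
      by (rule continuous_map_compose2[OF \<mu>c[OF cK[OF i]] principal_bundleD(1)[OF PP]])
    let ?Z = "subtopology (tot P) {p. ?w p i \<noteq> 0}"
    show "continuous_map ?Z (Arr G) (\<lambda>p. ?g p i)"
    proof (rule continuous_map_diff_arrow[OF PP])
      have "continuous_map (subtopology B (V (c i))) (tot P) (s (c i))"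
        using s[OF cK[OF i]] by (simp add: local_section_def)
      then show "continuous_map ?Z (tot P) (\<lambda>p. s (c i) (proj P p))"
        by (rule continuous_map_subtopology_compose[OF _ continuous_map_from_subtopology[OF principal_bundleD(1)[OF PP]]])
           (use sp(3)[OF _ i] in auto)
      show "continuous_map ?Z (tot P) (\<lambda>p. p)" by (simp add: continuous_map_from_subtopology)
    qed (use sp(2)[OF _ i] in auto)
  qed (use w0 wpos g in blast)+
  show ?thesis
  proof -
    have "F (act P p h) = milnor_act G (F p) h"
      if p: "p \<in> topspace (tot P)" "h \<in> topspace (Arr G)" "anchor P p = tgt G h" for p h
    proof (rule milnor_eqI[of _ G])
      note q = principal_bundleD(7,8)[OF PP p]
      show "F (act P p h) \<in> milnor_set G" using Fin(1) q by blast
      show "milnor_act G (F p) h \<in> milnor_set G" using milnor_act(1)[OF Fin(1)[OF p(1)] p(2)] Fin(2)[OF p(1)] p(3) by simp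
      fix i
      show eq: "fst (F (act P p h) i) = fst (milnor_act G (F p) h i)"
        using q by (simp add: F_def normal_join_def join_point_def)
      assume nz: "fst (F (act P p h) i) \<noteq> 0"
      then have i: "i < N" "?w p i \<noteq> 0" using q by (auto simp: F_def normal_join_def join_point_def split: if_splits)
      have "?g (act P p h) i = gmul G (?g p i) h"
        using diff_arrow_right[OF PP sp(1)[OF p(1) i] p(1) sp(2)[OF p(1) i] p(2,3)] q(2) by simp
      moreover have "snd (F p' i) = ?g p' i" if "fst (F p' i) \<noteq> 0" for p'
        using that i(1) by (auto simp: F_def normal_join_def join_point_def)
      ultimately show "snd (F (act P p h) i) = snd (milnor_act G (F p) h i)"
        using nz eq by (simp add: milnor_act_snd)
    qed
    moreover have "F (sect P a) \<in> milnor_simplex G a0" if a: "a \<in> A" for a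
    proof -
      note sa = pointed_bundleD(5,6)[OF P a] pointed_bundleD(4)[OF P a]
      have "snd (F (sect P a) i) = gid G a0" if "fst (F (sect P a) i) \<noteq> 0" for i
      proof -
        have i: "i < N" "?w (sect P a) i \<noteq> 0" using that by (auto simp: F_def normal_join_def join_point_def split: if_splits)
        have "s (c i) a = sect P a"
          using sA[OF cK[OF i(1)] _ a] sp(3)[OF sa(1) i] sa(2) by simp
        then have "?g (sect P a) i = gid G a0" using diff_arrow_self[OF PP sa(1)] sa by simp
        then show ?thesis using that i(1) by (auto simp: F_def normal_join_def join_point_def)
      qed
      then show ?thesis using Fin(1)[OF sa(1)] by (simp add: milnor_simplex_def)
    qed
    ultimately show ?thesis using bundle_map_to_milnor[OF a0 P Fc Fin(2)] by blast
  qed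
qed

section \<open>Uniqueness of classifying maps up to homotopy\<close>

lemma blend_act:
  assumes e: "e \<in> milnor_set G" "e' \<in> milnor_set G" "compatible G e e'" and u: "0 \<le> u" "u \<le> 1"
    and g: "g \<in> topspace (Arr G)" "milnor_anchor G e = tgt G g"
  shows "blend u (milnor_act G e g) (milnor_act G e' g) = milnor_act G (blend u e e') g"
proof
  fix i show "blend u (milnor_act G e g) (milnor_act G e' g) i = milnor_act G (blend u e e') g i"
    unfolding milnor_act_def blend_def join_point_def by auto
qed

text \<open>Segments between compatible points descend to the base because blending commutes with the action.\<close>
lemma homotopic_of_compatible:
  fixes P :: "('p, 'o, 'a, 'c) gbundle"
  assumes a0: "a0 \<in> topspace (Obj G)" and P: "pointed_bundle G a0 B A P"
    and F: "bundle_map G A P (milnor_bundle G a0) F f" "f ` A \<subseteq> orbit_simplex G a0"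
    and F': "bundle_map G A P (milnor_bundle G a0) F' f'" "f' ` A \<subseteq> orbit_simplex G a0"
    and comp: "\<And>p. p \<in> topspace (tot P) \<Longrightarrow> compatible G (F p) (F' p)"
  shows "homotopic_with (\<lambda>f. f ` A \<subseteq> orbit_simplex G a0) B (classifying_space G) f f'"
proof -
  let ?BG = "classifying_space G" and ?I = "top_of_set {0..1::real}"
  note PP = pointed_bundleD(2)[OF P]
  have Fc: "continuous_map (tot P) (milnor_total G) F" "continuous_map (tot P) (milnor_total G) F'"
    using bundle_mapD(1)[OF F(1)] bundle_mapD(1)[OF F'(1)] by auto
  have Fin: "F p \<in> milnor_set G" "F' p \<in> milnor_set G" if "p \<in> topspace (tot P)" for p
    using bundle_mapD(2)[OF F(1) that] bundle_mapD(2)[OF F'(1) that] by auto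
  define h where "h z = milnor_orbit G (blend (fst z) (F (SOME p. p \<in> topspace (tot P) \<and> proj P p = snd z))
      (F' (SOME p. p \<in> topspace (tot P) \<and> proj P p = snd z)))" for z
  have h: "h (t, proj P p) = milnor_orbit G (blend t (F p) (F' p))" if p: "p \<in> topspace (tot P)" and t: "0 \<le> t" "t \<le> 1" for p t
  proof -
    let ?q = "SOME q. q \<in> topspace (tot P) \<and> proj P q = proj P p"
    have q: "?q \<in> topspace (tot P) \<and> proj P ?q = proj P p"
      by (rule someI[of _ p]) (use p in simp)
    let ?d = "diff_arrow G P p ?q"
    have d: "?d \<in> topspace (Arr G)" "tgt G ?d = anchor P p" "act P p ?d = ?q"
      using diff_arrow[OF PP p, of ?q] q by auto
    have e: "F ?q = milnor_act G (F p) ?d" "F' ?q = milnor_act G (F' p) ?d"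
      using bundle_mapD(5)[OF F(1) p d(1)] bundle_mapD(5)[OF F'(1) p d(1)] d by auto
    have an: "milnor_anchor G (F p) = tgt G ?d" using bundle_mapD(4)[OF F(1) p] d by simp
    note b = blend[OF Fin[OF p] comp[OF p] t]
    have "milnor_orbit G (blend t (F ?q) (F' ?q)) = milnor_orbit G (blend t (F p) (F' p))"
      unfolding e blend_act[OF Fin[OF p] comp[OF p] t d(1) an]
      by (rule milnor_orbit_act[OF b(1) d(1)]) (use b(2) an in simp)
    then show ?thesis by (simp add: h_def)
  qed
  have hc: "continuous_map (prod_topology ?I B) ?BG h"
  proof (rule continuous_map_locally)
    fix z assume z: "z \<in> topspace (prod_topology ?I B)"
    then have zB: "snd z \<in> topspace B" by auto
    obtain V s where V: "openin B V" "snd z \<in> V" "local_section B P V s"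
      using principal_bundleD(2)[OF PP zB] by blast
    have VB: "V \<subseteq> topspace B" using V(1) openin_subset by blast
    let ?W = "{0..1::real} \<times> V"
    let ?Z = "subtopology (prod_topology ?I B) ?W"
    have W: "openin (prod_topology ?I B) ?W"
      by (simp add: openin_prod_Times_iff V(1))
    have sc: "continuous_map ?Z (tot P) (\<lambda>x. s (snd x))"
      by (rule continuous_map_subtopology_compose[of B V]) (use V(3) in \<open>auto simp: local_section_def\<close>)
    have ss: "s (snd x) \<in> topspace (tot P)" "proj P (s (snd x)) = snd x" if "x \<in> topspace ?Z" for x
      using local_section_in[OF V(3) VB, of "snd x"] that by auto
    have "continuous_map ?Z (milnor_total G) (\<lambda>x. blend (fst x) (F (s (snd x))) (F' (s (snd x))))"
      by (intro continuous_map_blend continuous_map_compose2[OF Fc(1) sc] continuous_map_compose2[OF Fc(2) sc] comp ss) simp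
    from continuous_map_compose2[OF quotient_imp_continuous_map[OF quotient_map_milnor_orbit] this]
    have "continuous_map ?Z ?BG h"
    proof (rule continuous_map_eq)
      fix x assume x: "x \<in> topspace ?Z"
      then have "0 \<le> fst x" "fst x \<le> 1" by auto
      then show "milnor_orbit G (blend (fst x) (F (s (snd x))) (F' (s (snd x)))) = h x"
        using h[OF ss(1)[OF x], of "fst x"] ss(2)[OF x] by simp
    qed
    then show "\<exists>W. openin (prod_topology ?I B) W \<and> z \<in> W \<and> continuous_map (subtopology (prod_topology ?I B) W) ?BG h"
      using W V(2) z by (intro exI[of _ ?W]) auto
  qed
  have AB: "A \<subseteq> topspace B" using pointed_bundleD(1)[OF P] .
  have ends: "h (0, b) = f b" "h (1, b) = f' b" if "b \<in> topspace B" for b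
  proof -
    note b = that
    obtain p where p: "p \<in> topspace (tot P)" "proj P p = b" using fibre_nonempty[OF PP b] .
    show "h (0, b) = f b" "h (1, b) = f' b"
      using h[OF p(1), of 0] h[OF p(1), of 1] p(2) blend_end[OF Fin[OF p(1)] comp[OF p(1)]]
        bundle_mapD(3)[OF F(1) p(1)] bundle_mapD(3)[OF F'(1) p(1)] by auto
  qed
  have hA: "h (t, a) \<in> orbit_simplex G a0" if t: "0 \<le> t" "t \<le> 1" and a: "a \<in> A" for t a
  proof -
    have sa: "sect P a \<in> topspace (tot P)" "proj P (sect P a) = a" using pointed_bundleD(5,6)[OF P a] .
    have "F (sect P a) \<in> milnor_simplex G a0" "F' (sect P a) \<in> milnor_simplex G a0"
      using bundle_mapD(6)[OF F(1) a] bundle_mapD(6)[OF F'(1) a] milnor_sect_in(1) F(2) F'(2) a by auto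
    then have "blend t (F (sect P a)) (F' (sect P a)) \<in> milnor_simplex G a0"
      using blend(1)[OF Fin[OF sa(1)] comp[OF sa(1)] t] by (auto simp: milnor_simplex_def blend_def join_point_def)
    then show ?thesis using h[OF sa(1) t] sa(2) by (auto simp: orbit_simplex_def)
  qed
  show ?thesis
    apply (subst homotopic_with)
    using AB apply (metis image_cong subsetD)
    using hc ends hA by (intro exI[of _ h]) auto
qed

text \<open>The first \<open>N\<close> coordinates, normalised and moved up by \<open>M\<close> places.\<close>
definition spread :: "nat \<Rightarrow> nat \<Rightarrow> (nat \<Rightarrow> real \<times> 'a) \<Rightarrow> nat \<Rightarrow> real \<times> 'a" where
  "spread N M e = normal_join (M + N) (\<lambda>i. if M \<le> i then fst (e (i - M)) else 0) (\<lambda>i. snd (e (i - M)))"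

lemma spread_sum_pos:
  assumes "e \<in> milnor_set G" "\<exists>i<N. fst (e i) \<noteq> 0"
  shows "0 < (\<Sum>i<M + N. if M \<le> i then fst (e (i - M)) else 0)"
proof -
  obtain i where i: "i < N" "fst (e i) \<noteq> 0" using assms(2) by blast
  then show ?thesis
    using milnor_setD(1)[OF assms(1)] by (intro sum_pos2[of _ "M + i"]) (auto simp: less_le)
qed

lemma spread_nz:
  assumes "fst (spread N M e i) \<noteq> 0"
  shows "M \<le> i" "i < M + N" "fst (e (i - M)) \<noteq> 0" "snd (spread N M e i) = snd (e (i - M))"
  using assms by (auto simp: spread_def normal_join_def join_point_def split: if_splits)

lemma spread:
  assumes e: "e \<in> milnor_set G" "\<exists>i<N. fst (e i) \<noteq> 0"
  shows "spread N M e \<in> milnor_set G" "milnor_anchor G (spread N M e) = milnor_anchor G e"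
  unfolding spread_def
  by (rule normal_join[where x = "milnor_anchor G e"];
      use spread_sum_pos[OF e] milnor_setD(1,5)[OF e(1)] milnor_anchor_eq[OF e(1)] in \<open>auto split: if_splits\<close>)+

lemma bundle_map_spread:
  assumes a0: "a0 \<in> topspace (Obj G)" and P: "pointed_bundle G a0 B A P"
    and F: "bundle_map G A P (milnor_bundle G a0) F f" "f ` A \<subseteq> orbit_simplex G a0"
    and N: "\<And>p. p \<in> topspace (tot P) \<Longrightarrow> \<exists>i<N. fst (F p i) \<noteq> 0"
  shows "\<exists>f'. bundle_map G A P (milnor_bundle G a0) (\<lambda>p. spread N M (F p)) f' \<and> f' ` A \<subseteq> orbit_simplex G a0"
proof -
  have Fc: "continuous_map (tot P) (milnor_total G) F" using bundle_mapD(1)[OF F(1)] by simp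
  have Fin: "F p \<in> milnor_set G" if "p \<in> topspace (tot P)" for p
    using bundle_mapD(2)[OF F(1) that] by auto
  have 1: "continuous_map (tot P) (milnor_total G) (\<lambda>p. spread N M (F p))"
    unfolding spread_def
  proof (rule continuous_map_normal_join[where a = "anchor P"])
    show "0 < (\<Sum>i<M + N. if M \<le> i then fst (F x (i - M)) else 0)" if "x \<in> topspace (tot P)" for x
      by (rule spread_sum_pos[OF Fin[OF that] N[OF that]])
    show "continuous_map (tot P) euclideanreal (\<lambda>x. if M \<le> i then fst (F x (i - M)) else 0)" for i
      using continuous_map_milnor_weight[OF Fc] by (cases "M \<le> i") auto
    show "continuous_map (subtopology (tot P) {x. (if M \<le> i then fst (F x (i - M)) else 0) \<noteq> 0}) (Arr G) (\<lambda>x. snd (F x (i - M)))" for i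
      by (rule continuous_map_from_subtopology_mono[OF continuous_map_milnor_arrow[OF Fc, of "i - M"]]) auto
  next
    fix x i assume x: "x \<in> topspace (tot P)"
    show "0 \<le> (if M \<le> i then fst (F x (i - M)) else 0)"
      using milnor_setD(1)[OF Fin[OF x]] by simp
    assume "(if M \<le> i then fst (F x (i - M)) else 0) \<noteq> 0"
    then show "snd (F x (i - M)) \<in> topspace (Arr G) \<and> src G (snd (F x (i - M))) = anchor P x"
      using milnor_setD(5)[OF Fin[OF x]] milnor_anchor_eq[OF Fin[OF x]] bundle_mapD(4)[OF F(1) x]
      by (auto split: if_splits)
  qed
  have 2: "milnor_anchor G (spread N M (F p)) = anchor P p" if "p \<in> topspace (tot P)" for p
    using spread(2)[OF Fin[OF that] N[OF that]] bundle_mapD(4)[OF F(1) that] by simp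
  have 3: "spread N M (F (act P p g)) = milnor_act G (spread N M (F p)) g"
    if "p \<in> topspace (tot P)" "g \<in> topspace (Arr G)" "anchor P p = tgt G g" for p g
  proof
    have e: "F (act P p g) = milnor_act G (F p) g" using bundle_mapD(5)[OF F(1) that] by simp
    fix i show "spread N M (F (act P p g)) i = milnor_act G (spread N M (F p)) g i"
      unfolding e spread_def normal_join_def milnor_act_fst by (auto simp: milnor_act_def join_point_def)
  qed
  have 4: "spread N M (F (sect P a)) \<in> milnor_simplex G a0" if a: "a \<in> A" for a
  proof -
    have s: "F (sect P a) \<in> milnor_simplex G a0"
      using bundle_mapD(6)[OF F(1) a] milnor_sect_in(1) F(2) a by auto
    have sa: "sect P a \<in> topspace (tot P)" using pointed_bundleD(5)[OF P a] .
    show ?thesis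
      using spread(1)[OF Fin[OF sa] N[OF sa]] s spread_nz[of N M "F (sect P a)"]
      by (auto simp: milnor_simplex_def)
  qed
  show ?thesis using bundle_map_to_milnor[OF a0 P 1 2 3 4] by blast
qed

text \<open>The sets on which the weights are positive form an open cover of the compact base.\<close>
lemma finite_support_bound:
  assumes a0: "a0 \<in> topspace (Obj G)" and P: "pointed_bundle G a0 B A P" and B: "compact_space B"
    and F: "bundle_map G A P (milnor_bundle G a0) F f"
  obtains N where "\<And>p. p \<in> topspace (tot P) \<Longrightarrow> \<exists>i<N. fst (F p i) \<noteq> 0"
proof -
  note PP = pointed_bundleD(2)[OF P]
  have fc: "continuous_map B (classifying_space G) f"
    by (rule bundle_map_base_continuous[OF PP principal_milnor_bundle[OF a0] F])
  let ?O = "\<lambda>i. {x \<in> topspace B. f x \<in> milnor_orbit G ` {x \<in> milnor_set G. fst (x i) \<noteq> 0}}"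
  have O: "openin B (?O i)" for i
    using openin_continuous_map_preimage[OF fc openin_orbit_weight] .
  have fO: "proj P p \<in> ?O i \<longleftrightarrow> fst (F p i) \<noteq> 0" if "p \<in> topspace (tot P)" for p i
    using milnor_orbit_weight[of "F p" i] bundle_mapD(2,3)[OF F that] principal_bundleD(4)[OF PP that] by auto
  have "topspace B \<subseteq> \<Union> (range ?O)"
  proof
    fix b assume "b \<in> topspace B"
    then obtain p where p: "p \<in> topspace (tot P)" "proj P p = b" using fibre_nonempty[OF PP] by metis
    have "F p \<in> milnor_set G" using bundle_mapD(2)[OF F p(1)] by simp
    then obtain i where "fst (F p i) \<noteq> 0" using milnor_setD(6) by blast
    then show "b \<in> \<Union> (range ?O)" using fO[OF p(1)] p(2) by blast
  qed
  then obtain \<F> where \<F>: "finite \<F>" "\<F> \<subseteq> range ?O" "topspace B \<subseteq> \<Union>\<F>"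
    using B O unfolding compact_space_alt by (metis (no_types, lifting) rangeE)
  then obtain K where K: "finite K" "\<F> = ?O ` K"
    by (meson finite_subset_image)
  obtain N where N: "K \<subseteq> {..<N}" using finite_nat_bounded[OF K(1)] by blast
  have "\<exists>i<N. fst (F p i) \<noteq> 0" if p: "p \<in> topspace (tot P)" for p
  proof -
    obtain i where "i \<in> K" "proj P p \<in> ?O i"
      using \<F>(3) K(2) principal_bundleD(4)[OF PP p] by blast
    then show ?thesis using fO[OF p] N by blast
  qed
  then show thesis by (rule that)
qed

text \<open>After compactness has provided a common \<open>N\<close>, the chain is \<open>F\<close>, its truncation to the places below \<open>N\<close>,
  the truncation of \<open>F'\<close> moved to the places from \<open>N\<close> to \<open>2 N\<close>, the truncation of \<open>F'\<close> at the places below \<open>N\<close>, and \<open>F'\<close>.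
  Neighbours are compatible, as they have either equal arrows or disjoint supports.\<close>
lemma classifying_map_unique:
  assumes a0: "a0 \<in> topspace (Obj G)" and P: "pointed_bundle G a0 B A P" and B: "compact_space B"
    and F: "bundle_map G A P (milnor_bundle G a0) F f" "f ` A \<subseteq> orbit_simplex G a0"
    and F': "bundle_map G A P (milnor_bundle G a0) F' f'" "f' ` A \<subseteq> orbit_simplex G a0"
  shows "homotopic_with (\<lambda>f. f ` A \<subseteq> orbit_simplex G a0) B (classifying_space G) f f'"
proof -
  obtain N1 where N1: "\<And>p. p \<in> topspace (tot P) \<Longrightarrow> \<exists>i<N1. fst (F p i) \<noteq> 0"
    using finite_support_bound[OF a0 P B F(1)] by blast
  obtain N2 where N2: "\<And>p. p \<in> topspace (tot P) \<Longrightarrow> \<exists>i<N2. fst (F' p i) \<noteq> 0"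
    using finite_support_bound[OF a0 P B F'(1)] by blast
  define N where "N = max N1 N2"
  have N: "\<exists>i<N. fst (F p i) \<noteq> 0" "\<exists>i<N. fst (F' p i) \<noteq> 0" if "p \<in> topspace (tot P)" for p
    using N1[OF that] N2[OF that] by (auto simp: N_def less_max_iff_disj)
  obtain f1 where f1: "bundle_map G A P (milnor_bundle G a0) (\<lambda>p. spread N 0 (F p)) f1" "f1 ` A \<subseteq> orbit_simplex G a0"
    using bundle_map_spread[OF a0 P F N(1)] by blast
  obtain f2 where f2: "bundle_map G A P (milnor_bundle G a0) (\<lambda>p. spread N N (F' p)) f2" "f2 ` A \<subseteq> orbit_simplex G a0"
    using bundle_map_spread[OF a0 P F' N(2)] by blast
  obtain f3 where f3: "bundle_map G A P (milnor_bundle G a0) (\<lambda>p. spread N 0 (F' p)) f3" "f3 ` A \<subseteq> orbit_simplex G a0"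
    using bundle_map_spread[OF a0 P F' N(2)] by blast
  have anch: "milnor_anchor G (K p) = anchor P p"
    if "bundle_map G A P (milnor_bundle G a0) K k" "p \<in> topspace (tot P)" for K k p
    using bundle_mapD(4)[OF that] by simp
  note hom = homotopic_of_compatible[OF a0 P]
  note an = anch[OF F(1)] anch[OF F'(1)] anch[OF f1(1)] anch[OF f2(1)] anch[OF f3(1)]
  have disj: "fst (spread N 0 e i) = 0 \<or> fst (spread N N e' i) = 0" for e e' :: "nat \<Rightarrow> real \<times> 'a" and i
    using spread_nz(2)[of N 0 e i] spread_nz(1)[of N N e' i] by force
  have "homotopic_with (\<lambda>f. f ` A \<subseteq> orbit_simplex G a0) B (classifying_space G) f f1"
    by (rule hom[OF F f1]) (use an spread_nz(4)[of N 0] in \<open>auto simp: compatible_def\<close>)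
  moreover have "homotopic_with (\<lambda>f. f ` A \<subseteq> orbit_simplex G a0) B (classifying_space G) f1 f2"
    by (rule hom[OF f1 f2], unfold compatible_def) (use an disj in metis)
  moreover have "homotopic_with (\<lambda>f. f ` A \<subseteq> orbit_simplex G a0) B (classifying_space G) f3 f2"
    by (rule hom[OF f3 f2], unfold compatible_def) (use an disj in metis)
  moreover have "homotopic_with (\<lambda>f. f ` A \<subseteq> orbit_simplex G a0) B (classifying_space G) f' f3"
    by (rule hom[OF F' f3]) (use an spread_nz(4)[of N 0] in \<open>auto simp: compatible_def\<close>)
  ultimately show ?thesis
    by (meson homotopic_with_sym homotopic_with_trans)
qed

text \<open>A classifying map of the homotopy restricts at the ends to classifying maps of
  bundles isomorphic to \<open>P\<close> and \<open>Q\<close>.\<close>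
lemma homotopy_of_bundle_homotopic:
  fixes P :: "('p, 'o, 'a, 'c) gbundle" and Q :: "('q, 'o, 'a, 'c) gbundle"
  assumes a0: "a0 \<in> topspace (Obj G)" and PQ: "bundle_homotopic G a0 B A P Q"
    and AB: "A \<subseteq> topspace B" and B: "compact_space B" "completely_regular_space B"
    and F: "bundle_map G A P (milnor_bundle G a0) F f" "f ` A \<subseteq> orbit_simplex G a0"
    and F': "bundle_map G A Q (milnor_bundle G a0) F' f'" "f' ` A \<subseteq> orbit_simplex G a0"
  shows "homotopic_with (\<lambda>f. f ` A \<subseteq> orbit_simplex G a0) B (classifying_space G) f f'"
proof -
  let ?I = "top_of_set {0..1::real}"
  let ?BI = "prod_topology B ?I" and ?U = "milnor_bundle G a0"
  let ?h = "homotopic_with (\<lambda>f. f ` A \<subseteq> orbit_simplex G a0) B (classifying_space G)"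
  obtain H :: "(('c \<times> real) \<times> 'a, 'o, 'a, 'c \<times> real) gbundle" and \<phi> \<psi> where
    H: "pointed_bundle G a0 ?BI (A \<times> {0..1}) H" and
    \<phi>: "bundle_iso G A (restrict_bundle (topspace B) (\<lambda>b. (b, 0)) H) P \<phi>" and
    \<psi>: "bundle_iso G A (restrict_bundle (topspace B) (\<lambda>b. (b, 1)) H) Q \<psi>"
    using PQ unfolding bundle_homotopic_def by blast
  have "compact_space ?BI" "completely_regular_space ?BI"
    using B by (auto simp: compact_space_prod_topology completely_regular_space_prod_topology compact_space_subtopology
       intro: completely_regular_space_subtopology metrizable_imp_completely_regular_space metrizable_space_euclidean)
  then obtain K k where K: "bundle_map G (A \<times> {0..1}) H ?U K k" "k ` (A \<times> {0..1}) \<subseteq> orbit_simplex G a0"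
      "continuous_map ?BI (classifying_space G) k"
    using classifying_map_exists[OF a0 H] by blast
  have slice_h: "?h (\<lambda>b. k (b, t)) g"
    if t: "t \<in> {0..1}" and \<phi>: "bundle_iso G A (restrict_bundle (topspace B) (\<lambda>b. (b, t)) H) R \<phi>"
      and F: "bundle_map G A R ?U F g" "g ` A \<subseteq> orbit_simplex G a0"
    for t R \<phi> F g
  proof -
    let ?R = "restrict_bundle (topspace B) (\<lambda>b. (b, t)) H"
    have R: "pointed_bundle G a0 B A ?R" by (rule pointed_restrict_slice[OF H AB t])
    have 1: "bundle_map G A ?R ?U (\<lambda>p. K p) (\<lambda>b. k (b, t))"
      by (rule bundle_map_compose[OF bundle_map_restrict K(1)]) (use t in auto)
    have 2: "bundle_map G A ?R ?U (\<lambda>p. F (\<phi> p)) (\<lambda>b. g (id b))"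
      by (rule bundle_map_compose[OF bundle_iso_imp_bundle_map[OF \<phi>] F(1)]) simp
    have "?h (\<lambda>b. k (b, t)) (\<lambda>b. g (id b))"
      by (rule classifying_map_unique[OF a0 R B(1) 1 _ 2]) (use K(2) t F(2) in auto)
    then show ?thesis by simp
  qed
  have "continuous_map (prod_topology ?I B) (classifying_space G) (\<lambda>z. k (snd z, fst z))"
    by (rule continuous_map_compose2[OF K(3)]) (intro continuous_map_pairedI continuous_map_fst continuous_map_snd)
  then have "?h (\<lambda>b. k (b, 0)) (\<lambda>b. k (b, 1))"
    unfolding homotopic_with_def using K(2) by (intro exI[of _ "\<lambda>z. k (snd z, fst z)"]) auto
  moreover have "?h (\<lambda>b. k (b, 0)) f" by (rule slice_h[OF _ \<phi> F]) simp
  moreover have "?h (\<lambda>b. k (b, 1)) f'" by (rule slice_h[OF _ \<psi> F']) simp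
  ultimately show ?thesis by (meson homotopic_with_sym homotopic_with_trans)
qed

end

section \<open>Cubes\<close>

lemma topspace_cube: "topspace (cube n) = PiE {..<n} (\<lambda>_. {0..1})"
  by (simp add: cube_def)

lemma cubeD: "x \<in> topspace (cube n) \<Longrightarrow> i < n \<Longrightarrow> 0 \<le> x i" "x \<in> topspace (cube n) \<Longrightarrow> i < n \<Longrightarrow> x i \<le> 1"
    "x \<in> topspace (cube n) \<Longrightarrow> \<not> i < n \<Longrightarrow> x i = undefined"
  by (auto simp: topspace_cube PiE_iff extensional_def)

lemma cubeI:
  assumes "\<And>i. i < n \<Longrightarrow> 0 \<le> x i \<and> x i \<le> 1" "\<And>i. \<not> i < n \<Longrightarrow> x i = undefined"
  shows "x \<in> topspace (cube n)"
  using assms by (auto simp: topspace_cube PiE_iff extensional_def)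

lemma continuous_map_into_cube:
  assumes "\<And>x. x \<in> topspace X \<Longrightarrow> f x \<in> topspace (cube n)"
    "\<And>i. i < n \<Longrightarrow> continuous_map X euclideanreal (\<lambda>x. f x i)"
  shows "continuous_map X (cube n) f"
  unfolding cube_def continuous_map_componentwise
proof (intro conjI ballI)
  show "f ` topspace X \<subseteq> extensional {..<n}"
    using assms(1) by (auto simp: topspace_cube PiE_iff)
  fix i assume "i \<in> {..<n}"
  then show "continuous_map X (top_of_set {0..1}) (\<lambda>x. f x i)"
    using assms(2) cubeD(1,2)[OF assms(1), of _ i] by (auto simp: continuous_map_in_subtopology)
qed

lemma continuous_map_cube_coord:
  assumes "continuous_map X (cube n) f" "i < n"
  shows "continuous_map X euclideanreal (\<lambda>x. f x i)"
  using assms continuous_map_into_fulltopology unfolding cube_def continuous_map_componentwise by blast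

lemma compact_space_cube: "compact_space (cube n)"
  by (simp add: cube_def compact_space_product_topology compact_space_subtopology)

lemma completely_regular_space_cube: "completely_regular_space (cube n)"
  unfolding cube_def completely_regular_space_product_topology
  by (auto intro: completely_regular_space_subtopology metrizable_imp_completely_regular_space metrizable_space_euclidean)

lemma cube_boundary_sub: "cube_boundary n \<subseteq> topspace (cube n)"
  by (auto simp: cube_boundary_def)

definition half_cube :: "nat \<Rightarrow> bool \<Rightarrow> (nat \<Rightarrow> real) set" where
  "half_cube n k = {x \<in> topspace (cube n). if k then 1 / 2 \<le> x 0 else x 0 \<le> 1 / 2}"

lemma closedin_half_cube:
  assumes "n \<ge> 1" shows "closedin (cube n) (half_cube n k)"
proof -
  have c: "continuous_map (cube n) euclideanreal (\<lambda>x. x 0)"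
    by (rule continuous_map_cube_coord[of _ n "\<lambda>x. x"]) (use assms in auto)
  have "closedin euclideanreal (if k then {1/2..} else {..1/2})" by simp
  from closedin_continuous_map_preimage[OF c this] show ?thesis
    unfolding half_cube_def by (cases k) auto
qed

lemma to_half_in:
  assumes "n \<ge> 1" "x \<in> topspace (cube n)"
  shows "to_half k x \<in> half_cube n k"
proof -
  have "0 \<le> (x 0 + of_bool k) / 2 \<and> (x 0 + of_bool k) / 2 \<le> 1 \<and>
      (if k then 1 / 2 \<le> (x 0 + of_bool k) / 2 else (x 0 + of_bool k) / 2 \<le> 1 / 2)"
    using cubeD(1,2)[OF assms(2), of 0] assms(1) by (cases k) auto
  then show ?thesis
    using cubeD[OF assms(2)] assms(1) unfolding half_cube_def to_half_def by (auto intro!: cubeI)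
qed

lemma from_half_in:
  assumes "n \<ge> 1" "x \<in> half_cube n k"
  shows "from_half k x \<in> topspace (cube n)"
proof -
  have x: "x \<in> topspace (cube n)" using assms(2) by (simp add: half_cube_def)
  have "0 \<le> x 0" "x 0 \<le> 1" using cubeD(1,2)[OF x, of 0] assms(1) by auto
  then show ?thesis
    using assms cubeD[OF x] by (auto simp: half_cube_def from_half_def intro!: cubeI split: if_splits)
qed

lemma half_inverse [simp]: "from_half k (to_half k x) = x" "to_half k (from_half k x) = x"
  by (rule ext, simp add: to_half_def from_half_def field_simps)+

lemma continuous_map_to_half:
  assumes "n \<ge> 1" shows "continuous_map (cube n) (cube n) (to_half k)"
proof (rule continuous_map_into_cube)
  show "to_half k x \<in> topspace (cube n)" if "x \<in> topspace (cube n)" for x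
    using to_half_in[OF assms that] by (simp add: half_cube_def)
  have c: "continuous_map (cube n) euclideanreal (\<lambda>x. x i)" if "i < n" for i
    by (rule continuous_map_cube_coord[of _ n "\<lambda>x. x"]) (use that in auto)
  show "continuous_map (cube n) euclideanreal (\<lambda>x. to_half k x i)" if "i < n" for i
  proof (cases "i = 0")
    case True
    have "continuous_map (cube n) euclideanreal (\<lambda>x. (x 0 + of_bool k) / 2)"
      using assms by (intro continuous_map_real_divide continuous_map_add c) auto
    then show ?thesis using True by (simp add: to_half_def)
  qed (use c[OF that] in \<open>simp add: to_half_def\<close>)
qed

lemma continuous_map_from_half:
  assumes "n \<ge> 1" shows "continuous_map (subtopology (cube n) (half_cube n k)) (cube n) (from_half k)"
proof (rule continuous_map_into_cube)
  show "from_half k x \<in> topspace (cube n)" if "x \<in> topspace (subtopology (cube n) (half_cube n k))" for x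
    using from_half_in[OF assms] that by simp
  have c: "continuous_map (subtopology (cube n) (half_cube n k)) euclideanreal (\<lambda>x. x i)" if "i < n" for i
    by (rule continuous_map_cube_coord[of _ n "\<lambda>x. x"]) (use that continuous_map_from_subtopology in auto)
  show "continuous_map (subtopology (cube n) (half_cube n k)) euclideanreal (\<lambda>x. from_half k x i)" if "i < n" for i
  proof (cases "i = 0")
    case True
    have "continuous_map (subtopology (cube n) (half_cube n k)) euclideanreal (\<lambda>x. 2 * x 0 - of_bool k)"
      using assms by (intro continuous_map_real_mult continuous_map_diff c) auto
    then show ?thesis using True by (simp add: from_half_def)
  qed (use c[OF that] in \<open>simp add: from_half_def\<close>)
qed

text \<open>The boundary together with the seam. Both halves of a concatenation have their section prescribed on
  the whole of their boundary, which includes the seam.\<close>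
definition concat_sections :: "nat \<Rightarrow> (nat \<Rightarrow> real) set" where
  "concat_sections n = {x \<in> topspace (cube n). x \<in> cube_boundary n \<or> x 0 = 1 / 2}"

lemma to_half_boundary:
  assumes "n \<ge> 1" "x \<in> cube_boundary n"
  shows "to_half k x \<in> concat_sections n"
proof -
  have x: "x \<in> topspace (cube n)" using assms cube_boundary_sub by blast
  then have 1: "to_half k x \<in> topspace (cube n)" using to_half_in[OF assms(1) x] by (simp add: half_cube_def)
  obtain i where i: "i < n" "x i = 0 \<or> x i = 1" using assms(2) by (auto simp: cube_boundary_def)
  show ?thesis
  proof (cases "i = 0")
    case True
    then have "to_half k x 0 \<in> {0, 1/2, 1}" using i by (cases k) (auto simp: to_half_def)
    then show ?thesis using 1 i True by (auto simp: concat_sections_def cube_boundary_def)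
  next
    case False
    then have "to_half k x i = x i" by (simp add: to_half_def)
    then show ?thesis using 1 i by (auto simp: concat_sections_def cube_boundary_def)
  qed
qed

lemma from_half_boundary:
  assumes "n \<ge> 1" "x \<in> concat_sections n" "x \<in> half_cube n k"
  shows "from_half k x \<in> cube_boundary n"
proof -
  note x = from_half_in[OF assms(1,3)]
  consider "x 0 = 1/2" | i where "i < n" "x i = 0 \<or> x i = 1" using assms(2) by (auto simp: concat_sections_def cube_boundary_def)
  then show ?thesis
  proof cases
    case 1
    then have "from_half k x 0 = 0 \<or> from_half k x 0 = 1" by (cases k) (auto simp: from_half_def)
    then show ?thesis using x assms(1) by (auto simp: cube_boundary_def intro!: exI[of _ 0])
  next
    case (2 i)
    then have "from_half k x i = 0 \<or> from_half k x i = 1"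
      using assms(3) by (cases "i = 0"; cases k) (auto simp: from_half_def half_cube_def)
    then show ?thesis using x 2(1) unfolding cube_boundary_def by blast
  qed
qed

lemma case_nat_face:
  assumes "n \<ge> 1" "u \<in> {0..1::real}"
  shows "c \<in> topspace (cube (n - 1)) \<Longrightarrow> case_nat u c \<in> topspace (cube n)"
    "x \<in> topspace (cube n) \<Longrightarrow> (\<lambda>i. x (Suc i)) \<in> topspace (cube (n - 1))"
    "x \<in> topspace (cube n) \<Longrightarrow> x \<in> case_nat u ` topspace (cube (n - 1)) \<longleftrightarrow> x 0 = u"
proof -
  show 1: "case_nat u c \<in> topspace (cube n)" if "c \<in> topspace (cube (n - 1))" for c
  proof (rule cubeI)
    show "0 \<le> case_nat u c i \<and> case_nat u c i \<le> 1" if "i < n" for i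
      using assms(2) cubeD(1,2)[OF \<open>c \<in> topspace (cube (n - 1))\<close>, of "i - 1"] that by (cases i) auto
    show "case_nat u c i = undefined" if "\<not> i < n" for i
      using assms(1) cubeD(3)[OF \<open>c \<in> topspace (cube (n - 1))\<close>, of "i - 1"] that by (cases i) auto
  qed
  show 2: "(\<lambda>i. x (Suc i)) \<in> topspace (cube (n - 1))" if "x \<in> topspace (cube n)" for x
    using cubeD[OF that] assms(1) by (intro cubeI) auto
  have "x = case_nat (x 0) (\<lambda>i. x (Suc i))" for x :: "nat \<Rightarrow> real" by (rule ext) (simp split: nat.split)
  then show "x \<in> topspace (cube n) \<Longrightarrow> x \<in> case_nat u ` topspace (cube (n - 1)) \<longleftrightarrow> x 0 = u"
    using 2 by auto
qed

lemma inj_case_nat: "inj_on (case_nat u) S"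
proof (rule inj_onI)
  fix c c' :: "nat \<Rightarrow> 'a" assume eq: "case_nat u c = case_nat u c'"
  show "c = c'"
  proof
    fix i show "c i = c' i" using fun_cong[OF eq, of "Suc i"] by simp
  qed
qed

lemma case_nat_boundary:
  assumes "n \<ge> 1" "u = 0 \<or> u = 1"
  shows "case_nat u ` topspace (cube (n - 1)) \<subseteq> cube_boundary n"
proof
  fix x assume "x \<in> case_nat u ` topspace (cube (n - 1))"
  then obtain c where c: "c \<in> topspace (cube (n - 1))" "x = case_nat u c" by blast
  then have "x \<in> topspace (cube n)" "x 0 = u" using case_nat_face(1)[OF assms(1), of u c] assms(2) by auto
  then show "x \<in> cube_boundary n" using assms by (auto simp: cube_boundary_def intro!: exI[of _ 0])
qed

context topological_groupoid
begin

lemma pointed_face: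
  assumes n: "n \<ge> 1" and u: "u = 0 \<or> u = 1" and P: "pointed_bundle G a0 (cube n) (cube_boundary n) P"
  shows "pointed_bundle G a0 (cube (n - 1)) (topspace (cube (n - 1)))
     (restrict_bundle (topspace (cube (n - 1))) (case_nat u) P)"
proof (rule pointed_restrict[OF P _ inj_case_nat])
  let ?C = "cube (n - 1)"
  have u': "u \<in> {0..1}" using u by auto
  note cf = case_nat_face[OF n u']
  show "continuous_map ?C (cube n) (case_nat u)"
  proof (rule continuous_map_into_cube[OF cf(1)])
    show "continuous_map ?C euclideanreal (\<lambda>x. case_nat u x i)" if "i < n" for i
      using that continuous_map_cube_coord[OF continuous_map_self, of "i - 1" "n - 1"] by (cases i) auto
  qed
  let ?D = "subtopology (cube n) (case_nat u ` topspace ?C)"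
  have "continuous_map ?D ?C (\<lambda>x i. x (Suc i))"
  proof (rule continuous_map_into_cube)
    show "(\<lambda>i. x (Suc i)) \<in> topspace ?C" if "x \<in> topspace ?D" for x
      using cf(2) that by simp
    show "continuous_map ?D euclideanreal (\<lambda>x. x (Suc i))" if "i < n - 1" for i
      using that by (intro continuous_map_from_subtopology continuous_map_cube_coord[OF continuous_map_self]) auto
  qed
  moreover have "(\<lambda>i. x (Suc i)) = inv_into (topspace ?C) (case_nat u) x" if "x \<in> topspace ?D" for x
    using that inv_into_f_f[OF inj_case_nat] by fastforce
  ultimately show "continuous_map ?D ?C (inv_into (topspace ?C) (case_nat u))"
    by (rule continuous_map_eq)
qed (use case_nat_boundary[OF n u] in auto)

text \<open>A section over the whole base with constant anchor \<open>a0\<close> trivialises the bundle.\<close>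
lemma iso_of_global_sections:
  fixes P :: "('p, 'o, 'a, 'c) gbundle" and Q :: "('q, 'o, 'a, 'c) gbundle"
  assumes a0: "a0 \<in> topspace (Obj G)"
    and P: "pointed_bundle G a0 C (topspace C) P" and Q: "pointed_bundle G a0 C (topspace C) Q"
  shows "\<exists>\<phi>. bundle_iso G (topspace C) P Q \<phi>"
proof -
  let ?T = "trivial_bundle G a0 C"
  have T: "pointed_bundle G a0 C (topspace C) ?T" by (rule pointed_trivial[OF a0]) simp
  have m: "bundle_map G (topspace C) R ?T (\<lambda>p. (proj R p, diff_arrow G R (sect R (proj R p)) p)) id"
    if R: "pointed_bundle G a0 C (topspace C) R" for R :: "('z, 'o, 'a, 'c) gbundle"
  proof -
    note RR = pointed_bundleD(2)[OF R] and s = pointed_bundleD(4-6)[OF R]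
    note pj = principal_bundleD(4)[OF RR]
    have sc: "continuous_map (tot R) (tot R) (\<lambda>p. sect R (proj R p))"
      using pointed_bundleD(3)[OF R] continuous_map_compose2[OF _ principal_bundleD(1)[OF RR], of "tot R" "sect R"]
      by (simp add: local_section_def)
    have dc: "continuous_map (tot R) (Arr G) (\<lambda>p. diff_arrow G R (sect R (proj R p)) p)"
      by (rule continuous_map_diff_arrow[OF RR sc]) (use s pj in auto)
    note d = diff_arrow[OF RR s(2)[OF pj] _ s(3)[OF pj]]
    show ?thesis
      unfolding bundle_map_def
    proof (intro conjI ballI impI)
      show "continuous_map (tot R) (tot ?T) (\<lambda>p. (proj R p, diff_arrow G R (sect R (proj R p)) p))"
        using principal_bundleD(1)[OF RR] dc d(2) s(1) pj
        by (auto intro!: continuous_map_pairedI continuous_map_into_subtopology)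
    next
      fix p g assume p: "p \<in> topspace (tot R)" "g \<in> topspace (Arr G)" "anchor R p = tgt G g"
      show "(proj R (act R p g), diff_arrow G R (sect R (proj R (act R p g))) (act R p g)) =
          act ?T (proj R p, diff_arrow G R (sect R (proj R p)) p) g"
        using diff_arrow_right[OF RR s(2)[OF pj[OF p(1)]] p(1) s(3)[OF pj[OF p(1)]] p(2,3)] principal_bundleD(8)[OF RR p]
        by simp
    next
      fix a assume "a \<in> topspace C"
      then show "(proj R (sect R a), diff_arrow G R (sect R (proj R (sect R a))) (sect R a)) = sect ?T (id a)"
        using s diff_arrow_self[OF RR] by simp
    qed (use d in auto)
  qed
  show ?thesis
    by (rule bundle_iso_of_bundle_maps[OF pointed_bundleD(2)[OF P] pointed_bundleD(2)[OF Q] pointed_bundleD(2)[OF T] m[OF P] m[OF Q]])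
       (use pointed_bundleD(5,6)[OF P] pointed_bundleD(5,6)[OF Q] in auto)
qed

end

section \<open>Concatenation\<close>

text \<open>A partial bijection between two disjoint sets generates an equivalence relation without
  longer chains. The first equation expresses that domain and range are disjoint.\<close>
lemma rtrancl_matching:
  assumes "E O E = {}" "E\<inverse> O E \<subseteq> Id" "E O E\<inverse> \<subseteq> Id"
  shows "(E \<union> E\<inverse>)\<^sup>* = Id \<union> E \<union> E\<inverse>"
proof
  show "(E \<union> E\<inverse>)\<^sup>* \<subseteq> Id \<union> E \<union> E\<inverse>"
  proof (rule subrelI)
    fix x y assume "(x, y) \<in> (E \<union> E\<inverse>)\<^sup>*"
    then show "(x, y) \<in> Id \<union> E \<union> E\<inverse>"
      by (induction rule: rtrancl_induct) (use assms in blast)+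
  qed
qed auto

locale bundle_pair = topological_groupoid G for G :: "('o, 'a) groupoid_data" +
  fixes a0 :: 'o and n :: nat and P Q :: "('p, 'o, 'a, nat \<Rightarrow> real) gbundle"
  assumes a0: "a0 \<in> topspace (Obj G)" and n: "n \<ge> 1"
    and P: "pointed_bundle G a0 (cube n) (cube_boundary n) P"
    and Q: "pointed_bundle G a0 (cube n) (cube_boundary n) Q"
begin

abbreviation "\<phi> \<equiv> face_iso G n P Q"
definition "piece k = (if k then Q else P)"
definition "E = {((False, p), (True, \<phi> p)) | p. p \<in> topspace (tot P) \<and> proj P p 0 = 1}"
definition "cls z = (E \<union> E\<inverse>)\<^sup>* `` {z}"
definition "faceP = {p \<in> topspace (tot P). proj P p 0 = 1}"
definition "faceQ = {p \<in> topspace (tot Q). proj Q p 0 = 0}"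
definition "T = concat_bundle G n P Q"

lemma piece: "pointed_bundle G a0 (cube n) (cube_boundary n) (piece k)"
  using P Q by (simp add: piece_def)

lemmas pb = pointed_bundleD(2)[OF piece]

lemma pj: "p \<in> topspace (tot (piece k)) \<Longrightarrow> proj (piece k) p \<in> topspace (cube n)"
  by (rule principal_bundleD(4)[OF pb])

lemma face_iso: "bundle_iso G (topspace (cube (n - 1)))
        (restrict_bundle (topspace (cube (n - 1))) (case_nat 1) P)
        (restrict_bundle (topspace (cube (n - 1))) (case_nat 0) Q) \<phi>"
  unfolding face_iso_def
  using someI_ex[OF iso_of_global_sections[OF a0 pointed_face[OF n _ P] pointed_face[OF n _ Q], of 1 0]] by simp

lemma face_restrict:
  "p \<in> topspace (tot (piece k)) \<Longrightarrow> u = 0 \<or> u = 1 \<Longrightarrow>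
    proj (piece k) p \<in> case_nat u ` topspace (cube (n - 1)) \<longleftrightarrow> proj (piece k) p 0 = u"
  by (rule case_nat_face(3)[OF n _ pj]) auto

lemma face_subtopology:
  "subtopology (tot P) {p. proj P p \<in> case_nat 1 ` topspace (cube (n - 1))} = subtopology (tot P) faceP"
  "subtopology (tot Q) {p. proj Q p \<in> case_nat 0 ` topspace (cube (n - 1))} = subtopology (tot Q) faceQ"
proof -
  have "{x \<in> topspace (tot P). proj P x \<in> case_nat 1 ` topspace (cube (n - 1))} = faceP"
    "{x \<in> topspace (tot Q). proj Q x \<in> case_nat 0 ` topspace (cube (n - 1))} = faceQ"
    using face_restrict[of _ False 1] face_restrict[of _ True 0] by (auto simp: faceP_def faceQ_def piece_def)
  then show 
    "subtopology (tot P) {p. proj P p \<in> case_nat 1 ` topspace (cube (n - 1))} = subtopology (tot P) faceP"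
    "subtopology (tot Q) {p. proj Q p \<in> case_nat 0 ` topspace (cube (n - 1))} = subtopology (tot Q) faceQ"
    by (simp_all only: subtopology_Collect[where P = "\<lambda>p. proj P p \<in> _"] subtopology_Collect[where P = "\<lambda>p. proj Q p \<in> _"])
qed

lemma phi_homeo: "homeomorphic_map (subtopology (tot P) faceP) (subtopology (tot Q) faceQ) \<phi>"
  using face_iso unfolding bundle_iso_def restrict_bundle_simps face_subtopology by blast

lemma topspace_face: "topspace (subtopology (tot P) faceP) = faceP" "topspace (subtopology (tot Q) faceQ) = faceQ"
  by (auto simp: faceP_def faceQ_def)

lemma phi_inj: "inj_on \<phi> faceP" and phi_im: "\<phi> ` faceP = faceQ"
  using homeomorphic_imp_injective_map[OF phi_homeo] homeomorphic_imp_surjective_map[OF phi_homeo] topspace_face by auto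

lemma phi:
  assumes "p \<in> faceP"
  shows "\<phi> p \<in> faceQ" "proj Q (\<phi> p) = (proj P p)(0 := 0)" "anchor Q (\<phi> p) = anchor P p"
    "g \<in> topspace (Arr G) \<Longrightarrow> anchor P p = tgt G g \<Longrightarrow> \<phi> (act P p g) = act Q (\<phi> p) g"
proof -
  show fQ: "\<phi> p \<in> faceQ" using phi_im assms by blast
  have t: "p \<in> topspace (tot (restrict_bundle (topspace (cube (n - 1))) (case_nat 1) P))"
    unfolding restrict_bundle_simps face_subtopology topspace_face by (rule assms)
  have "inv_into (topspace (cube (n - 1))) (case_nat 0) (proj Q (\<phi> p)) = inv_into (topspace (cube (n - 1))) (case_nat 1) (proj P p)"
    using face_iso t unfolding bundle_iso_def by simp
  moreover have "proj P p \<in> case_nat 1 ` topspace (cube (n - 1))" "proj Q (\<phi> p) \<in> case_nat 0 ` topspace (cube (n - 1))"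
    using assms fQ face_restrict[of p False 1] face_restrict[of "\<phi> p" True 0] by (auto simp: faceP_def faceQ_def piece_def)
  then obtain c c' where c: "c \<in> topspace (cube (n - 1))" "proj P p = case_nat 1 c"
     "c' \<in> topspace (cube (n - 1))" "proj Q (\<phi> p) = case_nat 0 c'" by blast
  ultimately have "c = c'" using inv_into_f_f[OF inj_case_nat] by metis
  then show "proj Q (\<phi> p) = (proj P p)(0 := 0)" using c by (auto split: nat.split)
  show "anchor Q (\<phi> p) = anchor P p"
    using face_iso t unfolding bundle_iso_def by simp
  show "g \<in> topspace (Arr G) \<Longrightarrow> anchor P p = tgt G g \<Longrightarrow> \<phi> (act P p g) = act Q (\<phi> p) g"
    using face_iso t unfolding bundle_iso_def by simp
qed

lemma phi_sect:
  assumes "x \<in> topspace (cube n)" "x 0 = 1"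
  shows "sect P x \<in> faceP" "\<phi> (sect P x) = sect Q (x(0 := 0))"
proof -
  have b: "x \<in> cube_boundary n" using assms n by (auto simp: cube_boundary_def intro!: exI[of _ 0])
  show "sect P x \<in> faceP" using pointed_bundleD(5,6)[OF P b] assms(2) by (simp add: faceP_def)
  have "x \<in> case_nat 1 ` topspace (cube (n - 1))" using case_nat_face(3)[OF n _ assms(1), of 1] assms(2) by simp
  then obtain c where c: "c \<in> topspace (cube (n - 1))" "x = case_nat 1 c" by blast
  then have "\<phi> (sect P x) = sect Q (case_nat 0 c)" using face_iso unfolding bundle_iso_def by simp
  moreover have "case_nat 0 c = x(0 := 0)" using c by (auto split: nat.split)
  ultimately show "\<phi> (sect P x) = sect Q (x(0 := 0))" by simp
qed

lemma E_eq: "E = {((False, p), (True, \<phi> p)) | p. p \<in> faceP}"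
  by (auto simp: E_def faceP_def)

lemma cls_eq: "cls z = (Id \<union> E \<union> E\<inverse>) `` {z}"
proof -
  have "E O E = {}" by (auto simp: E_eq)
  moreover have "E\<inverse> O E \<subseteq> Id" by (auto simp: E_eq)
  moreover have "E O E\<inverse> \<subseteq> Id" using phi_inj by (auto simp: E_eq inj_on_def)
  ultimately show ?thesis unfolding cls_def by (simp only: rtrancl_matching)
qed

lemma cls_self: "z \<in> cls z" by (simp add: cls_eq)

lemma cls_in: "w \<in> cls z \<longleftrightarrow> w = z \<or> (z, w) \<in> E \<or> (w, z) \<in> E"
  by (auto simp: cls_eq)

lemma cls_eq_iff: "cls z = cls w \<longleftrightarrow> w \<in> cls z"
proof
  assume "w \<in> cls z"
  then show "cls z = cls w"
  proof -
    have "equiv UNIV ((E \<union> E\<inverse>)\<^sup>*)"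
      by (intro equivI refl_rtrancl sym_rtrancl trans_rtrancl) (auto simp: sym_def)
    then show ?thesis using \<open>w \<in> cls z\<close> equiv_class_eq[of UNIV _ z w] by (simp add: cls_def)
  qed
qed (use cls_self in metis)

lemma cls_inj: "cls (k, p) = cls (k, p') \<longleftrightarrow> p = p'"
  unfolding cls_eq_iff cls_in by (auto simp: E_eq)

lemma cls_seam: "cls (False, p) = cls (True, r) \<longleftrightarrow> p \<in> faceP \<and> r = \<phi> p"
  unfolding cls_eq_iff cls_in by (auto simp: E_eq)

lemma T_def': "T = (let rep = (\<lambda>c. SOME z. z \<in> c)
      in \<lparr>tot = quotient_topology (sum_topology (\<lambda>k. tot (piece k)) UNIV) cls,
          proj = (\<lambda>c. let (k, p) = rep c in to_half k (proj (piece k) p)),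
          anchor = (\<lambda>c. let (k, p) = rep c in anchor (piece k) p),
          act = (\<lambda>c g. let (k, p) = rep c in cls (k, act (piece k) p g)),
          sect = (\<lambda>x. let k = (x 0 > 1 / 2) in cls (k, sect (piece k) (from_half k x)))\<rparr>)"
  unfolding T_def concat_bundle_def Let_def cls_def[abs_def] piece_def E_def by simp

lemma rep:
  obtains k p where "(SOME z. z \<in> cls w) = (k, p)" "(k, p) = w \<or> (w, (k, p)) \<in> E \<or> ((k, p), w) \<in> E"
  using someI[of "\<lambda>z. z \<in> cls w", OF cls_self] cls_in by (metis surj_pair)

lemma seam_proj: "p \<in> faceP \<Longrightarrow> to_half True (proj Q (\<phi> p)) = to_half False (proj P p)"
  by (auto simp: phi to_half_def faceP_def)

lemma T_proj: "proj T (cls (k, p)) = to_half k (proj (piece k) p)"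
  by (rule rep[of "(k, p)"]) (auto simp: T_def' Let_def E_eq seam_proj piece_def)

lemma T_anchor: "anchor T (cls (k, p)) = anchor (piece k) p"
  by (rule rep[of "(k, p)"]) (auto simp: T_def' Let_def E_eq phi piece_def)

lemma faceP_act: "p \<in> faceP \<Longrightarrow> g \<in> topspace (Arr G) \<Longrightarrow> anchor P p = tgt G g \<Longrightarrow> act P p g \<in> faceP"
  using principal_bundleD(7,8)[OF pointed_bundleD(2)[OF P]] by (auto simp: faceP_def)

lemma T_act:
  assumes "g \<in> topspace (Arr G)" "anchor (piece k) p = tgt G g"
  shows "act T (cls (k, p)) g = cls (k, act (piece k) p g)"
proof (rule rep[of "(k, p)"])
  fix k' p' assume r: "(SOME z. z \<in> cls (k, p)) = (k', p')" "(k', p') = (k, p) \<or> ((k, p), (k', p')) \<in> E \<or> ((k', p'), (k, p)) \<in> E"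
  have a: "act T (cls (k, p)) g = cls (k', act (piece k') p' g)" using r(1) by (simp add: T_def' Let_def)
  have e: "cls (False, act P x g) = cls (True, act Q (\<phi> x) g)" if "x \<in> faceP" "anchor P x = tgt G g" for x
    using cls_seam faceP_act[OF that(1) assms(1) that(2)] phi(4)[OF that(1) assms(1) that(2)] by simp
  show ?thesis
    using r(2) a e assms(2) by (auto simp: E_eq piece_def phi(3))
qed

lemma T_sect: "sect T x = cls (x 0 > 1 / 2, sect (piece (x 0 > 1 / 2)) (from_half (x 0 > 1 / 2) x))"
  by (simp add: T_def' Let_def)

lemma T_tot: "tot T = quotient_topology (sum_topology (\<lambda>k. tot (piece k)) UNIV) cls"
  by (simp add: T_def' Let_def)

lemma topspace_T: "topspace (tot T) = (\<Union>k. (\<lambda>p. cls (k, p)) ` topspace (tot (piece k)))"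
  unfolding T_tot by auto

lemma T_cases:
  assumes "t \<in> topspace (tot T)"
  obtains k p where "p \<in> topspace (tot (piece k))" "t = cls (k, p)"
  using assms unfolding topspace_T by blast

lemma closedin_T:
  "closedin (tot T) C \<longleftrightarrow> C \<subseteq> topspace (tot T) \<and> (\<forall>k. closedin (tot (piece k)) {p \<in> topspace (tot (piece k)). cls (k, p) \<in> C})"
proof -
  have q: "quotient_map (sum_topology (\<lambda>k. tot (piece k)) UNIV) (tot T) cls"
    unfolding T_tot by (rule quotient_map_quotient_topology)
  have "closedin (sum_topology (\<lambda>k. tot (piece k)) UNIV) {x \<in> topspace (sum_topology (\<lambda>k. tot (piece k)) UNIV). cls x \<in> C}
     \<longleftrightarrow> (\<forall>k. closedin (tot (piece k)) {p \<in> topspace (tot (piece k)). cls (k, p) \<in> C})"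
    unfolding closedin_sum_topology by auto
  moreover have "\<forall>U. U \<subseteq> topspace (tot T) \<longrightarrow>
      closedin (sum_topology (\<lambda>k. tot (piece k)) UNIV) {x \<in> topspace (sum_topology (\<lambda>k. tot (piece k)) UNIV). cls x \<in> U}
      = closedin (tot T) U"
    using q unfolding quotient_map_closedin by (rule conjunct2)
  ultimately show ?thesis
    using closedin_subset[of "tot T" C] by blast
qed

lemma cls_cont: "continuous_map (tot (piece k)) (tot T) (\<lambda>p. cls (k, p))"
  unfolding continuous_map_closedin using closedin_T topspace_T by auto

lemma closed_faces: "closedin (tot P) faceP" "closedin (tot Q) faceQ"
proof -
  have c: "continuous_map (tot R) euclideanreal (\<lambda>p. proj R p 0)" if "principal_bundle G (cube n) R" for R :: "('p, 'o, 'a, nat \<Rightarrow> real) gbundle"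
    by (rule continuous_map_cube_coord[OF principal_bundleD(1)[OF that]]) (use n in simp)
  show "closedin (tot P) faceP" "closedin (tot Q) faceQ"
    using closedin_continuous_map_preimage[OF c[OF pointed_bundleD(2)[OF P]], of "{1}"]
      closedin_continuous_map_preimage[OF c[OF pointed_bundleD(2)[OF Q]], of "{0}"]
    by (auto simp: faceP_def faceQ_def)
qed

text \<open>The pieces are glued along a homeomorphism of closed subspaces, so each of them is closed in the result. Thus
  continuity can be tested on the two pieces (\<open>pasting_parts\<close>), also for functions of several
  points of the result, where products of quotient maps would not do.\<close>
lemma closed_map_cls: "closed_map (tot (piece k)) (tot T) (\<lambda>p. cls (k, p))"
  unfolding closed_map_def
proof (intro allI impI)
  fix C assume C: "closedin (tot (piece k)) C"
  have sub: "C \<subseteq> topspace (tot (piece k))" using C closedin_subset by blast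
  have "closedin (tot (piece l)) {p \<in> topspace (tot (piece l)). cls (l, p) \<in> (\<lambda>p. cls (k, p)) ` C}" for l
  proof -
    consider "l = k" | "k = False" "l = True" | "k = True" "l = False" by (cases k; cases l) auto
    then show ?thesis
    proof cases
      case 1
      then have "{p \<in> topspace (tot (piece l)). cls (l, p) \<in> (\<lambda>p. cls (k, p)) ` C} = C"
        using sub cls_inj by auto
      then show ?thesis using C 1 by simp
    next
      case 2
      have "{p \<in> topspace (tot Q). cls (True, p) \<in> (\<lambda>p. cls (False, p)) ` C} = \<phi> ` (C \<inter> faceP)"
      proof (rule subset_antisym; rule subsetI)
        fix q assume "q \<in> {p \<in> topspace (tot Q). cls (True, p) \<in> (\<lambda>p. cls (False, p)) ` C}"
        then have "cls (True, q) \<in> (\<lambda>p. cls (False, p)) ` C" by blast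
        then obtain c where c: "cls (True, q) = cls (False, c)" "c \<in> C" by (rule imageE)
        show "q \<in> \<phi> ` (C \<inter> faceP)" using c(2) c(1)[symmetric, unfolded cls_seam] by blast
      next
        fix q assume "q \<in> \<phi> ` (C \<inter> faceP)"
        then obtain c where c: "c \<in> C" "c \<in> faceP" "q = \<phi> c" by blast
        then have "cls (True, q) = cls (False, c)" "q \<in> topspace (tot Q)" using cls_seam phi(1) by (auto simp: faceQ_def)
        then show "q \<in> {p \<in> topspace (tot Q). cls (True, p) \<in> (\<lambda>p. cls (False, p)) ` C}" using c(1) by blast
      qed
      moreover have "closedin (subtopology (tot P) faceP) (C \<inter> faceP)"
        using C 2 by (auto simp: piece_def closedin_subtopology)
      then have "closedin (subtopology (tot Q) faceQ) (\<phi> ` (C \<inter> faceP))"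
        using homeomorphic_imp_closed_map[OF phi_homeo] by (simp add: closed_map_def)
      then have "closedin (tot Q) (\<phi> ` (C \<inter> faceP))"
        using closed_faces(2) closedin_trans_full by blast
      ultimately show ?thesis using 2 by (simp add: piece_def)
    next
      case 3
      have "{p \<in> topspace (tot P). cls (False, p) \<in> (\<lambda>p. cls (True, p)) ` C} = {p \<in> faceP. \<phi> p \<in> C}"
        using cls_seam by (auto simp: faceP_def image_iff)
      moreover have "closedin (subtopology (tot Q) faceQ) (C \<inter> faceQ)"
        using C 3 by (auto simp: piece_def closedin_subtopology)
      then have "closedin (subtopology (tot P) faceP) {p \<in> topspace (subtopology (tot P) faceP). \<phi> p \<in> C \<inter> faceQ}"
        using homeomorphic_imp_continuous_map[OF phi_homeo] closedin_continuous_map_preimage by blast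
      then have "closedin (tot P) {p \<in> faceP. \<phi> p \<in> C \<inter> faceQ}"
        using closed_faces(1) closedin_trans_full unfolding topspace_face by blast
      moreover have "{p \<in> faceP. \<phi> p \<in> C \<inter> faceQ} = {p \<in> faceP. \<phi> p \<in> C}" using phi(1) by blast
      ultimately show ?thesis using 3 by (simp add: piece_def)
    qed
  qed
  then show "closedin (tot T) ((\<lambda>p. cls (k, p)) ` C)"
    unfolding closedin_T using sub topspace_T by blast
qed

definition "half_part k = (\<lambda>p. cls (k, p)) ` topspace (tot (piece k))"

lemma closed_part: "closedin (tot T) (half_part k)"
  using closed_map_cls[of k] unfolding half_part_def closed_map_def by auto

lemma part_iff: "t \<in> topspace (tot T) \<Longrightarrow> t \<in> half_part k \<longleftrightarrow> proj T t \<in> half_cube n k"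
proof -
  assume t: "t \<in> topspace (tot T)"
  obtain l p where p: "p \<in> topspace (tot (piece l))" "t = cls (l, p)" using T_cases[OF t] .
  have pt: "proj T t = to_half l (proj (piece l) p)" using p T_proj by simp
  have 1: "t \<in> half_part k \<Longrightarrow> proj T t \<in> half_cube n k"
    using T_proj to_half_in[OF n pj] by (auto simp: half_part_def)
  have 2: "t \<in> half_part k" if h: "proj T t \<in> half_cube n k"
  proof (cases "l = k")
    case True
    then show ?thesis using p by (auto simp: half_part_def)
  next
    case False
    show ?thesis
    proof (cases l)
      case True
      then have "k" "False" if "\<not> k" "proj Q p 0 \<noteq> 0"
        using h pt p(1) cubeD(1)[OF pj[OF p(1)], of 0] n that by (auto simp: half_cube_def to_half_def piece_def)
      then have "p \<in> faceQ" "\<not> k" using False True p by (auto simp: faceQ_def piece_def)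
      then obtain r where "r \<in> faceP" "p = \<phi> r" using phi_im by blast
      then have "t = cls (False, r)" "r \<in> topspace (tot P)" using cls_seam p(2) True by (auto simp: faceP_def)
      then show ?thesis using \<open>\<not> k\<close> by (auto simp: half_part_def piece_def)
    next
      case l: False
      then have k: "k" using False by simp
      then have "proj P p 0 = 1"
        using h pt p(1) l cubeD(2)[OF pj[OF p(1)], of 0] n by (auto simp: half_cube_def to_half_def piece_def)
      then have f: "p \<in> faceP" using p l by (simp add: faceP_def piece_def)
      then have "t = cls (True, \<phi> p)" "\<phi> p \<in> topspace (tot Q)" using cls_seam p(2) l phi(1)[OF f] by (auto simp: faceQ_def)
      then show ?thesis using k by (auto simp: half_part_def piece_def)
    qed
  qed
  show ?thesis using 1 2 by blast
qed

definition "back k t = inv_into (topspace (tot (piece k))) (\<lambda>p. cls (k, p)) t"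

lemma back_cls [simp]: "p \<in> topspace (tot (piece k)) \<Longrightarrow> back k (cls (k, p)) = p"
  unfolding back_def by (rule inv_into_f_f) (auto simp: inj_on_def cls_inj)

lemma cls_back: "t \<in> half_part k \<Longrightarrow> cls (k, back k t) = t" "t \<in> half_part k \<Longrightarrow> back k t \<in> topspace (tot (piece k))"
  by (auto simp: half_part_def)

lemma back_cont: "continuous_map (subtopology (tot T) (half_part k)) (tot (piece k)) (back k)"
proof -
  have "embedding_map (tot (piece k)) (tot T) (\<lambda>p. cls (k, p))"
    by (rule injective_closed_imp_embedding_map[OF cls_cont closed_map_cls]) (auto simp: inj_on_def cls_inj)
  then have h: "homeomorphic_map (tot (piece k)) (subtopology (tot T) (half_part k)) (\<lambda>p. cls (k, p))"
    by (simp add: embedding_map_def half_part_def)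
  then obtain g where g: "homeomorphic_maps (tot (piece k)) (subtopology (tot T) (half_part k)) (\<lambda>p. cls (k, p)) g"
    by (auto simp: homeomorphic_map_maps)
  have sub: "half_part k \<subseteq> topspace (tot T)" using closed_part closedin_subset by blast
  show ?thesis
  proof (rule continuous_map_eq)
    show "continuous_map (subtopology (tot T) (half_part k)) (tot (piece k)) g"
      using g by (simp add: homeomorphic_maps_def)
    show "g t = back k t" if "t \<in> topspace (subtopology (tot T) (half_part k))" for t
      using g that by (auto simp: homeomorphic_maps_def half_part_def)
  qed
qed

lemma part_cover: "t \<in> topspace (tot T) \<Longrightarrow> \<exists>k. t \<in> half_part k"
  unfolding topspace_T half_part_def by blast

lemma pasting_parts:
  assumes u: "continuous_map X (tot T) u"
    and f: "\<And>k. continuous_map (subtopology X {x \<in> topspace X. u x \<in> half_part k}) Y f"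
  shows "continuous_map X Y f"
proof (rule pasting_lemma_closed[where I = UNIV and T = "\<lambda>k. {x \<in> topspace X. u x \<in> half_part k}" and f = "\<lambda>_. f"])
  show "closedin X {x \<in> topspace X. u x \<in> half_part i}" for i
    using closedin_continuous_map_preimage[OF u closed_part] .
  show "\<exists>j. j \<in> UNIV \<and> x \<in> {x \<in> topspace X. u x \<in> half_part j} \<and> f x = f x" if "x \<in> topspace X" for x
    using part_cover[OF continuous_map_in[OF u that]] that by blast
qed (use f in auto)

lemma back_cont_on:
  assumes u: "continuous_map X (tot T) u"
  shows "continuous_map (subtopology X {x \<in> topspace X. u x \<in> half_part k}) (tot (piece k)) (\<lambda>x. back k (u x))"
  by (rule continuous_map_subtopology_compose[OF back_cont continuous_map_from_subtopology[OF u]]) auto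

lemma T_on_part:
  assumes "t \<in> half_part k"
  shows "proj T t = to_half k (proj (piece k) (back k t))" "anchor T t = anchor (piece k) (back k t)"
    "g \<in> topspace (Arr G) \<Longrightarrow> anchor T t = tgt G g \<Longrightarrow> act T t g = cls (k, act (piece k) (back k t) g)"
  using T_proj[of k "back k t"] T_anchor[of k "back k t"] T_act[of g k "back k t"] cls_back(1)[OF assms] by auto

lemma part_act:
  assumes "t \<in> half_part k" "g \<in> topspace (Arr G)" "anchor T t = tgt G g"
  shows "act T t g \<in> half_part k" "back k (act T t g) = act (piece k) (back k t) g"
proof -
  have "act (piece k) (back k t) g \<in> topspace (tot (piece k))"
    using principal_bundleD(7)[OF pb cls_back(2)[OF assms(1)] assms(2)] T_on_part(2)[OF assms(1)] assms(3) by simp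
  then show "act T t g \<in> half_part k" "back k (act T t g) = act (piece k) (back k t) g"
    using T_on_part(3)[OF assms] by (auto simp: half_part_def)
qed

lemma to_half_inj: "to_half k x = to_half k y \<Longrightarrow> x = y"
  by (metis half_inverse(1))

text \<open>Two points with the same projection lie in a common piece, and their difference can be computed there.\<close>
lemma T_diff:
  assumes t: "t \<in> half_part k" "t' \<in> half_part k" "proj T t = proj T t'"
  shows "diff_arrow G T t t' = diff_arrow G (piece k) (back k t) (back k t')"
proof -
  have e: "proj (piece k) (back k t) = proj (piece k) (back k t')"
    using t T_on_part(1)[OF t(1)] T_on_part(1)[OF t(2)] to_half_inj by metis
  note d = diff_arrow[OF pb cls_back(2)[OF t(1)] cls_back(2)[OF t(2)] e]
  show ?thesis
    unfolding diff_arrow_def[of G T]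
  proof (rule the_equality)
    show "diff_arrow G (piece k) (back k t) (back k t') \<in> topspace (Arr G) \<and>
      tgt G (diff_arrow G (piece k) (back k t) (back k t')) = anchor T t \<and>
      act T t (diff_arrow G (piece k) (back k t) (back k t')) = t'"
      using d T_on_part(2,3)[OF t(1)] cls_back(1)[OF t(2)] by simp
    fix g assume g: "g \<in> topspace (Arr G) \<and> tgt G g = anchor T t \<and> act T t g = t'"
    then have "act (piece k) (back k t) g = back k t'" using part_act(2)[OF t(1), of g] by simp
    then show "g = diff_arrow G (piece k) (back k t) (back k t')"
      using diff_arrow_eqI[OF pb cls_back(2)[OF t(1)], of g "back k t'"] g T_on_part(2)[OF t(1)] by simp
  qed
qed

lemma T_diff_all:
  assumes t: "t \<in> topspace (tot T)" "t' \<in> topspace (tot T)" "proj T t = proj T t'"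
  shows "tgt G (diff_arrow G T t t') = anchor T t" "act T t (diff_arrow G T t t') = t'"
proof -
  obtain k where k: "t \<in> half_part k" using part_cover[OF t(1)] by blast
  then have k': "t' \<in> half_part k" using part_iff t by metis
  have e: "proj (piece k) (back k t) = proj (piece k) (back k t')"
    using t T_on_part(1)[OF k] T_on_part(1)[OF k'] to_half_inj by metis
  note d = diff_arrow[OF pb cls_back(2)[OF k] cls_back(2)[OF k'] e]
  show "tgt G (diff_arrow G T t t') = anchor T t" "act T t (diff_arrow G T t t') = t'"
    unfolding T_diff[OF k k' t(3)] using d T_on_part(2,3)[OF k] cls_back(1)[OF k'] by auto
qed

lemma T_act_closed:
  assumes "t \<in> topspace (tot T)" "g \<in> topspace (Arr G)" "anchor T t = tgt G g"
  shows "act T t g \<in> topspace (tot T)" "proj T (act T t g) = proj T t" "anchor T (act T t g) = src G g"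
proof -
  obtain k where k: "t \<in> half_part k" using part_cover[OF assms(1)] by blast
  note a = part_act[OF k assms(2,3)]
  note c = cls_back(2)[OF k] assms(2) 
  have an: "anchor (piece k) (back k t) = tgt G g" using T_on_part(2)[OF k] assms(3) by simp
  show "act T t g \<in> topspace (tot T)" using a(1) closed_part closedin_subset by blast
  show "proj T (act T t g) = proj T t" "anchor T (act T t g) = src G g"
    using T_on_part(1,2)[OF a(1)] T_on_part(1,2)[OF k] a(2) principal_bundleD(8,9)[OF pb c an] by auto
qed

lemma T_right_action: "right_action G (tot T) (anchor T) (act T)"
proof (rule right_actionI)
  show "continuous_map (tot T) (Obj G) (anchor T)"
  proof (rule pasting_parts[OF continuous_map_self])
    fix k
    show "continuous_map (subtopology (tot T) {x \<in> topspace (tot T). x \<in> half_part k}) (Obj G) (anchor T)"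
      by (rule continuous_map_eq[OF continuous_map_compose2[OF principal_bundleD(6)[OF pb] back_cont_on[OF continuous_map_self]]])
         (simp add: T_on_part[of _ k])
  qed
  let ?X = "subtopology (prod_topology (tot T) (Arr G)) {z. anchor T (fst z) = tgt G (snd z)}"
  show "continuous_map ?X (tot T) (\<lambda>z. act T (fst z) (snd z))"
  proof (rule pasting_parts[where u = fst])
    fix k
    let ?Y = "subtopology ?X {x \<in> topspace ?X. fst x \<in> half_part k}"
    have "continuous_map ?Y (tot (piece k)) (\<lambda>z. act (piece k) (back k (fst z)) (snd z))"
      by (intro continuous_map_act[OF principal_bundleD(3)[OF pb]] back_cont_on continuous_map_from_subtopology[of ?X] continuous_map_subtopology_fst_snd)
         (auto simp: T_on_part[of _ k])
    from continuous_map_compose2[OF cls_cont this]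
    show "continuous_map ?Y (tot T) (\<lambda>z. act T (fst z) (snd z))"
      by (rule continuous_map_eq) (auto simp: T_on_part(3)[of _ k])
  qed simp
next
  fix t assume "t \<in> topspace (tot T)"
  then obtain k where k: "t \<in> half_part k" using part_cover by blast
  have o: "anchor (piece k) (back k t) \<in> topspace (Obj G)" using principal_bundleD(5)[OF pb cls_back(2)[OF k]] .
  show "act T t (gid G (anchor T t)) = t"
    using T_on_part(2)[OF k] T_on_part(3)[OF k, of "gid G (anchor T t)"] o principal_bundleD(10)[OF pb cls_back(2)[OF k]] cls_back(1)[OF k]
    by simp
  fix g h assume g: "g \<in> topspace (Arr G)" "h \<in> topspace (Arr G)" "anchor T t = tgt G g" "src G g = tgt G h"
  have gh: "gmul G g h \<in> topspace (Arr G)" "anchor T t = tgt G (gmul G g h)" using g by auto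
  have an: "anchor T (act T t g) = tgt G h" using T_act_closed(3)[OF \<open>t \<in> topspace (tot T)\<close> g(1,3)] g(4) by simp
  note a = part_act[OF k g(1,3)]
  show "act T (act T t g) h = act T t (gmul G g h)"
    using T_on_part(3)[OF a(1) g(2) an] T_on_part(3)[OF k gh] a(2)
      principal_bundleD(11)[OF pb cls_back(2)[OF k] g(1,2) _ g(4)] T_on_part(2)[OF k] g(3) by simp
qed (use T_act_closed in auto)

text \<open>The section of the concatenation takes its value on the seam from the first piece; it agrees with the
  section of the second one because the isomorphism of the faces preserves sections.\<close>
lemma cls_boundary:
  assumes a: "a \<in> cube_boundary n"
  shows "cls (k, sect (piece k) a) = sect T (to_half k a)"
proof -
  have aC: "a \<in> topspace (cube n)" using a cube_boundary_sub by blast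
  have a0: "0 \<le> a 0" "a 0 \<le> 1" using cubeD(1,2)[OF aC, of 0] n by auto
  show ?thesis
  proof (cases "to_half k a 0 > 1 / 2 \<longleftrightarrow> k")
    case True
    then show ?thesis unfolding T_sect by simp
  next
    case False
    then have k: "k" "a 0 = 0" "\<not> to_half k a 0 > 1 / 2" using a0 by (cases k; auto simp: to_half_def)+
    let ?b = "a(0 := 1)"
    have b: "from_half False (to_half True a) = ?b" using k by (auto simp: from_half_def to_half_def)
    have "?b \<in> topspace (cube n)" using cubeD[OF aC] n by (intro cubeI) auto
    from phi_sect[OF this] have "cls (False, sect P ?b) = cls (True, sect Q a)"
      using k(2) cls_seam by (simp add: fun_upd_idem)
    then show ?thesis unfolding T_sect using k b by (simp add: piece_def)
  qed
qed

lemma T_sect_half: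
  assumes "x \<in> concat_sections n" "x \<in> half_cube n k"
  shows "sect T x = cls (k, sect (piece k) (from_half k x))"
  using cls_boundary[OF from_half_boundary[OF n assms], of k] by simp

text \<open>Local sections of the two pieces extend the prescribed sections on the seam, and these are identified by
  the gluing. This is where the extension property of pointed bundles is indispensable: arbitrary local
  sections of the two pieces would not fit together.\<close>
lemma T_local_section:
  assumes b: "b \<in> topspace (cube n)"
  shows "\<exists>V s. openin (cube n) V \<and> b \<in> V \<and> local_section (cube n) T V s \<and> (\<forall>a\<in>V \<inter> concat_sections n. s a = sect T a)"
proof -
  \<comment> \<open>If \<open>b\<close> lies outside a half, the empty domain in that half keeps the
    neighbourhood \<open>W\<close> below away from it.\<close>
  have "\<exists>V s. openin (cube n) V \<and> (b \<in> half_cube n k \<longrightarrow> from_half k b \<in> V) \<and> local_section (cube n) (piece k) V s \<and>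
      (\<forall>a\<in>V \<inter> cube_boundary n. s a = sect (piece k) a)" for k
  proof (cases "b \<in> half_cube n k")
    case True
    then show ?thesis using pointed_bundleD(7)[OF piece from_half_in[OF n True]] by blast
  next
    case False
    then show ?thesis by (intro exI[of _ "{}"]) (auto simp: local_section_def)
  qed
  then obtain V s where V: "\<And>k. openin (cube n) (V k)" "\<And>k. b \<in> half_cube n k \<Longrightarrow> from_half k b \<in> V k"
    and s: "\<And>k. local_section (cube n) (piece k) (V k) (s k)"
    and sA: "\<And>k a. a \<in> V k \<Longrightarrow> a \<in> cube_boundary n \<Longrightarrow> s k a = sect (piece k) a"
    by (metis IntI)
  define bad where "bad k = {x \<in> half_cube n k. from_half k x \<in> topspace (cube n) - V k}" for k
  define W where "W = topspace (cube n) - (bad True \<union> bad False)"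
  have half_top: "topspace (subtopology (cube n) (half_cube n k)) = half_cube n k" for k
    by (auto simp: half_cube_def)
  have "closedin (cube n) (bad k)" for k
  proof -
    have "closedin (cube n) (topspace (cube n) - V k)" using V(1) by blast
    from closedin_continuous_map_preimage[OF continuous_map_from_half[OF n] this]
    have "closedin (subtopology (cube n) (half_cube n k)) (bad k)"
      unfolding bad_def half_top .
    then show ?thesis using closedin_half_cube[OF n] closedin_trans_full by blast
  qed
  then have W: "openin (cube n) W" unfolding W_def by (intro openin_diff) auto
  have WV: "from_half k x \<in> V k" if "x \<in> W" "x \<in> half_cube n k" for x k
    using that from_half_in[OF n that(2)] by (cases k) (auto simp: W_def bad_def)
  have bW: "b \<in> W" using b V(2) by (auto simp: W_def bad_def)
  have VB: "V k \<subseteq> topspace (cube n)" for k using V(1) openin_subset by blast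
  define \<sigma> where "\<sigma> k x = cls (k, s k (from_half k x))" for k x
  define t where "t x = (if x 0 \<le> 1 / 2 then \<sigma> False x else \<sigma> True x)" for x
  have seam: "\<sigma> False x = \<sigma> True x" if x: "x \<in> W" "x 0 = 1 / 2" for x
  proof -
    have xC: "x \<in> topspace (cube n)" using x by (simp add: W_def)
    then have h: "x \<in> half_cube n k" for k using x by (simp add: half_cube_def)
    have cs: "x \<in> concat_sections n" using x xC by (simp add: concat_sections_def)
    have "\<sigma> k x = sect T x" for k
      using sA[OF WV[OF x(1) h] from_half_boundary[OF n cs h], of k] T_sect_half[OF cs h, of k] by (simp add: \<sigma>_def)
    then show ?thesis by simp
  qed
  have t_half: "t x = \<sigma> k x" if "x \<in> W" "x \<in> half_cube n k" for x k
    using that seam[OF that(1)] by (cases k) (auto simp: t_def half_cube_def)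
  have cover: "\<exists>k. x \<in> half_cube n k" if "x \<in> W" for x
    using that by (cases "x 0 \<le> 1 / 2") (auto simp: half_cube_def W_def intro: exI[of _ False] exI[of _ True])
  have \<sigma>c: "continuous_map (subtopology (cube n) (W \<inter> half_cube n k)) (tot T) (\<sigma> k)" for k
    unfolding \<sigma>_def
  proof (rule continuous_map_compose2[OF cls_cont])
    have "continuous_map (subtopology (cube n) (V k)) (tot (piece k)) (s k)" using s by (simp add: local_section_def)
    then show "continuous_map (subtopology (cube n) (W \<inter> half_cube n k)) (tot (piece k)) (\<lambda>x. s k (from_half k x))"
      by (rule continuous_map_subtopology_compose[OF _ continuous_map_from_subtopology_mono[OF continuous_map_from_half[OF n]]])
         (use WV in auto)
  qed
  have "continuous_map (subtopology (cube n) W) (tot T) t"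
    unfolding t_def
  proof (rule continuous_map_cases_le)
    show "continuous_map (subtopology (cube n) W) euclideanreal (\<lambda>x. x 0)"
      by (rule continuous_map_from_subtopology[OF continuous_map_cube_coord[OF continuous_map_self]]) (use n in simp)
    have eq: "W \<inter> {x \<in> topspace (subtopology (cube n) W). x 0 \<le> 1 / 2} = W \<inter> half_cube n False"
      "W \<inter> {x \<in> topspace (subtopology (cube n) W). 1 / 2 \<le> x 0} = W \<inter> half_cube n True"
      by (auto simp: half_cube_def)
    show "continuous_map (subtopology (subtopology (cube n) W) {x \<in> topspace (subtopology (cube n) W). x 0 \<le> 1 / 2}) (tot T) (\<sigma> False)"
      "continuous_map (subtopology (subtopology (cube n) W) {x \<in> topspace (subtopology (cube n) W). 1 / 2 \<le> x 0}) (tot T) (\<sigma> True)"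
      unfolding subtopology_subtopology eq by (rule \<sigma>c)+
  qed (use seam in auto)
  moreover have "proj T (t x) = x" if x: "x \<in> W" for x
  proof -
    obtain k where k: "x \<in> half_cube n k" using cover[OF x] by blast
    have "proj (piece k) (s k (from_half k x)) = from_half k x"
      using local_section_in(2)[OF s VB WV[OF x k]] .
    then show ?thesis unfolding t_half[OF x k] \<sigma>_def T_proj by simp
  qed
  moreover have "t a = sect T a" if a: "a \<in> W \<inter> concat_sections n" for a
  proof -
    obtain k where k: "a \<in> half_cube n k" using cover a by blast
    have aW: "a \<in> W" and ac: "a \<in> concat_sections n" using a by auto
    show ?thesis
      unfolding t_half[OF aW k] \<sigma>_def T_sect_half[OF ac k] using sA[OF WV[OF aW k] from_half_boundary[OF n ac k]] by simp
  qed
  ultimately show ?thesis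
    using W bW unfolding local_section_def by blast
qed

lemma pointed_concat: "pointed_bundle G a0 (cube n) (concat_sections n) T"
proof (rule pointed_bundleI[OF _ _ _ T_local_section])
  show "concat_sections n \<subseteq> topspace (cube n)" by (auto simp: concat_sections_def)
  show "anchor T (sect T a) = a0" if a: "a \<in> concat_sections n" for a
  proof -
    have "a \<in> half_cube n (a 0 > 1 / 2)" using a by (auto simp: half_cube_def concat_sections_def)
    then show ?thesis
      unfolding T_sect T_anchor using pointed_bundleD(4)[OF piece] from_half_boundary[OF n a] by blast
  qed
  show "principal_bundle G (cube n) T"
  proof (rule principal_bundleI[where d = "diff_arrow G T"])
    show "continuous_map (tot T) (cube n) (proj T)"
    proof (rule pasting_parts[OF continuous_map_self])
      fix k
      show "continuous_map (subtopology (tot T) {x \<in> topspace (tot T). x \<in> half_part k}) (cube n) (proj T)"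
        by (rule continuous_map_eq[OF continuous_map_compose2[OF continuous_map_to_half[OF n] continuous_map_compose2[OF principal_bundleD(1)[OF pb] back_cont_on[OF continuous_map_self]]]])
           (auto simp: T_on_part[of _ k])
    qed
    show "\<exists>V s. openin (cube n) V \<and> b \<in> V \<and> local_section (cube n) T V s" if "b \<in> topspace (cube n)" for b
      using T_local_section[OF that] by blast
    let ?X = "subtopology (prod_topology (tot T) (tot T)) {z. proj T (fst z) = proj T (snd z)}"
    have "continuous_map ?X (Arr G) (\<lambda>z. diff_arrow G T (fst z) (snd z))"
    proof (rule pasting_parts[where u = fst])
      fix k
      let ?S = "{x \<in> topspace ?X. fst x \<in> half_part k}"
      have S: "?S = {x \<in> topspace ?X. snd x \<in> half_part k}" using part_iff by auto
      have c2: "continuous_map (subtopology ?X ?S) (tot (piece k)) (\<lambda>z. back k (snd z))"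
        unfolding S by (rule back_cont_on) simp
      have e: "proj (piece k) (back k (fst z)) = proj (piece k) (back k (snd z))" if "z \<in> ?S" for z
        using that S T_on_part(1) to_half_inj by (metis (mono_tags, lifting) Int_iff mem_Collect_eq topspace_subtopology)
      have "continuous_map (subtopology ?X ?S) (Arr G) (\<lambda>z. diff_arrow G (piece k) (back k (fst z)) (back k (snd z)))"
        by (rule continuous_map_diff_arrow[OF pb back_cont_on c2]) (use e in auto)
      then show "continuous_map (subtopology ?X ?S) (Arr G) (\<lambda>z. diff_arrow G T (fst z) (snd z))"
      proof (rule continuous_map_eq)
        fix z assume z: "z \<in> topspace (subtopology ?X ?S)"
        then have "fst z \<in> half_part k" "snd z \<in> half_part k" "proj T (fst z) = proj T (snd z)" using S by auto
        then show "diff_arrow G (piece k) (back k (fst z)) (back k (snd z)) = diff_arrow G T (fst z) (snd z)"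
          using T_diff by simp
      qed
    qed simp
    then show "continuous_map (subtopology (prod_topology (tot T) (tot T)) {(p, p'). proj T p = proj T p'}) (Arr G)
        (\<lambda>(p, p'). diff_arrow G T p p')"
      by (simp add: case_prod_unfold)
    show "diff_arrow G T t (act T t g) = g" if t: "t \<in> topspace (tot T)" "g \<in> topspace (Arr G)" "anchor T t = tgt G g" for t g
    proof -
      obtain k where k: "t \<in> half_part k" using part_cover[OF t(1)] by blast
      note a = part_act[OF k t(2,3)]
      show ?thesis
        unfolding T_diff[OF k a(1) T_act_closed(2)[OF t, symmetric]] a(2)
        using diff_arrow_act[OF pb cls_back(2)[OF k] t(2)] T_on_part(2)[OF k] t(3) by simp
    qed
  qed (use T_right_action T_act_closed T_diff_all in auto)
qed

lemma bundle_map_cls: "bundle_map G (cube_boundary n) (piece k) T (\<lambda>p. cls (k, p)) (to_half k)"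
  unfolding bundle_map_def using cls_cont T_proj T_anchor T_act cls_boundary by auto

end

section \<open>Groups of classes\<close>

lemma group_of_classes:
  fixes N :: "'n set" and s :: "'n \<Rightarrow> 'n \<Rightarrow> bool" and m :: "'n \<Rightarrow> 'n \<Rightarrow> 'n"
  assumes refl: "\<And>f. f \<in> N \<Longrightarrow> s f f" and sym: "\<And>f g. s f g \<Longrightarrow> s g f"
    and trans: "\<And>f g h. s f g \<Longrightarrow> s g h \<Longrightarrow> s f h"
    and closed: "\<And>f g. f \<in> N \<Longrightarrow> g \<in> N \<Longrightarrow> m f g \<in> N"
    and cong: "\<And>f f' g g'. \<lbrakk>f \<in> N; f' \<in> N; g \<in> N; g' \<in> N; s f f'; s g g'\<rbrakk> \<Longrightarrow> s (m f g) (m f' g')"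
    and e: "e \<in> N"
    and assoc: "\<And>f g h. \<lbrakk>f \<in> N; g \<in> N; h \<in> N\<rbrakk> \<Longrightarrow> s (m (m f g) h) (m f (m g h))"
    and unit: "\<And>f. f \<in> N \<Longrightarrow> s (m e f) f"
    and inv: "\<And>f. f \<in> N \<Longrightarrow> \<exists>g\<in>N. s (m g f) e"
  shows "group \<lparr>carrier = N // {(f, g). f \<in> N \<and> g \<in> N \<and> s f g},
      mult = (\<lambda>c d. {h \<in> N. \<exists>f\<in>c. \<exists>g\<in>d. s (m f g) h}), one = {h \<in> N. s e h}\<rparr>"
    (is "group ?G")
proof -
  define cl where "cl f = {g \<in> N. s f g}" for f
  have carr: "carrier ?G = cl ` N"
    by (auto simp: quotient_def cl_def)
  have cl_eq: "cl f = cl g" if "s f g" for f g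
    using that sym trans unfolding cl_def by blast
  have mult: "cl f \<otimes>\<^bsub>?G\<^esub> cl g = cl (m f g)" if fg: "f \<in> N" "g \<in> N" for f g
  proof -
    have "s (m f g) h" if "f' \<in> N" "s f f'" "g' \<in> N" "s g g'" "s (m f' g') h" for f' g' h
      using cong[OF fg(1) that(1) fg(2) that(3) that(2,4)] that(5) trans by blast
    moreover have "s f f" "s g g" using refl fg by auto
    ultimately show ?thesis unfolding cl_def using fg by auto
  qed
  have one: "\<one>\<^bsub>?G\<^esub> = cl e" by (simp add: cl_def)
  show ?thesis
  proof (rule groupI)
    fix x y z assume "x \<in> carrier ?G" "y \<in> carrier ?G" "z \<in> carrier ?G"
    then obtain f g h where fgh: "f \<in> N" "g \<in> N" "h \<in> N" "x = cl f" "y = cl g" "z = cl h"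
      unfolding carr by blast
    show "x \<otimes>\<^bsub>?G\<^esub> y \<otimes>\<^bsub>?G\<^esub> z = x \<otimes>\<^bsub>?G\<^esub> (y \<otimes>\<^bsub>?G\<^esub> z)"
      unfolding fgh(4-6) by (simp only: mult closed fgh(1-3) cl_eq[OF assoc[OF fgh(1-3)]])
  next
    fix x y assume "x \<in> carrier ?G" "y \<in> carrier ?G"
    then obtain f g where fg: "f \<in> N" "g \<in> N" "x = cl f" "y = cl g" unfolding carr by blast
    show "x \<otimes>\<^bsub>?G\<^esub> y \<in> carrier ?G"
      unfolding fg(3,4) carr mult[OF fg(1,2)] using closed[OF fg(1,2)] by blast
  next
    fix x assume "x \<in> carrier ?G"
    then obtain f where f: "f \<in> N" "x = cl f" unfolding carr by blast
    show "\<one>\<^bsub>?G\<^esub> \<otimes>\<^bsub>?G\<^esub> x = x" unfolding one f(2) mult[OF e f(1)] by (rule cl_eq[OF unit[OF f(1)]])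
    obtain g where g: "g \<in> N" "s (m g f) e" using inv[OF f(1)] by blast
    then show "\<exists>y\<in>carrier ?G. y \<otimes>\<^bsub>?G\<^esub> x = \<one>\<^bsub>?G\<^esub>"
      unfolding one f(2) carr using mult[OF g(1) f(1)] cl_eq[OF g(2)] by (intro bexI[of _ "cl g"]) auto
  qed (unfold carr one, use e in blast)
qed

text \<open>A relation between representatives induces an isomorphism once it is total on both sides and translates
  equivalence, product and unit. The relations \<open>r\<close> and \<open>\<mu>\<close> on \<open>M\<close> inherit their properties from
  those on \<open>N\<close>. The product on \<open>M\<close> has the form of a ternary relation because the concatenation of two bundles has another type.\<close>
lemma iso_of_classes:
  fixes M :: "'m set" and N :: "'n set"
  assumes s: "\<And>n. n \<in> N \<Longrightarrow> s n n" "\<And>n n'. s n n' \<Longrightarrow> s n' n" "\<And>n n' n''. s n n' \<Longrightarrow> s n' n'' \<Longrightarrow> s n n''"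
    and tot: "\<And>m. m \<in> M \<Longrightarrow> \<exists>n\<in>N. rel m n" and surj: "\<And>n. n \<in> N \<Longrightarrow> \<exists>m\<in>M. rel m n"
    and comp: "\<And>m m' n n'. \<lbrakk>m \<in> M; m' \<in> M; n \<in> N; n' \<in> N; rel m n; rel m' n'\<rbrakk> \<Longrightarrow> r m m' \<longleftrightarrow> s n n'"
    and mult: "\<And>m m' m'' n n' n''. \<lbrakk>m \<in> M; m' \<in> M; m'' \<in> M; n \<in> N; n' \<in> N; n'' \<in> N; rel m n; rel m' n'; rel m'' n''\<rbrakk>
        \<Longrightarrow> \<mu> m m' m'' \<longleftrightarrow> \<nu> n n' n''"
    and one: "\<And>m n. \<lbrakk>m \<in> M; n \<in> N; rel m n\<rbrakk> \<Longrightarrow> u m \<longleftrightarrow> v n"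
    and A: "A = \<lparr>carrier = M // {(m, m'). m \<in> M \<and> m' \<in> M \<and> r m m'},
      mult = (\<lambda>c d. {h \<in> M. \<exists>f\<in>c. \<exists>g\<in>d. \<mu> f g h}), one = {h \<in> M. u h}\<rparr>"
    and B: "B = \<lparr>carrier = N // {(n, n'). n \<in> N \<and> n' \<in> N \<and> s n n'},
      mult = (\<lambda>c d. {h \<in> N. \<exists>f\<in>c. \<exists>g\<in>d. \<nu> f g h}), one = {h \<in> N. v h}\<rparr>"
    and grp: "group B"
  shows "group A \<and> A \<cong> B"
proof -
  define ca where "ca m = {m' \<in> M. r m m'}" for m
  define cb where "cb n = {n' \<in> N. s n n'}" for n
  have cA: "carrier A = ca ` M" and cB: "carrier B = cb ` N"
    by (auto simp: A B quotient_def ca_def cb_def)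
  define \<Phi> where "\<Phi> d = {m \<in> M. \<exists>n\<in>d. rel m n}" for d
  have \<Phi>: "\<Phi> (cb n) = ca m" if mn: "m \<in> M" "n \<in> N" "rel m n" for m n
  proof (intro subset_antisym subsetI)
    fix m' assume "m' \<in> \<Phi> (cb n)"
    then show "m' \<in> ca m" using comp mn by (auto simp: \<Phi>_def ca_def cb_def)
  next
    fix m' assume "m' \<in> ca m"
    then have m': "m' \<in> M" "r m m'" by (auto simp: ca_def)
    obtain n' where "n' \<in> N" "rel m' n'" using tot[OF m'(1)] by blast
    then show "m' \<in> \<Phi> (cb n)" using comp[OF mn(1) m'(1) mn(2)] mn m' by (auto simp: \<Phi>_def cb_def)
  qed
  have im: "\<Phi> ` carrier B = carrier A"
  proof (intro subset_antisym subsetI)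
    fix x assume "x \<in> \<Phi> ` carrier B"
    then obtain n where n: "n \<in> N" "x = \<Phi> (cb n)" unfolding cB by blast
    obtain m where "m \<in> M" "rel m n" using surj[OF n(1)] by blast
    then show "x \<in> carrier A" using \<Phi> n unfolding cA by blast
  next
    fix x assume "x \<in> carrier A"
    then obtain m where m: "m \<in> M" "x = ca m" unfolding cA by blast
    obtain n where "n \<in> N" "rel m n" using tot[OF m(1)] by blast
    then show "x \<in> \<Phi> ` carrier B" using \<Phi>[OF m(1)] m(2) unfolding cB by blast
  qed
  have inj: "inj_on \<Phi> (carrier B)"
  proof (rule inj_onI)
    fix x y assume xy: "x \<in> carrier B" "y \<in> carrier B" "\<Phi> x = \<Phi> y"
    then obtain n n' where n: "n \<in> N" "x = cb n" "n' \<in> N" "y = cb n'" unfolding cB by blast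
    obtain m where m: "m \<in> M" "rel m n" using surj[OF n(1)] by blast
    obtain m' where m': "m' \<in> M" "rel m' n'" using surj[OF n(3)] by blast
    have "m' \<in> ca m'" using comp[OF m'(1,1) n(3,3) m'(2,2)] s(1)[OF n(3)] m'(1) by (simp add: ca_def)
    then have "r m m'" using \<Phi>[OF m(1) n(1) m(2)] \<Phi>[OF m'(1) n(3) m'(2)] xy(3) n by (auto simp: ca_def)
    then have "s n n'" using comp[OF m(1) m'(1) n(1,3) m(2) m'(2)] by simp
    then show "x = y" unfolding n(2,4) cb_def using s(2,3) by blast
  qed
  have hom: "\<Phi> (x \<otimes>\<^bsub>B\<^esub> y) = \<Phi> x \<otimes>\<^bsub>A\<^esub> \<Phi> y" if xy: "x \<in> carrier B" "y \<in> carrier B" for x y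
  proof (intro subset_antisym subsetI)
    have sub: "x \<subseteq> N" "y \<subseteq> N" using xy unfolding cB cb_def by auto
    {
      fix h assume "h \<in> \<Phi> (x \<otimes>\<^bsub>B\<^esub> y)"
      then obtain k f g where k: "h \<in> M" "k \<in> N" "rel h k" "f \<in> x" "g \<in> y" "\<nu> f g k"
        unfolding \<Phi>_def B by auto
      obtain p where p: "p \<in> M" "rel p f" using surj k(4) sub by blast
      obtain q where q: "q \<in> M" "rel q g" using surj k(5) sub by blast
      have "\<mu> p q h" using mult[OF p(1) q(1) k(1) _ _ k(2) p(2) q(2) k(3)] k sub by blast
      then show "h \<in> \<Phi> x \<otimes>\<^bsub>A\<^esub> \<Phi> y" using p q k unfolding \<Phi>_def A by auto
    }
    {
      fix h assume "h \<in> \<Phi> x \<otimes>\<^bsub>A\<^esub> \<Phi> y"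
      then obtain p q f g where k: "h \<in> M" "\<mu> p q h" "p \<in> M" "rel p f" "f \<in> x" "q \<in> M" "rel q g" "g \<in> y"
        unfolding \<Phi>_def A by auto
      obtain k where k': "k \<in> N" "rel h k" using tot[OF k(1)] by blast
      have "\<nu> f g k" using mult[OF k(3,6,1) _ _ k'(1) k(4,7) k'(2)] k sub by blast
      then show "h \<in> \<Phi> (x \<otimes>\<^bsub>B\<^esub> y)" using k k' unfolding \<Phi>_def B by auto
    }
  qed
  have \<Phi>1: "\<Phi> \<one>\<^bsub>B\<^esub> = \<one>\<^bsub>A\<^esub>"
    unfolding A B \<Phi>_def monoid.simps using one tot by blast
  have h: "\<Phi> \<in> hom B A" using hom im by (auto simp: hom_def)
  have "group (A\<lparr>carrier := \<Phi> ` carrier B, one := \<Phi> \<one>\<^bsub>B\<^esub>\<rparr>)"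
    by (rule group.hom_imp_img_group[OF grp h])
  then have "group A" using im \<Phi>1 by (simp add: A)
  moreover have "\<Phi> \<in> iso B A" using h im inj by (simp add: iso_def bij_betw_def)
  then have "B \<cong> A" unfolding is_iso_def by blast
  then have "A \<cong> B" by (rule group.iso_sym[OF grp])
  ultimately show ?thesis by blast
qed

section \<open>Homotopy groups of spaces\<close>

lemma concat_map_continuous:
  assumes n: "n \<ge> 1"
    and F: "continuous_map (prod_topology Z (cube n)) X F" and K: "continuous_map (prod_topology Z (cube n)) X K"
    and seam: "\<And>z x. z \<in> topspace Z \<Longrightarrow> x \<in> topspace (cube n) \<Longrightarrow> x 0 = 1 \<Longrightarrow> F (z, x) = K (z, x(0 := 0))"
  shows "continuous_map (prod_topology Z (cube n)) X
     (\<lambda>y. concat_map (\<lambda>x. F (fst y, x)) (\<lambda>x. K (fst y, x)) (snd y))"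
proof -
  let ?X = "prod_topology Z (cube n)"
  have c: "continuous_map ?X euclideanreal (\<lambda>y. snd y 0)"
    by (rule continuous_map_cube_coord[of _ n]) (use n in \<open>auto intro: continuous_map_snd\<close>)
  have half: "continuous_map (subtopology ?X S) X (\<lambda>y. H (fst y, from_half k (snd y)))"
    if H: "continuous_map ?X X H" and S: "\<And>y. y \<in> S \<Longrightarrow> snd y \<in> half_cube n k" for H k S
  proof (rule continuous_map_compose2[OF H])
    have "continuous_map (subtopology ?X S) (cube n) (\<lambda>y. from_half k (snd y))"
      by (rule continuous_map_subtopology_compose[OF continuous_map_from_half[OF n]]) (use S in auto)
    then show "continuous_map (subtopology ?X S) ?X (\<lambda>y. (fst y, from_half k (snd y)))"
      by (intro continuous_map_pairedI) simp
  qed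
  have "continuous_map ?X X (\<lambda>y. if snd y 0 \<le> 1 / 2 then F (fst y, from_half False (snd y)) else K (fst y, from_half True (snd y)))"
  proof (rule continuous_map_cases_le[OF c])
    fix y assume y: "y \<in> topspace ?X" "snd y 0 = 1 / 2"
    then have h: "snd y \<in> half_cube n False" by (auto simp: half_cube_def)
    have "from_half False (snd y) 0 = 1" "(from_half False (snd y))(0 := 0) = from_half True (snd y)"
      using y(2) by (auto simp: from_half_def)
    then show "F (fst y, from_half False (snd y)) = K (fst y, from_half True (snd y))"
      using seam[of "fst y" "from_half False (snd y)"] from_half_in[OF n h] y(1) by auto
  qed (auto intro!: half F K simp: half_cube_def)
  then show ?thesis by (simp add: concat_map_def)
qed

lemma concat_map_boundary:
  assumes n: "n \<ge> 1" and a: "a \<in> cube_boundary n"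
    and f: "\<And>a. a \<in> cube_boundary n \<Longrightarrow> f a \<in> D" and g: "\<And>a. a \<in> cube_boundary n \<Longrightarrow> g a \<in> D"
  shows "concat_map f g a \<in> D"
proof -
  have aC: "a \<in> topspace (cube n)" and cs: "a \<in> concat_sections n"
    using a cube_boundary_sub by (auto simp: concat_sections_def)
  show ?thesis
    using f[OF from_half_boundary[OF n cs, of False]] g[OF from_half_boundary[OF n cs, of True]] aC
    by (auto simp: concat_map_def half_cube_def)
qed

lemma cube_homotopicI:
  assumes "continuous_map (prod_topology (top_of_set {0..1::real}) (cube n)) X h"
    "\<And>x. x \<in> topspace (cube n) \<Longrightarrow> h (0, x) = f x" "\<And>x. x \<in> topspace (cube n) \<Longrightarrow> h (1, x) = g x"
    "\<And>t a. 0 \<le> t \<Longrightarrow> t \<le> 1 \<Longrightarrow> a \<in> cube_boundary n \<Longrightarrow> h (t, a) = x0"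
  shows "cube_homotopic n X x0 f g"
  unfolding cube_homotopic_def
proof (subst homotopic_with)
  show "(\<forall>a\<in>cube_boundary n. h a = x0) = (\<forall>a\<in>cube_boundary n. k a = x0)"
    if "\<And>x. x \<in> topspace (cube n) \<Longrightarrow> h x = k x" for h k
    using that cube_boundary_sub by (metis subsetD)
qed (rule exI[of _ h], use assms in auto)

lemma cube_homotopicE:
  assumes "cube_homotopic n X x0 f g"
  obtains h where "continuous_map (prod_topology (top_of_set {0..1::real}) (cube n)) X h"
    "\<And>x. h (0, x) = f x" "\<And>x. h (1, x) = g x" "\<And>t a. 0 \<le> t \<Longrightarrow> t \<le> 1 \<Longrightarrow> a \<in> cube_boundary n \<Longrightarrow> h (t, a) = x0"
proof -
  obtain h where h: "continuous_map (prod_topology (top_of_set {0..1::real}) (cube n)) X h"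
    "\<forall>x. h (0, x) = f x" "\<forall>x. h (1, x) = g x" "\<forall>t\<in>{0..1}. \<forall>a\<in>cube_boundary n. h (t, a) = x0"
    using assms unfolding cube_homotopic_def homotopic_with_def by blast
  show thesis by (rule that[of h]) (use h in auto)
qed

lemma cube_homotopic_eqI:
  assumes f: "f \<in> cube_maps n X x0" and eq: "\<And>x. x \<in> topspace (cube n) \<Longrightarrow> f x = g x"
  shows "cube_homotopic n X x0 f g"
  using assms continuous_map_compose2[OF _ continuous_map_snd, of "cube n" X f "top_of_set {0..1}"]
  by (intro cube_homotopicI[of _ _ "\<lambda>z. f (snd z)"]) (auto simp: cube_maps_def)

lemma cube_homotopic_refl: "f \<in> cube_maps n X x0 \<Longrightarrow> cube_homotopic n X x0 f f"
  by (rule cube_homotopic_eqI) auto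

lemma cube_homotopic_sym: "cube_homotopic n X x0 f g \<Longrightarrow> cube_homotopic n X x0 g f"
  unfolding cube_homotopic_def by (simp add: homotopic_with_sym)

lemma cube_homotopic_trans:
  "cube_homotopic n X x0 f g \<Longrightarrow> cube_homotopic n X x0 g h \<Longrightarrow> cube_homotopic n X x0 f h"
  unfolding cube_homotopic_def by (rule homotopic_with_trans)

lemma cube_maps_concat:
  assumes n: "n \<ge> 1" and f: "f \<in> cube_maps n X x0" and g: "g \<in> cube_maps n X x0"
  shows "concat_map f g \<in> cube_maps n X x0"
proof -
  have face: "x \<in> cube_boundary n" "x(0 := 0) \<in> cube_boundary n" if "x \<in> topspace (cube n)" "x 0 = 1" for x
    using that n cubeD[OF that(1)] by (auto simp: cube_boundary_def intro!: exI[of _ 0] cubeI)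
  \<comment> \<open>A one-point space of parameters.\<close>
  let ?Z = "top_of_set {0::real}"
  have "continuous_map (prod_topology ?Z (cube n)) X (\<lambda>y. concat_map (\<lambda>x. f (snd (fst y, x))) (\<lambda>x. g (snd (fst y, x))) (snd y))"
    by (rule concat_map_continuous[OF n, of ?Z X "\<lambda>y. f (snd y)" "\<lambda>y. g (snd y)"])
       (use f g face continuous_map_compose2[OF _ continuous_map_snd] in \<open>auto simp: cube_maps_def\<close>)
  then have 1: "continuous_map (prod_topology ?Z (cube n)) X (\<lambda>y. concat_map f g (snd y))" by simp
  have "continuous_map (cube n) (prod_topology ?Z (cube n)) (\<lambda>x. (0, x))"
    by (intro continuous_map_pairedI) auto
  from continuous_map_compose2[OF 1 this]
  have "continuous_map (cube n) X (concat_map f g)" by simp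
  moreover have "concat_map f g a = x0" if "a \<in> cube_boundary n" for a
    using concat_map_boundary[OF n that, of f "{x0}" g] f g by (simp add: cube_maps_def)
  ultimately show ?thesis by (simp add: cube_maps_def)
qed

lemma cube_homotopic_concat:
  assumes n: "n \<ge> 1" and f: "cube_homotopic n X x0 f f'" and g: "cube_homotopic n X x0 g g'"
  shows "cube_homotopic n X x0 (concat_map f g) (concat_map f' g')"
proof -
  obtain h where h: "continuous_map (prod_topology (top_of_set {0..1::real}) (cube n)) X h"
    "\<And>x. h (0, x) = f x" "\<And>x. h (1, x) = f' x" "\<And>t a. 0 \<le> t \<Longrightarrow> t \<le> 1 \<Longrightarrow> a \<in> cube_boundary n \<Longrightarrow> h (t, a) = x0"
    using cube_homotopicE[OF f] by blast
  obtain k where k: "continuous_map (prod_topology (top_of_set {0..1::real}) (cube n)) X k"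
    "\<And>x. k (0, x) = g x" "\<And>x. k (1, x) = g' x" "\<And>t a. 0 \<le> t \<Longrightarrow> t \<le> 1 \<Longrightarrow> a \<in> cube_boundary n \<Longrightarrow> k (t, a) = x0"
    using cube_homotopicE[OF g] by blast
  have face: "x \<in> cube_boundary n" "x(0 := 0) \<in> cube_boundary n" if "x \<in> topspace (cube n)" "x 0 = 1" for x
    using that n cubeD[OF that(1)] by (auto simp: cube_boundary_def intro!: exI[of _ 0] cubeI)
  let ?H = "\<lambda>y :: real \<times> (nat \<Rightarrow> real). concat_map (\<lambda>x. h (fst y, x)) (\<lambda>x. k (fst y, x)) (snd y)"
  show ?thesis
  proof (rule cube_homotopicI[of _ _ ?H])
    show "continuous_map (prod_topology (top_of_set {0..1::real}) (cube n)) X ?H"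
      by (rule concat_map_continuous[OF n h(1) k(1)]) (use h(4) k(4) face in auto)
    show "?H (t, a) = x0" if "0 \<le> t" "t \<le> 1" "a \<in> cube_boundary n" for t a
      using concat_map_boundary[OF n that(3), of "\<lambda>x. h (t, x)" "{x0}" "\<lambda>x. k (t, x)"] h(4) k(4) that by simp
  qed (simp_all add: h k)
qed

text \<open>The straight line between the two parameter changes keeps the ends of the first coordinate at \<open>0\<close> or \<open>1\<close>.\<close>
lemma reparametrize:
  assumes n: "n \<ge> 1" and f: "f \<in> cube_maps n X x0"
    and \<rho>: "continuous_on UNIV \<rho>" "\<And>s. s \<in> {0..1} \<Longrightarrow> \<rho> s \<in> {0..1::real}"
    and \<rho>': "continuous_on UNIV \<rho>'" "\<And>s. s \<in> {0..1} \<Longrightarrow> \<rho>' s \<in> {0..1::real}"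
    and ends: "\<rho> 0 = \<rho>' 0" "\<rho> 1 = \<rho>' 1" "\<rho> 0 = 0 \<or> \<rho> 0 = 1" "\<rho> 1 = 0 \<or> \<rho> 1 = 1"
  shows "cube_homotopic n X x0 (\<lambda>x. f (x(0 := \<rho> (x 0)))) (\<lambda>x. f (x(0 := \<rho>' (x 0))))"
proof -
  let ?IX = "prod_topology (top_of_set {0..1::real}) (cube n)"
  define w where "w t s = (1 - t) * \<rho> s + t * \<rho>' s" for t s
  define k where "k y = (snd y)(0 := w (fst y) (snd y 0))" for y :: "real \<times> (nat \<Rightarrow> real)"
  have w01: "w t s \<in> {0..1}" if "0 \<le> t" "t \<le> 1" "s \<in> {0..1}" for t s
  proof -
    have r: "0 \<le> \<rho> s" "\<rho> s \<le> 1" "0 \<le> \<rho>' s" "\<rho>' s \<le> 1"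
      using \<rho>(2)[OF that(3)] \<rho>'(2)[OF that(3)] by auto
    have "0 \<le> (1 - t) * \<rho> s" "0 \<le> t * \<rho>' s" using r that by auto
    moreover have "(1 - t) * \<rho> s \<le> (1 - t) * 1" "t * \<rho>' s \<le> t * 1"
      using r that by (intro mult_left_mono; simp)+
    ultimately show ?thesis unfolding w_def by auto
  qed
  have kin: "k y \<in> topspace (cube n)" if "y \<in> topspace ?IX" for y
  proof -
    have y: "0 \<le> fst y" "fst y \<le> 1" "snd y \<in> topspace (cube n)" using that by auto
    then show ?thesis
      using w01[OF y(1,2), of "snd y 0"] cubeD[OF y(3)] n by (auto simp: k_def intro!: cubeI)
  qed
  have c: "continuous_map ?IX euclideanreal (\<lambda>y. snd y i)" if "i < n" for i
    by (rule continuous_map_cube_coord[of _ n]) (use that in \<open>auto intro: continuous_map_snd\<close>)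
  have t: "continuous_map ?IX euclideanreal fst"
    using continuous_map_fst[of "top_of_set {0..1::real}" "cube n"] continuous_map_into_fulltopology by blast
  have "continuous_map ?IX euclideanreal (\<lambda>y. w (fst y) (snd y 0))"
  proof -
    have r: "continuous_map euclideanreal euclideanreal \<rho>" "continuous_map euclideanreal euclideanreal \<rho>'"
      using \<rho>(1) \<rho>'(1) by simp_all
    have "continuous_map ?IX euclideanreal (\<lambda>y. snd y 0)" using c n by simp
    from continuous_map_compose2[OF r(1) this] continuous_map_compose2[OF r(2) this]
    show ?thesis
      unfolding w_def by (intro continuous_map_add continuous_map_real_mult continuous_map_diff t) simp_all
  qed
  then have "continuous_map ?IX (cube n) k"
    by (intro continuous_map_into_cube kin) (use c in \<open>auto simp: k_def fun_upd_def\<close>)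
  moreover have "continuous_map (cube n) X f" using f by (simp add: cube_maps_def)
  ultimately have fk: "continuous_map ?IX X (\<lambda>y. f (k y))" using continuous_map_compose2 by blast
  have bd: "k (t, a) \<in> cube_boundary n" if ta: "0 \<le> t" "t \<le> 1" "a \<in> cube_boundary n" for t a
  proof -
    have kc: "k (t, a) \<in> topspace (cube n)" using kin[of "(t, a)"] ta cube_boundary_sub by auto
    obtain i where i: "i < n" "a i = 0 \<or> a i = 1" using ta(3) by (auto simp: cube_boundary_def)
    have "k (t, a) i = 0 \<or> k (t, a) i = 1"
      using i(2) ends by (cases "i = 0") (auto simp: k_def w_def algebra_simps)
    then show ?thesis using kc i(1) by (auto simp: cube_boundary_def)
  qed
  show ?thesis
    by (rule cube_homotopicI[OF fk]) (use bd f in \<open>auto simp: k_def w_def cube_maps_def\<close>)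
qed

lemma reparametrize_id:
  assumes n: "n \<ge> 1" and f: "f \<in> cube_maps n X x0"
    and \<rho>: "continuous_on UNIV \<rho>" "\<And>s. s \<in> {0..1} \<Longrightarrow> \<rho> s \<in> {0..1::real}" "\<rho> 0 = 0" "\<rho> 1 = 1"
    and g: "g \<in> cube_maps n X x0" "\<And>x. x \<in> topspace (cube n) \<Longrightarrow> g x = f (x(0 := \<rho> (x 0)))"
  shows "cube_homotopic n X x0 g f"
proof -
  have "cube_homotopic n X x0 g (\<lambda>x. f (x(0 := \<rho> (x 0))))" by (rule cube_homotopic_eqI[OF g])
  moreover have "cube_homotopic n X x0 (\<lambda>x. f (x(0 := \<rho> (x 0)))) (\<lambda>x. f (x(0 := x 0)))"
    by (rule reparametrize[OF n f \<rho>(1,2)]) (use \<rho> in auto)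
  ultimately show ?thesis using cube_homotopic_trans by fastforce
qed

text \<open>Each group law compares two reparametrisations, in the first coordinate, of one map.\<close>
lemma group_homotopy_group:
  assumes n: "n \<ge> 1" and x0: "x0 \<in> topspace X"
  shows "group (homotopy_group n X x0)"
  unfolding homotopy_group_def
proof (rule group_of_classes[where m = concat_map])
  show const: "(\<lambda>_. x0) \<in> cube_maps n X x0" using x0 by (simp add: cube_maps_def)
  have x0r: "x 0 \<in> {0..1}" if "x \<in> topspace (cube n)" for x
    using cubeD(1,2)[OF that, of 0] n by auto
  have upd: "x(0 := u) \<in> cube_boundary n" if "x \<in> topspace (cube n)" "u = 0 \<or> u = 1" for x u
    using cubeD[OF that(1)] that(2) n by (auto simp: cube_boundary_def intro!: cubeI exI[of _ 0])
  fix f assume f: "f \<in> cube_maps n X x0"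
  have fb: "f a = x0" if "a \<in> cube_boundary n" for a using f that by (simp add: cube_maps_def)
  show "cube_homotopic n X x0 (concat_map (\<lambda>_. x0) f) f"
  proof (rule reparametrize_id[OF n f, where \<rho> = "\<lambda>s. max 0 (2 * s - 1)"])
    show "concat_map (\<lambda>_. x0) f x = f (x(0 := max 0 (2 * x 0 - 1)))" if x: "x \<in> topspace (cube n)" for x
    proof (cases "x 0 \<le> 1 / 2")
      case True
      then have "max 0 (2 * x 0 - 1) = 0" by simp
      then show ?thesis using True fb[OF upd[OF x, of 0]] by (simp add: concat_map_def)
    next
      case False
      then have "max 0 (2 * x 0 - 1) = 2 * x 0 - 1" by simp
      then show ?thesis using False by (simp add: concat_map_def from_half_def)
    qed
  qed (use cube_maps_concat[OF n const f] in \<open>auto intro!: continuous_intros\<close>)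
  show "\<exists>g\<in>cube_maps n X x0. cube_homotopic n X x0 (concat_map g f) (\<lambda>_. x0)"
  proof
    let ?g = "\<lambda>x. f (x(0 := 1 - x 0))"
    have r: "x(0 := 1 - x 0) \<in> topspace (cube n)" if "x \<in> topspace (cube n)" for x
      using cubeD[OF that] n by (intro cubeI) auto
    have c: "continuous_map (cube n) (cube n) (\<lambda>x. x(0 := 1 - x 0))"
    proof (rule continuous_map_into_cube[OF r])
      have ci: "continuous_map (cube n) euclideanreal (\<lambda>x. x i)" if "i < n" for i
        by (rule continuous_map_cube_coord[OF continuous_map_self that])
      show "continuous_map (cube n) euclideanreal (\<lambda>x. (x(0 := 1 - x 0)) i)" if "i < n" for i
        using n that by (cases "i = 0") (auto intro!: continuous_map_diff ci)
    qed
    have "continuous_map (cube n) X ?g" using f continuous_map_compose2[OF _ c, of X f] by (simp add: cube_maps_def)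
    moreover have "x(0 := 1 - x 0) \<in> cube_boundary n" if b: "x \<in> cube_boundary n" for x
    proof -
      have xC: "x \<in> topspace (cube n)" using b cube_boundary_sub by blast
      obtain i where "i < n" "x i = 0 \<or> x i = 1" using b by (auto simp: cube_boundary_def)
      then show ?thesis using r[OF xC] unfolding cube_boundary_def by (cases "i = 0") (auto intro!: exI[of _ i])
    qed
    ultimately show g: "?g \<in> cube_maps n X x0" using fb by (simp add: cube_maps_def)
    have "cube_homotopic n X x0 (concat_map ?g f) (\<lambda>x. f (x(0 := \<bar>1 - 2 * x 0\<bar>)))"
      by (rule cube_homotopic_eqI[OF cube_maps_concat[OF n g f]]) (auto simp: concat_map_def from_half_def)
    moreover have "cube_homotopic n X x0 (\<lambda>x. f (x(0 := \<bar>1 - 2 * x 0\<bar>))) (\<lambda>x. f (x(0 := (\<lambda>_. 1) (x 0))))"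
      by (rule reparametrize[OF n f]) (auto intro!: continuous_intros)
    moreover have "cube_homotopic n X x0 (\<lambda>_. x0) (\<lambda>x. f (x(0 := (\<lambda>_. 1) (x 0))))"
      by (rule cube_homotopic_eqI[OF const]) (use fb upd in auto)
    ultimately show "cube_homotopic n X x0 (concat_map ?g f) (\<lambda>_. x0)"
      by (meson cube_homotopic_sym cube_homotopic_trans)
  qed
  fix g h assume g: "g \<in> cube_maps n X x0" and h: "h \<in> cube_maps n X x0"
  show "cube_homotopic n X x0 (concat_map (concat_map f g) h) (concat_map f (concat_map g h))"
    \<comment> \<open>The concave function with slopes \<open>2\<close>, \<open>1\<close> and \<open>1 / 2\<close> on \<open>[0, 1/4]\<close>, \<open>[1/4, 1/2]\<close> and \<open>[1/2, 1]\<close>.\<close>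
  proof (rule reparametrize_id[OF n, where \<rho> = "\<lambda>s. min (2 * s) (min (s + 1 / 4) ((s + 1) / 2))"])
    show "concat_map (concat_map f g) h x = concat_map f (concat_map g h) (x(0 := min (2 * x 0) (min (x 0 + 1 / 4) ((x 0 + 1) / 2))))"
      if "x \<in> topspace (cube n)" for x
    proof -
      consider "x 0 \<le> 1/4" | "1/4 < x 0" "x 0 \<le> 1/2" | "1/2 < x 0" by linarith
      then show ?thesis
      proof cases
        case 1
        then have "min (2 * x 0) (min (x 0 + 1 / 4) ((x 0 + 1) / 2)) = 2 * x 0" by (auto simp: min_def)
        then show ?thesis using 1 by (simp add: concat_map_def from_half_def)
      next
        case 2
        then have "min (2 * x 0) (min (x 0 + 1 / 4) ((x 0 + 1) / 2)) = x 0 + 1 / 4" by (auto simp: min_def)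
        then show ?thesis using 2 by (simp add: concat_map_def from_half_def algebra_simps)
      next
        case 3
        then have "min (2 * x 0) (min (x 0 + 1 / 4) ((x 0 + 1) / 2)) = (x 0 + 1) / 2" by (auto simp: min_def field_simps)
        then show ?thesis using 3 by (simp add: concat_map_def from_half_def field_simps)
      qed
    qed
    show "concat_map f (concat_map g h) \<in> cube_maps n X x0" "concat_map (concat_map f g) h \<in> cube_maps n X x0"
      by (intro cube_maps_concat[OF n] f g h)+
    show "continuous_on UNIV (\<lambda>s::real. min (2 * s) (min (s + 1 / 4) ((s + 1) / 2)))"
      by (intro continuous_intros) auto
  qed (auto simp: min_def)
next
  show "cube_homotopic n X x0 f f" if "f \<in> cube_maps n X x0" for f by (rule cube_homotopic_refl[OF that])
  show "cube_homotopic n X x0 g f" if "cube_homotopic n X x0 f g" for f g by (rule cube_homotopic_sym[OF that])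
  show "cube_homotopic n X x0 f h" if "cube_homotopic n X x0 f g" "cube_homotopic n X x0 g h" for f g h
    by (rule cube_homotopic_trans[OF that])
  show "concat_map f g \<in> cube_maps n X x0" if "f \<in> cube_maps n X x0" "g \<in> cube_maps n X x0" for f g
    by (rule cube_maps_concat[OF n that])
  show "cube_homotopic n X x0 (concat_map f g) (concat_map f' g')"
    if "cube_homotopic n X x0 f f'" "cube_homotopic n X x0 g g'" for f f' g g'
    by (rule cube_homotopic_concat[OF n that])
qed

section \<open>Contracting the boundary values\<close>

text \<open>The distance to the boundary in the maximum metric; the initial value \<open>1\<close> bounds all coordinates of the cube from above.\<close>
primrec depth :: "nat \<Rightarrow> (nat \<Rightarrow> real) \<Rightarrow> real" where
  "depth 0 x = 1"
| "depth (Suc n) x = min (depth n x) (min (x n) (1 - x n))"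

lemma depth_le: "i < n \<Longrightarrow> depth n x \<le> x i" "i < n \<Longrightarrow> depth n x \<le> 1 - x i"
  by (induction n) (auto simp: less_Suc_eq min_le_iff_disj)

lemma depth_attained: "depth n x < 1 \<Longrightarrow> \<exists>i<n. depth n x = x i \<or> depth n x = 1 - x i"
  by (induction n) (auto simp: less_Suc_eq min_def)

lemma depth_nonneg: "x \<in> topspace (cube n) \<Longrightarrow> 0 \<le> depth n x"
proof -
  assume x: "x \<in> topspace (cube n)"
  have "m \<le> n \<Longrightarrow> 0 \<le> depth m x" for m
    by (induction m) (use cubeD(1,2)[OF x] in auto)
  then show ?thesis by simp
qed

lemma continuous_map_depth:
  assumes "continuous_map X (cube n) \<xi>"
  shows "continuous_map X euclideanreal (\<lambda>x. depth n (\<xi> x))"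
proof -
  have "m \<le> n \<Longrightarrow> continuous_map X euclideanreal (\<lambda>x. depth m (\<xi> x))" for m
  proof (induction m)
    case (Suc m)
    have "continuous_map X euclideanreal (\<lambda>x. \<xi> x m)"
      by (rule continuous_map_cube_coord[OF assms]) (use Suc.prems in simp)
    then show ?case using Suc by (auto intro!: continuous_map_real_min continuous_map_diff)
  qed simp
  then show ?thesis by simp
qed

text \<open>Expansion about the centre of the cube by the factor \<open>1 + u\<close>, followed by the retraction that cuts off each
  coordinate. The points of depth at most \<open>u / (2 (1 + u))\<close> go to the boundary.\<close>
definition squeeze :: "nat \<Rightarrow> real \<Rightarrow> (nat \<Rightarrow> real) \<Rightarrow> nat \<Rightarrow> real" where
  "squeeze n u x = (\<lambda>i. if i < n then max 0 (min 1 ((1 + u) * x i - u / 2)) else undefined)"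

lemma squeeze_in: "squeeze n u x \<in> topspace (cube n)"
  by (rule cubeI) (auto simp: squeeze_def)

lemma continuous_map_squeeze:
  assumes "continuous_map X (cube n) \<xi>" "continuous_map X euclideanreal \<upsilon>"
  shows "continuous_map X (cube n) (\<lambda>x. squeeze n (\<upsilon> x) (\<xi> x))"
proof (rule continuous_map_into_cube[OF squeeze_in])
  show "continuous_map X euclideanreal (\<lambda>x. squeeze n (\<upsilon> x) (\<xi> x) i)" if "i < n" for i
    using that unfolding squeeze_def
    by (auto intro!: continuous_map_real_max continuous_map_real_min continuous_map_diff continuous_map_real_mult
        continuous_map_add continuous_map_real_divide assms continuous_map_cube_coord[OF assms(1)])
qed

lemma squeeze_0: "x \<in> topspace (cube n) \<Longrightarrow> squeeze n 0 x = x"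
proof (rule ext)
  fix i assume x: "x \<in> topspace (cube n)"
  show "squeeze n 0 x i = x i" using cubeD[OF x, of i] by (auto simp: squeeze_def)
qed

lemma squeeze_face:
  assumes "0 \<le> u" "u \<le> 1" "i < n" "x i = 0 \<or> x i = 1"
  shows "squeeze n u x i = x i"
  using assms by (auto simp: squeeze_def)

lemma squeeze_boundary:
  assumes u: "0 \<le> u" "u \<le> 1" and d: "2 * (1 + u) * depth n x \<le> u"
  shows "squeeze n u x \<in> cube_boundary n"
proof -
  have "depth n x < 1"
  proof (rule ccontr)
    assume "\<not> depth n x < 1"
    then have "2 * (1 + u) * 1 \<le> 2 * (1 + u) * depth n x" using u by (intro mult_left_mono) auto
    then show False using d u by (simp add: algebra_simps)
  qed
  then obtain i where i: "i < n" "depth n x = x i \<or> depth n x = 1 - x i" using depth_attained by blast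
  then have "squeeze n u x i = 0 \<or> squeeze n u x i = 1"
  proof (elim disjE)
    assume "depth n x = x i"
    then have "(1 + u) * x i - u / 2 \<le> 0" using d by (simp add: algebra_simps)
    then show ?thesis using i(1) by (simp add: squeeze_def)
  next
    assume "depth n x = 1 - x i"
    then have "(1 + u) * x i = (1 + u) * (1 - depth n x)" by simp
    also have "\<dots> = 1 + u - (1 + u) * depth n x" by (simp add: algebra_simps)
    finally have "(1 + u) * x i = 1 + u - (1 + u) * depth n x" .
    moreover have "(1 + u) * depth n x \<le> u / 2" using d by (simp add: algebra_simps)
    ultimately have "1 \<le> (1 + u) * x i - u / 2" by linarith
    then show ?thesis using i(1) by (simp add: squeeze_def)
  qed
  then show ?thesis using squeeze_in i(1) by (auto simp: cube_boundary_def)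
qed

lemma depth_boundary:
  assumes "x \<in> cube_boundary n" shows "depth n x = 0"
proof -
  have xC: "x \<in> topspace (cube n)" using assms cube_boundary_sub by blast
  obtain i where "i < n" "x i = 0 \<or> x i = 1" using assms by (auto simp: cube_boundary_def)
  then show ?thesis using depth_le[of i n x] depth_nonneg[OF xC] by auto
qed

text \<open>The properties of the pair \<open>(B\<G>, \<Delta>)\<close> that permit boundary values in \<open>\<Delta>\<close> to be replaced by the base point.\<close>
locale pair_contraction =
  fixes Y :: "'y topology" and D :: "'y set" and b0 :: 'y and c :: "'y \<times> real \<Rightarrow> 'y" and n :: nat
  assumes n: "n \<ge> 1"
    and c_cont: "continuous_map (prod_topology (subtopology Y D) (top_of_set {0..1::real})) Y c"
    and DY: "D \<subseteq> topspace Y" and b0: "b0 \<in> D"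
    and c_D: "\<And>d u. d \<in> D \<Longrightarrow> 0 \<le> u \<Longrightarrow> u \<le> 1 \<Longrightarrow> c (d, u) \<in> D"
    and c_0: "\<And>d. d \<in> D \<Longrightarrow> c (d, 0) = d" and c_1: "\<And>d. d \<in> D \<Longrightarrow> c (d, 1) = b0"
    and c_b0: "\<And>u. 0 \<le> u \<Longrightarrow> u \<le> 1 \<Longrightarrow> c (b0, u) = b0"
begin

abbreviation "phom \<equiv> homotopic_with (\<lambda>f. f ` cube_boundary n \<subseteq> D) (cube n) Y"

text \<open>The map \<open>f\<close> is pushed inwards by \<open>squeeze\<close>, and the values on the remaining collar, which lie in \<open>D\<close>, are
  deformed to \<open>b0\<close>: the time of the deformation grows from \<open>0\<close> on the inner side of the collar to \<open>u\<close> on the boundary.\<close>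
definition collar :: "real \<Rightarrow> ((nat \<Rightarrow> real) \<Rightarrow> 'y) \<Rightarrow> (nat \<Rightarrow> real) \<Rightarrow> 'y" where
  "collar u f x = (if 2 * (1 + u) * depth n x \<le> u then c (f (squeeze n u x), u - 2 * (1 + u) * depth n x)
     else f (squeeze n u x))"

lemma phomI:
  assumes "continuous_map (prod_topology (top_of_set {0..1::real}) (cube n)) Y h"
    "\<And>x. x \<in> topspace (cube n) \<Longrightarrow> h (0, x) = f x" "\<And>x. x \<in> topspace (cube n) \<Longrightarrow> h (1, x) = g x"
    "\<And>t a. 0 \<le> t \<Longrightarrow> t \<le> 1 \<Longrightarrow> a \<in> cube_boundary n \<Longrightarrow> h (t, a) \<in> D"
  shows "phom f g"
proof (subst homotopic_with)
  show "(h ` cube_boundary n \<subseteq> D) = (k ` cube_boundary n \<subseteq> D)"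
    if "\<And>x. x \<in> topspace (cube n) \<Longrightarrow> h x = k x" for h k
    using that cube_boundary_sub by (metis image_cong subsetD)
qed (rule exI[of _ h], use assms in auto)

lemma phomE:
  assumes "phom f g"
  obtains h where "continuous_map (prod_topology (top_of_set {0..1::real}) (cube n)) Y h"
    "\<And>x. h (0, x) = f x" "\<And>x. h (1, x) = g x" "\<And>t a. 0 \<le> t \<Longrightarrow> t \<le> 1 \<Longrightarrow> a \<in> cube_boundary n \<Longrightarrow> h (t, a) \<in> D"
proof -
  obtain h where h: "continuous_map (prod_topology (top_of_set {0..1::real}) (cube n)) Y h"
    "\<forall>x. h (0, x) = f x" "\<forall>x. h (1, x) = g x" "\<forall>t\<in>{0..1}. (\<lambda>x. h (t, x)) ` cube_boundary n \<subseteq> D"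
    using assms unfolding homotopic_with_def by blast
  show thesis by (rule that[of h]) (use h in \<open>auto simp: image_subset_iff\<close>)
qed

lemma phom_cube_homotopic:
  assumes "cube_homotopic n Y b0 f g" shows "phom f g"
  using assms unfolding cube_homotopic_def by (rule homotopic_with_mono) (use b0 in auto)

lemma collar_cond:
  assumes "x \<in> topspace (cube n)" "0 \<le> u" "u \<le> 1" "2 * (1 + u) * depth n x \<le> u"
  shows "0 \<le> u - 2 * (1 + u) * depth n x" "u - 2 * (1 + u) * depth n x \<le> 1"
proof -
  have "0 \<le> 2 * (1 + u) * depth n x" using depth_nonneg[OF assms(1)] assms(2) by simp
  then show "0 \<le> u - 2 * (1 + u) * depth n x" "u - 2 * (1 + u) * depth n x \<le> 1"
    using assms(3,4) by linarith+
qed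

lemma collar_continuous:
  assumes h: "continuous_map (prod_topology Z (cube n)) Y h"
    and hD: "\<And>z a. z \<in> topspace Z \<Longrightarrow> a \<in> cube_boundary n \<Longrightarrow> h (z, a) \<in> D"
    and \<zeta>: "continuous_map X Z \<zeta>" and \<xi>: "continuous_map X (cube n) \<xi>"
    and \<upsilon>: "continuous_map X (top_of_set {0..1::real}) \<upsilon>"
  shows "continuous_map X Y (\<lambda>x. collar (\<upsilon> x) (\<lambda>y. h (\<zeta> x, y)) (\<xi> x))"
  unfolding collar_def
proof (rule continuous_map_cases_le)
  have \<upsilon>': "continuous_map X euclideanreal \<upsilon>" "\<And>x. x \<in> topspace X \<Longrightarrow> 0 \<le> \<upsilon> x \<and> \<upsilon> x \<le> 1"
    using \<upsilon> by (auto simp: continuous_map_in_subtopology)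
  have \<xi>C: "\<xi> x \<in> topspace (cube n)" if "x \<in> topspace X" for x using continuous_map_in[OF \<xi> that] .
  show dc: "continuous_map X euclideanreal (\<lambda>x. 2 * (1 + \<upsilon> x) * depth n (\<xi> x))"
    by (intro continuous_map_real_mult continuous_map_add \<upsilon>' continuous_map_depth[OF \<xi>]) auto
  show "continuous_map X euclideanreal \<upsilon>" by (rule \<upsilon>')
  have main: "continuous_map X Y (\<lambda>x. h (\<zeta> x, squeeze n (\<upsilon> x) (\<xi> x)))"
    by (intro continuous_map_compose2[OF h] continuous_map_pairedI \<zeta> continuous_map_squeeze[OF \<xi> \<upsilon>'(1)])
  then show "continuous_map (subtopology X {x \<in> topspace X. \<upsilon> x \<le> 2 * (1 + \<upsilon> x) * depth n (\<xi> x)}) Y (\<lambda>x. h (\<zeta> x, squeeze n (\<upsilon> x) (\<xi> x)))"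
    by (rule continuous_map_from_subtopology)
  have bd: "h (\<zeta> x, squeeze n (\<upsilon> x) (\<xi> x)) \<in> D" if "x \<in> topspace X" "2 * (1 + \<upsilon> x) * depth n (\<xi> x) \<le> \<upsilon> x" for x
    using hD[OF continuous_map_in[OF \<zeta> that(1)] squeeze_boundary[OF _ _ that(2)]] \<upsilon>'(2)[OF that(1)] by blast
  let ?S = "{x \<in> topspace X. 2 * (1 + \<upsilon> x) * depth n (\<xi> x) \<le> \<upsilon> x}"
  show "continuous_map (subtopology X ?S) Y
     (\<lambda>x. c (h (\<zeta> x, squeeze n (\<upsilon> x) (\<xi> x)), \<upsilon> x - 2 * (1 + \<upsilon> x) * depth n (\<xi> x)))"
  proof (rule continuous_map_compose2[OF c_cont], rule continuous_map_pairedI)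
    show "continuous_map (subtopology X ?S) (subtopology Y D) (\<lambda>x. h (\<zeta> x, squeeze n (\<upsilon> x) (\<xi> x)))"
      using bd continuous_map_from_subtopology[OF main] by (auto simp: continuous_map_in_subtopology)
    have "continuous_map X euclideanreal (\<lambda>x. \<upsilon> x - 2 * (1 + \<upsilon> x) * depth n (\<xi> x))"
      by (intro continuous_map_diff \<upsilon>'(1) dc)
    from continuous_map_from_subtopology[OF this, of ?S]
    show "continuous_map (subtopology X ?S) (top_of_set {0..1::real}) (\<lambda>x. \<upsilon> x - 2 * (1 + \<upsilon> x) * depth n (\<xi> x))"
      using collar_cond[OF \<xi>C] \<upsilon>'(2) by (auto simp: continuous_map_in_subtopology)
  qed
  show "c (h (\<zeta> x, squeeze n (\<upsilon> x) (\<xi> x)), \<upsilon> x - 2 * (1 + \<upsilon> x) * depth n (\<xi> x)) = h (\<zeta> x, squeeze n (\<upsilon> x) (\<xi> x))"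
    if "x \<in> topspace X" "2 * (1 + \<upsilon> x) * depth n (\<xi> x) = \<upsilon> x" for x
    using c_0[OF bd[OF that(1)]] that(2) by simp
qed

lemma collar_boundary:
  assumes "\<And>a. a \<in> cube_boundary n \<Longrightarrow> f a \<in> D" "0 \<le> u" "u \<le> 1" "a \<in> cube_boundary n"
  shows "squeeze n u a \<in> cube_boundary n" "collar u f a = c (f (squeeze n u a), u)" "collar u f a \<in> D"
proof -
  have d: "depth n a = 0" by (rule depth_boundary[OF assms(4)])
  show s: "squeeze n u a \<in> cube_boundary n" using squeeze_boundary[OF assms(2,3), of n a] d assms(2) by simp
  show e: "collar u f a = c (f (squeeze n u a), u)" using d assms(2) by (simp add: collar_def)
  show "collar u f a \<in> D" unfolding e by (rule c_D[OF assms(1)[OF s] assms(2,3)])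
qed

lemma collar_0:
  assumes "\<And>a. a \<in> cube_boundary n \<Longrightarrow> f a \<in> D" "x \<in> topspace (cube n)"
  shows "collar 0 f x = f x"
  using squeeze_boundary[of 0 n x] squeeze_0[OF assms(2)] c_0[OF assms(1)] depth_nonneg[OF assms(2)]
  by (auto simp: collar_def)

lemma collar_homotopy:
  assumes f: "continuous_map (cube n) Y f"
  and fD: "\<And>a. a \<in> cube_boundary n \<Longrightarrow> f a \<in> D"
  shows "continuous_map (prod_topology (top_of_set {0..1::real}) (cube n)) Y (\<lambda>y. collar (fst y) f (snd y))"
proof -
  let ?X = "prod_topology (top_of_set {0..1::real}) (cube n)"
  have h: "continuous_map ?X Y (\<lambda>y. f (snd y))"
    by (rule continuous_map_compose2[OF f continuous_map_snd])
  show ?thesis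
    using collar_continuous[OF h _ continuous_map_fst continuous_map_snd continuous_map_fst] fD by simp
qed

text \<open>The family \<open>collar u f\<close> deforms \<open>f\<close> as a map of pairs.\<close>
lemma collar_1:
  assumes f: "continuous_map (cube n) Y f" and fD: "\<And>a. a \<in> cube_boundary n \<Longrightarrow> f a \<in> D"
  shows "collar 1 f \<in> cube_maps n Y b0" "phom f (collar 1 f)"
proof -
  note h = collar_homotopy[OF f fD]
  have "continuous_map (cube n) (prod_topology (top_of_set {0..1::real}) (cube n)) (\<lambda>x. (1, x))"
    by (intro continuous_map_pairedI) auto
  from continuous_map_compose2[OF h this] have "continuous_map (cube n) Y (collar 1 f)" by simp
  moreover have "collar 1 f a = b0" if "a \<in> cube_boundary n" for a
    using collar_boundary(1,2)[of f 1 a] that c_1 fD by simp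
  ultimately show "collar 1 f \<in> cube_maps n Y b0" by (simp add: cube_maps_def)
  show "phom f (collar 1 f)"
    by (rule phomI[OF h]) (use collar_0[OF fD] collar_boundary(3)[OF fD] in auto)
qed

text \<open>If \<open>f\<close> is already constant on the boundary, the same family is a homotopy relative to the boundary,
  because \<open>b0\<close> stays fixed.\<close>
lemma cube_homotopic_collar:
  assumes f: "f \<in> cube_maps n Y b0"
  shows "cube_homotopic n Y b0 f (collar 1 f)"
proof -
  have fc: "continuous_map (cube n) Y f" and fb: "\<And>a. a \<in> cube_boundary n \<Longrightarrow> f a = b0" using f by (auto simp: cube_maps_def)
  then have fD: "\<And>a. a \<in> cube_boundary n \<Longrightarrow> f a \<in> D" using b0 by simp
  show ?thesis
    by (rule cube_homotopicI[OF collar_homotopy[OF fc fD]])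
       (use collar_0[OF fD] collar_boundary(1,2)[OF fD] fb c_b0 in auto)
qed

text \<open>Applying \<open>collar 1\<close> to every stage of a homotopy of pairs makes it constant on the boundary.\<close>
lemma cube_homotopic_phom:
  assumes f: "f \<in> cube_maps n Y b0" and g: "g \<in> cube_maps n Y b0" and fg: "phom f g"
  shows "cube_homotopic n Y b0 f g"
proof -
  let ?I = "top_of_set {0..1::real}"
  obtain h where h: "continuous_map (prod_topology ?I (cube n)) Y h"
    "\<And>x. h (0, x) = f x" "\<And>x. h (1, x) = g x" "\<And>t a. 0 \<le> t \<Longrightarrow> t \<le> 1 \<Longrightarrow> a \<in> cube_boundary n \<Longrightarrow> h (t, a) \<in> D"
    using phomE[OF fg] by blast
  have "continuous_map (prod_topology ?I (cube n)) ?I (\<lambda>_. 1)" by simp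
  from collar_continuous[OF h(1) _ continuous_map_fst continuous_map_snd this]
  have k: "continuous_map (prod_topology ?I (cube n)) Y (\<lambda>y. collar 1 (\<lambda>x. h (fst y, x)) (snd y))" using h(4) by simp
  have "cube_homotopic n Y b0 (collar 1 f) (collar 1 g)"
  proof (rule cube_homotopicI[OF k])
    show "collar 1 (\<lambda>x. h (fst (t, a), x)) (snd (t, a)) = b0" if "0 \<le> t" "t \<le> 1" "a \<in> cube_boundary n" for t a
      using collar_boundary[of "\<lambda>x. h (t, x)" 1 a] h(4)[OF that(1,2)] that(3) c_1 by simp
  qed (simp_all add: h)
  then show ?thesis
    using cube_homotopic_collar[OF f] cube_homotopic_collar[OF g] by (meson cube_homotopic_sym cube_homotopic_trans)
qed

text \<open>The two collar deformations agree along the seam, since on the boundary they depend only on the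
  value of the map at the expanded point.\<close>
lemma phom_concat:
  assumes f: "continuous_map (cube n) Y f" "\<And>a. a \<in> cube_boundary n \<Longrightarrow> f a \<in> D"
    and g: "continuous_map (cube n) Y g" "\<And>a. a \<in> cube_boundary n \<Longrightarrow> g a \<in> D"
    and seam: "\<And>x. x \<in> topspace (cube n) \<Longrightarrow> x 0 = 1 \<Longrightarrow> f x = g (x(0 := 0))"
    and f': "f' \<in> cube_maps n Y b0" "phom f f'" and g': "g' \<in> cube_maps n Y b0" "phom g g'"
  shows "phom (concat_map f g) (concat_map f' g')"
proof -
  let ?I = "top_of_set {0..1::real}"
  let ?H = "\<lambda>y :: real \<times> (nat \<Rightarrow> real). concat_map (\<lambda>x. (\<lambda>y. collar (fst y) f (snd y)) (fst y, x)) (\<lambda>x. (\<lambda>y. collar (fst y) g (snd y)) (fst y, x)) (snd y)"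
  have face: "x \<in> cube_boundary n" "x(0 := 0) \<in> cube_boundary n" if "x \<in> topspace (cube n)" "x 0 = 1" for x
    using that n cubeD[OF that(1)] by (auto simp: cube_boundary_def intro!: exI[of _ 0] cubeI)
  have 1: "continuous_map (prod_topology ?I (cube n)) Y ?H"
  proof (rule concat_map_continuous[OF n collar_homotopy[OF f] collar_homotopy[OF g]])
    fix u :: real and x assume u: "u \<in> topspace ?I" and x: "x \<in> topspace (cube n)" "x 0 = 1"
    have u': "0 \<le> u" "u \<le> 1" using u by auto
    have "squeeze n u x 0 = 1" "squeeze n u (x(0 := 0)) = (squeeze n u x)(0 := 0)"
      using squeeze_face[OF u', of 0 n x] n x(2) u' by (auto simp: squeeze_def)
    then have "f (squeeze n u x) = g (squeeze n u (x(0 := 0)))"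
      using seam[OF squeeze_in, of u x] by simp
    then show "(\<lambda>y. collar (fst y) f (snd y)) (u, x) = (\<lambda>y. collar (fst y) g (snd y)) (u, x(0 := 0))"
      using collar_boundary(2)[OF f(2) u' face(1)[OF x]] collar_boundary(2)[OF g(2) u' face(2)[OF x]] by simp
  qed
  have cm: "concat_map p q x = concat_map p' q' x"
    if "\<And>x. x \<in> topspace (cube n) \<Longrightarrow> p x = p' x" "\<And>x. x \<in> topspace (cube n) \<Longrightarrow> q x = q' x" "x \<in> topspace (cube n)"
    for p q p' q' and x
    using that(1)[OF from_half_in[OF n, of x False]] that(2)[OF from_half_in[OF n, of x True]] that(3)
    by (auto simp: concat_map_def half_cube_def)
  have "phom (concat_map f g) (concat_map (collar 1 f) (collar 1 g))"
  proof (rule phomI[OF 1])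
    show "?H (0, x) = concat_map f g x" if "x \<in> topspace (cube n)" for x
      using cm[OF collar_0[OF f(2)] collar_0[OF g(2)] that] by simp
    show "?H (t, a) \<in> D" if "0 \<le> t" "t \<le> 1" "a \<in> cube_boundary n" for t a
      using concat_map_boundary[OF n that(3), of "collar t f" D "collar t g"]
        collar_boundary(3)[OF f(2) that(1,2)] collar_boundary(3)[OF g(2) that(1,2)] by simp
  qed simp
  moreover have "cube_homotopic n Y b0 (collar 1 f) f'" "cube_homotopic n Y b0 (collar 1 g) g'"
    using cube_homotopic_phom[OF collar_1(1)[OF f] f'(1)] cube_homotopic_phom[OF collar_1(1)[OF g] g'(1)]
      collar_1(2)[OF f] collar_1(2)[OF g] f'(2) g'(2) by (meson homotopic_with_sym homotopic_with_trans)+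
  then have "phom (concat_map (collar 1 f) (collar 1 g)) (concat_map f' g')"
    by (intro phom_cube_homotopic cube_homotopic_concat[OF n])
  ultimately show ?thesis by (rule homotopic_with_trans)
qed

end

section \<open>The isomorphism\<close>

definition base_vertex :: "('o, 'a) groupoid_data \<Rightarrow> 'o \<Rightarrow> nat \<Rightarrow> real \<times> 'a" where
  "base_vertex G a0 = (\<lambda>i. join_point (if i = 0 then 1 else 0) (gid G a0))"

lemma pointed_bundle_mono:
  assumes "pointed_bundle G a0 B A P" "A' \<subseteq> A"
  shows "pointed_bundle G a0 B A' P"
proof (rule pointed_bundleI)
  note P = pointed_bundleD[OF assms(1)]
  show "A' \<subseteq> topspace B" "principal_bundle G B P" using P(1,2) assms(2) by auto
  show "anchor P (sect P a) = a0" if "a \<in> A'" for a using P(4) assms(2) that by blast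
  show "\<exists>V s. openin B V \<and> b \<in> V \<and> local_section B P V s \<and> (\<forall>a\<in>V \<inter> A'. s a = sect P a)" if "b \<in> topspace B" for b
    using P(7)[OF that] assms(2) by blast
qed

lemma bundle_map_mono: "bundle_map G A P Q F f \<Longrightarrow> A' \<subseteq> A \<Longrightarrow> bundle_map G A' P Q F f"
  unfolding bundle_map_def by blast

context topological_groupoid
begin

lemma base_vertex:
  assumes a0: "a0 \<in> topspace (Obj G)"
  shows "base_vertex G a0 \<in> milnor_simplex G a0"
proof -
  have "base_vertex G a0 \<in> milnor_set G"
    by (rule milnor_setI(1)[of "{0}" _ G a0]) (use a0 in \<open>auto simp: base_vertex_def join_point_def split: if_splits\<close>)
  then show ?thesis by (auto simp: milnor_simplex_def base_vertex_def join_point_def split: if_splits)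
qed

lemma basepoint_eq: "classifying_basepoint G a0 = milnor_orbit G (base_vertex G a0)"
  by (simp add: classifying_basepoint_def base_vertex_def)

text \<open>All points of the simplex are compatible, so it contracts linearly to its first vertex.\<close>
lemma simplex_contraction:
  assumes a0: "a0 \<in> topspace (Obj G)" and n: "n \<ge> 1"
  shows "pair_contraction (classifying_space G) (orbit_simplex G a0) (classifying_basepoint G a0)
    (\<lambda>z. milnor_orbit G (blend (snd z) (sect (milnor_bundle G a0) (fst z)) (base_vertex G a0))) n"
proof -
  let ?Y = "classifying_space G" and ?D = "orbit_simplex G a0" and ?e = "base_vertex G a0"
  let ?s = "sect (milnor_bundle G a0)"
  have comp: "compatible G e e'" if "e \<in> milnor_simplex G a0" "e' \<in> milnor_simplex G a0" for e e'
    using milnor_simplex_anchor[OF a0] that by (auto simp: compatible_def milnor_simplex_def)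
  have mem: "e \<in> milnor_set G" if "e \<in> milnor_simplex G a0" for e using that by (simp add: milnor_simplex_def)
  note e = base_vertex[OF a0]
  have b: "blend u x ?e \<in> milnor_simplex G a0" if "x \<in> milnor_simplex G a0" "0 \<le> u" "u \<le> 1" for u x
    using blend(1)[OF mem[OF that(1)] mem[OF e] comp[OF that(1) e] that(2,3)] that(1) e
    by (auto simp: milnor_simplex_def blend_def join_point_def)
  note s = milnor_sect_in
  show ?thesis
  proof
    let ?X = "prod_topology (subtopology ?Y ?D) (top_of_set {0..1::real})"
    have sc: "continuous_map (subtopology ?Y ?D) (milnor_total G) ?s"
      using pointed_bundleD(3)[OF pointed_milnor_bundle[OF a0]] by (simp add: local_section_def)
    have "continuous_map ?X (milnor_total G) (\<lambda>z. blend (snd z) (?s (fst z)) ?e)"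
    proof (rule continuous_map_blend[OF continuous_map_compose2[OF sc continuous_map_fst] _ continuous_map_snd])
      show "continuous_map ?X (milnor_total G) (\<lambda>z. ?e)" using mem[OF e] by simp
      show "compatible G (?s (fst z)) ?e" if "z \<in> topspace ?X" for z
        using that by (intro comp s(1) e) auto
    qed
    from continuous_map_compose2[OF quotient_imp_continuous_map[OF quotient_map_milnor_orbit] this]
    show "continuous_map ?X ?Y (\<lambda>z. milnor_orbit G (blend (snd z) (?s (fst z)) ?e))" .
    show "?D \<subseteq> topspace ?Y" by (rule pointed_bundleD(1)[OF pointed_milnor_bundle[OF a0]])
    show "classifying_basepoint G a0 \<in> ?D" using e by (simp add: basepoint_eq orbit_simplex_def)
    fix u :: real assume u: "0 \<le> u" "u \<le> 1"
    have "blend u ?e ?e = ?e"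
    proof
      fix i show "blend u ?e ?e i = ?e i"
        by (auto simp: blend_def base_vertex_def join_point_def)
    qed
    then show "milnor_orbit G (blend (snd (classifying_basepoint G a0, u)) (?s (fst (classifying_basepoint G a0, u))) ?e) = classifying_basepoint G a0"
      using milnor_sect[OF a0 e] by (simp add: basepoint_eq)
    fix d assume d: "d \<in> ?D"
    show "milnor_orbit G (blend (snd (d, u)) (?s (fst (d, u))) ?e) \<in> ?D"
      using b[OF s(1)[OF d] u] by (simp add: orbit_simplex_def)
  next
    fix d assume d: "d \<in> ?D"
    note be = blend_end[OF mem[OF s(1)[OF d]] mem[OF e] comp[OF s(1)[OF d] e]]
    show "milnor_orbit G (blend (snd (d, 0)) (?s (fst (d, 0))) ?e) = d"
      "milnor_orbit G (blend (snd (d, 1)) (?s (fst (d, 1))) ?e) = classifying_basepoint G a0"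
      using be s(2)[OF d] by (simp_all add: basepoint_eq)
  qed (rule n)
qed

lemma trivial_classifying:
  assumes a0: "a0 \<in> topspace (Obj G)"
  shows "bundle_map G A (trivial_bundle G a0 B) (milnor_bundle G a0)
    (\<lambda>z. milnor_act G (base_vertex G a0) (snd z)) (\<lambda>_. classifying_basepoint G a0)"
proof -
  let ?e = "base_vertex G a0" and ?T = "trivial_bundle G a0 B"
  have e: "?e \<in> milnor_set G" "milnor_anchor G ?e = a0"
    using base_vertex[OF a0] milnor_simplex_anchor[OF a0] by (auto simp: milnor_simplex_def)
  have "continuous_map (tot ?T) (milnor_total G) (\<lambda>z. milnor_act G ?e (snd z))"
  proof (rule continuous_map_milnor_act)
    show "continuous_map (tot ?T) (Arr G) snd"
      using continuous_map_snd[of B "subtopology (Arr G) {g. tgt G g = a0}"] continuous_map_into_fulltopology by auto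
  qed (use e in auto)
  then show ?thesis
    unfolding bundle_map_def
    using e milnor_act[OF e(1)] milnor_act_act[OF e(1)] milnor_orbit_act[OF e(1)] milnor_act_id[OF e(1)]
      milnor_sect[OF a0 base_vertex[OF a0]]
    by (auto simp: basepoint_eq)
qed

text \<open>The inclusion of a piece composed with a classifying map of the concatenation classifies the piece.
  As the seam belongs to the set on which the section is prescribed, this respects the sections on the
  whole boundary of the piece.\<close>
lemma concat_classifying:
  fixes P Q :: "('p, 'o, 'a, nat \<Rightarrow> real) gbundle"
  assumes a0: "a0 \<in> topspace (Obj G)" and n: "n \<ge> 1"
    and P: "pointed_bundle G a0 (cube n) (cube_boundary n) P"
    and Q: "pointed_bundle G a0 (cube n) (cube_boundary n) Q"
  obtains F F1 F2 f g where "pointed_bundle G a0 (cube n) (cube_boundary n) (concat_bundle G n P Q)"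
    "bundle_map G (cube_boundary n) (concat_bundle G n P Q) (milnor_bundle G a0) F (concat_map f g)"
    "bundle_map G (cube_boundary n) P (milnor_bundle G a0) F1 f"
    "bundle_map G (cube_boundary n) Q (milnor_bundle G a0) F2 g"
    "concat_map f g ` cube_boundary n \<subseteq> orbit_simplex G a0"
    "f ` cube_boundary n \<subseteq> orbit_simplex G a0" "g ` cube_boundary n \<subseteq> orbit_simplex G a0"
    "\<And>x. x \<in> topspace (cube n) \<Longrightarrow> x 0 = 1 \<Longrightarrow> f x = g (x(0 := 0))"
proof -
  interpret bundle_pair G a0 n P Q by unfold_locales (rule a0 n P Q)+
  let ?U = "milnor_bundle G a0"
  have sub: "cube_boundary n \<subseteq> concat_sections n"
    using cube_boundary_sub by (auto simp: concat_sections_def)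
  obtain F k where F: "bundle_map G (concat_sections n) T ?U F k" "k ` concat_sections n \<subseteq> orbit_simplex G a0"
    using classifying_map_exists[OF a0 pointed_concat compact_space_cube completely_regular_space_cube] by blast
  define f where "f = (\<lambda>x. k (to_half False x))"
  define g where "g = (\<lambda>x. k (to_half True x))"
  have k: "k = concat_map f g"
    by (rule ext) (simp add: concat_map_def f_def g_def)
  have m: "bundle_map G (cube_boundary n) (piece l) ?U (\<lambda>p. F (cls (l, p))) (\<lambda>x. k (to_half l x))" for l
    by (rule bundle_map_compose[OF bundle_map_cls F(1)]) (use to_half_boundary[OF n] in auto)
  show thesis
  proof (rule that)
    show "pointed_bundle G a0 (cube n) (cube_boundary n) (concat_bundle G n P Q)"
      using pointed_bundle_mono[OF pointed_concat sub] by (simp add: T_def)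
    show "bundle_map G (cube_boundary n) (concat_bundle G n P Q) ?U F (concat_map f g)"
      using bundle_map_mono[OF F(1) sub] unfolding k T_def .
    show "bundle_map G (cube_boundary n) P ?U (\<lambda>p. F (cls (False, p))) f"
      "bundle_map G (cube_boundary n) Q ?U (\<lambda>p. F (cls (True, p))) g"
      using m[of False] m[of True] by (simp_all add: piece_def f_def g_def)
    show "concat_map f g ` cube_boundary n \<subseteq> orbit_simplex G a0" using F(2) sub unfolding k by blast
    show "f ` cube_boundary n \<subseteq> orbit_simplex G a0" "g ` cube_boundary n \<subseteq> orbit_simplex G a0"
      using F(2) to_half_boundary[OF n] by (auto simp: f_def g_def)
    show "f x = g (x(0 := 0))" if "x 0 = 1" for x
      using that by (simp add: f_def g_def to_half_def)
  qed
qed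

end

theorem mainTheorem1:
  fixes G :: "('o, 'a) groupoid_data" and a0 :: 'o and n :: nat
  assumes "topological_groupoid G"
    and "a0 \<in> topspace (Obj G)"
    and "n \<ge> 1"
  shows "group (groupoid_homotopy_group G a0 n) \<and>
    group (homotopy_group n (classifying_space G) (classifying_basepoint G a0)) \<and>
    groupoid_homotopy_group G a0 n \<cong>
      homotopy_group n (classifying_space G) (classifying_basepoint G a0)"
proof -
  interpret topological_groupoid G by fact
  note a0 = assms(2) and n = assms(3)
  let ?Y = "classifying_space G" and ?b = "classifying_basepoint G a0" and ?U = "milnor_bundle G a0"
  let ?D = "orbit_simplex G a0" and ?B = "cube_boundary n"
  interpret pair_contraction ?Y ?D ?b
    "\<lambda>z. milnor_orbit G (blend (snd z) (sect (milnor_bundle G a0) (fst z)) (base_vertex G a0))" n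
    by (rule simplex_contraction[OF a0 n])
  let ?M = "cube_bundles G a0 n" and ?N = "cube_maps n ?Y ?b"
  let ?hom = "bundle_homotopic G a0 (cube n) ?B"
  note U = pointed_milnor_bundle[OF a0]
  note cc = compact_space_cube[of n] completely_regular_space_cube[of n]
  have pbM: "pointed_bundle G a0 (cube n) ?B R" if "R \<in> ?M" for R using that by (simp add: cube_bundles_def)
  have bmap: "continuous_map (cube n) ?Y k"
    if "bundle_map G ?B R ?U F k" "pointed_bundle G a0 (cube n) ?B R"
    for F k and R :: "('r, 'o, 'a, nat \<Rightarrow> real) gbundle"
    by (rule bundle_map_base_continuous[OF pointed_bundleD(2)[OF that(2)] pointed_bundleD(2)[OF U] that(1)])
  \<comment> \<open>A bundle and a map of cubes correspond if the map is, as a map of pairs, homotopic to a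
    classifying map of the bundle.\<close>
  define rel where "rel R f \<longleftrightarrow> (\<exists>F k. bundle_map G ?B R ?U F k \<and> k ` ?B \<subseteq> ?D \<and> phom k f)"
    for R :: "('o, 'a) cube_bundle" and f
  have grp: "group (homotopy_group n ?Y ?b)"
    by (rule group_homotopy_group[OF n]) (use b0 DY in blast)
  have homotopic_iff: "?hom P R \<longleftrightarrow> cube_homotopic n ?Y ?b f g"
    if P: "pointed_bundle G a0 (cube n) ?B P" "bundle_map G ?B P ?U F k" "k ` ?B \<subseteq> ?D" "phom k f" "f \<in> ?N"
      and R: "R \<in> ?M" "rel R g" "g \<in> ?N"
    for P :: "('p, 'o, 'a, nat \<Rightarrow> real) gbundle" and R F k f g
  proof -
    obtain F' k' where R': "bundle_map G ?B R ?U F' k'" "k' ` ?B \<subseteq> ?D" "phom k' g"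
      using R(2) unfolding rel_def by blast
    have "?hom P R \<longleftrightarrow> phom k k'"
      using homotopy_of_bundle_homotopic[OF a0 _ cube_boundary_sub cc P(2,3) R'(1,2)]
        bundle_homotopic_of_homotopy[OF U P(1) pbM[OF R(1)] P(2) R'(1)] by blast
    also have "\<dots> \<longleftrightarrow> phom f g"
      using P(4) R'(3) by (meson homotopic_with_sym homotopic_with_trans)
    also have "\<dots> \<longleftrightarrow> cube_homotopic n ?Y ?b f g"
      using cube_homotopic_phom[OF P(5) R(3)] phom_cube_homotopic by blast
    finally show ?thesis .
  qed
  have "group (groupoid_homotopy_group G a0 n) \<and> groupoid_homotopy_group G a0 n \<cong> homotopy_group n ?Y ?b"
  proof (rule iso_of_classes[where M = ?M and N = ?N and s = "cube_homotopic n ?Y ?b" and rel = rel,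
        OF _ _ _ _ _ _ _ _ groupoid_homotopy_group_def homotopy_group_def grp])
    fix R assume R: "R \<in> ?M"
    obtain F k where F: "bundle_map G ?B R ?U F k" "k ` ?B \<subseteq> ?D" "continuous_map (cube n) ?Y k"
      using classifying_map_exists[OF a0 pbM[OF R] cc] by blast
    then show "\<exists>f\<in>?N. rel R f"
      using collar_1[OF F(3)] by (auto simp: rel_def image_subset_iff)
  next
    fix f assume f: "f \<in> ?N"
    then have fc: "continuous_map (cube n) ?Y f" "f ` ?B \<subseteq> ?D" using b0 by (auto simp: cube_maps_def)
    obtain R :: "('o, 'a) cube_bundle" and F where R: "pointed_bundle G a0 (cube n) ?B R" "bundle_map G ?B R ?U F f"
      by (rule pullback_recode[OF U fc(1) cube_boundary_sub fc(2)])
    have "phom f f" using fc by simp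
    then have "rel R f" unfolding rel_def using R(2) fc(2) by blast
    moreover have "R \<in> ?M" using R(1) by (simp add: cube_bundles_def)
    ultimately show "\<exists>R\<in>?M. rel R f" by blast
  next
    fix P R f g assume *: "P \<in> ?M" "R \<in> ?M" "f \<in> ?N" "g \<in> ?N" "rel P f" "rel R g"
    then obtain F k where "bundle_map G ?B P ?U F k" "k ` ?B \<subseteq> ?D" "phom k f" unfolding rel_def by blast
    then show "?hom P R \<longleftrightarrow> cube_homotopic n ?Y ?b f g"
      using homotopic_iff[OF pbM[OF *(1)]] * by blast
  next
    fix P Q R f g w
    assume *: "P \<in> ?M" "Q \<in> ?M" "R \<in> ?M" "f \<in> ?N" "g \<in> ?N" "w \<in> ?N" "rel P f" "rel Q g" "rel R w"
    obtain F F1 F2 p q where c: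
      "pointed_bundle G a0 (cube n) ?B (concat_bundle G n P Q)"
      "bundle_map G ?B (concat_bundle G n P Q) ?U F (concat_map p q)"
      "bundle_map G ?B P ?U F1 p" "bundle_map G ?B Q ?U F2 q"
      "concat_map p q ` ?B \<subseteq> ?D" "p ` ?B \<subseteq> ?D" "q ` ?B \<subseteq> ?D"
      "\<And>x. x \<in> topspace (cube n) \<Longrightarrow> x 0 = 1 \<Longrightarrow> p x = q (x(0 := 0))"
      by (rule concat_classifying[OF a0 n pbM[OF *(1)] pbM[OF *(2)]]) (rule that; assumption)
    have ph: "phom k f" if rf: "rel R f" "R \<in> ?M" "bundle_map G ?B R ?U F k" "k ` ?B \<subseteq> ?D" for R f F k
    proof -
      obtain F' k' where k': "bundle_map G ?B R ?U F' k'" "k' ` ?B \<subseteq> ?D" "phom k' f"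
        using rf(1) unfolding rel_def by blast
      show ?thesis
        by (rule homotopic_with_trans[OF classifying_map_unique[OF a0 pbM[OF rf(2)] cc(1) rf(3,4) k'(1,2)] k'(3)])
    qed
    have "phom (concat_map p q) (concat_map f g)"
      by (rule phom_concat[OF bmap[OF c(3) pbM[OF *(1)]] _ bmap[OF c(4) pbM[OF *(2)]] _ c(8) *(4) ph[OF *(7,1) c(3,6)] *(5) ph[OF *(8,2) c(4,7)]])
         (use c(6,7) in auto)
    then show "?hom (concat_bundle G n P Q) R \<longleftrightarrow> cube_homotopic n ?Y ?b (concat_map f g) w"
      by (rule homotopic_iff[OF c(1,2,5) _ cube_maps_concat[OF n *(4,5)] *(3,9,6)])
  next
    fix R w assume *: "R \<in> ?M" "w \<in> ?N" "rel R w"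
    have const: "(\<lambda>_. ?b) \<in> ?N" using b0 DY by (auto simp: cube_maps_def)
    have cD: "(\<lambda>_. ?b) ` ?B \<subseteq> ?D" using b0 by blast
    have "phom (\<lambda>_. ?b) (\<lambda>_. ?b)" using const cD by (simp add: cube_maps_def)
    then show "?hom (trivial_bundle G a0 (cube n)) R \<longleftrightarrow> cube_homotopic n ?Y ?b (\<lambda>_. ?b) w"
      by (rule homotopic_iff[OF pointed_trivial[OF a0 cube_boundary_sub] trivial_classifying[OF a0] cD _ const *(1,3,2)])
  next
    show "cube_homotopic n ?Y ?b f f" if "f \<in> ?N" for f by (rule cube_homotopic_refl[OF that])
    show "cube_homotopic n ?Y ?b g f" if "cube_homotopic n ?Y ?b f g" for f g by (rule cube_homotopic_sym[OF that])
    show "cube_homotopic n ?Y ?b f h" if "cube_homotopic n ?Y ?b f g" "cube_homotopic n ?Y ?b g h" for f g h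
      by (rule cube_homotopic_trans[OF that])
  qed
  then show ?thesis using grp by blast
qed

end
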